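(* Let $\Phi_1,\Phi_2,\Phi_3\in\mathscr{L}\cup\mathscr{U}$ be such that $\Phi_3^{-1}\sim\Phi_1^{-1}\cdot\Phi_2^{-1}$, where $\Phi_j^{-1}$ denotes the inverse function of $\Phi_j$ for $j\in\{1,2,3\}$. Then for any $F_1\in H^{\Phi_1}(\mathbb{C}_+)$ and $F_2\in H^{\Phi_2}(\mathbb{C}_+)$, the product $F_1\cdot F_2$ belongs to $H^{\Phi_3}(\mathbb{C}_+)$. Conversely, for any $F\in H^{\Phi_3}(\mathbb{C}_+)$ there exist $F_1\in H^{\Phi_1}(\mathbb{C}_+)$ and $F_2\in H^{\Phi_2}(\mathbb{C}_+)$ such that $F=F_1\cdot F_2$ and, moreover, $$\|F\|_{H^{\Phi_3}(\mathbb{C}_+)}^{\mathrm{lux}}\approx\|F_1\|_{H^{\Phi_1}(\mathbb{C}_+)}^{\mathrm{lux}}\cdot\|F_2\|_{H^{\Phi_2}(\mathbb{C}_+)}^{\mathrm{lux}},$$ with constants independent of $F$.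
   Context: A growth function is a nondecreasing $\Phi:[0,\infty)\to[0,\infty)$ with $\lim_{t\to0}\Phi(t)=\Phi(0)=0$, $\Phi(t)>0$ for $t>0$ and $\lim_{t\to\infty}\Phi(t)=\infty$. It is of upper type $p\in(0,\infty)$ (resp. lower type $p\in(0,\infty)$) if there is $C>1$ such that $\Phi(st)\le Ct^p\Phi(s)$ for all $s\ge0$ and all $t\in[1,\infty)$ (resp. $t\in[0,1]$). $\mathscr{U}^p$ ($p\ge1$) is the set of growth functions of upper type $p$ with $t\mapsto\Phi(t)/t$ nondecreasing on $(0,\infty)$; $\mathscr{L}_p$ ($0<p\le1$) is the set of growth functions of lower type $p$ with $t\mapsto\Phi(t)/t$ non-increasing on $(0,\infty)$; $\mathscr{U}=\bigcup_{p\ge1}\mathscr{U}^p$, $\mathscr{L}=\bigcup_{0<p\le1}\mathscr{L}_p$. Standing assumption: every element of $\mathscr{U}$ (resp. $\mathscr{L}$) is continuous, increasing (so that it has an inverse), of class $C^1$ on $(0,\infty)$, and convex (resp. concave). Two positive functions satisfy $\Phi\sim\Psi$ if there is $c>0$ with $c^{-1}\Phi(c^{-1}t)\le\Psi(t)\le c\,\Phi(ct)$ for all $t>0$. For measurable $f:\mathbb{R}\to\mathbb{C}$, $\|f\|_{L^\Phi(\mathbb{R})}^{\mathrm{lux}}=\inf\{\lambda>0:\int_{\mathbb{R}}\Phi(|f(t)|/\lambda)\,dt\le1\}$. $\mathbb{C}_+=\{x+iy:y>0\}$. $H^\Phi(\mathbb{C}_+)$ is the space of holomorphic $F$ on $\mathbb{C}_+$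 with $\|F\|_{H^\Phi(\mathbb{C}_+)}^{\mathrm{lux}}=\sup_{y>0}\|F(\cdot+iy)\|_{L^\Phi(\mathbb{R})}^{\mathrm{lux}}<\infty$. $A\approx B$ means $C^{-1}B\le A\le CB$ for a positive constant $C$ independent of the main parameters (here depending only on the $\Phi_j$). *)

theory Defs
  imports "HOL-Complex_Analysis.Complex_Analysis"
begin

text \<open>
  Functions on \<open>[0,\<infinity>)\<close> are total functions of type \<open>real \<Rightarrow> real\<close>; no notion below
  depends on their values at negative arguments.
\<close>

definition growth_function :: "(real \<Rightarrow> real) \<Rightarrow> bool" where
  "growth_function \<Phi> \<longleftrightarrow>
     mono_on {0..} \<Phi> \<and> \<Phi> 0 = 0 \<and> (\<Phi> \<longlongrightarrow> 0) (at_right 0) \<and>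
     (\<forall>t>0. \<Phi> t > 0) \<and> filterlim \<Phi> at_top at_top"

definition upper_type :: "real \<Rightarrow> (real \<Rightarrow> real) \<Rightarrow> bool" where
  "upper_type p \<Phi> \<longleftrightarrow> (\<exists>C>1. \<forall>s\<ge>0. \<forall>t\<ge>1. \<Phi> (s * t) \<le> C * t powr p * \<Phi> s)"

definition lower_type :: "real \<Rightarrow> (real \<Rightarrow> real) \<Rightarrow> bool" where
  "lower_type p \<Phi> \<longleftrightarrow> (\<exists>C>1. \<forall>s\<ge>0. \<forall>t\<in>{0..1}. \<Phi> (s * t) \<le> C * t powr p * \<Phi> s)"

definition U_type :: "real \<Rightarrow> (real \<Rightarrow> real) set" where
  "U_type p = {\<Phi>. growth_function \<Phi> \<and> upper_type p \<Phi> \<and> mono_on {0<..} (\<lambda>t. \<Phi> t / t)}"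

definition L_type :: "real \<Rightarrow> (real \<Rightarrow> real) set" where
  "L_type p = {\<Phi>. growth_function \<Phi> \<and> lower_type p \<Phi> \<and> antimono_on {0<..} (\<lambda>t. \<Phi> t / t)}"

definition smooth_increasing :: "(real \<Rightarrow> real) \<Rightarrow> bool" where
  "smooth_increasing \<Phi> \<longleftrightarrow>
     continuous_on {0..} \<Phi> \<and> strict_mono_on {0..} \<Phi> \<and> \<Phi> C1_differentiable_on {0<..}"

text \<open>
  The standing assumption that every element of \<open>\<U>\<close> (resp. \<open>\<L>\<close>) is continuous, increasing,
  \<open>C\<^sup>1\<close> on \<open>(0,\<infinity>)\<close> and convex (resp. concave) is made part of the two classes.
\<close>

definition class_U :: "(real \<Rightarrow> real) set" where
  "class_U = {\<Phi> \<in> (\<Union>p\<in>{1..}. U_type p). smooth_increasing \<Phi> \<and> convex_on {0..} \<Phi>}"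

definition class_L :: "(real \<Rightarrow> real) set" where
  "class_L = {\<Phi> \<in> (\<Union>p\<in>{0<..1}. L_type p). smooth_increasing \<Phi> \<and> concave_on {0..} \<Phi>}"

definition growth_inv :: "(real \<Rightarrow> real) \<Rightarrow> real \<Rightarrow> real" where
  "growth_inv \<Phi> = inv_into {0..} \<Phi>"

definition equiv_fun :: "(real \<Rightarrow> real) \<Rightarrow> (real \<Rightarrow> real) \<Rightarrow> bool" (infix "\<sim>\<^sub>g" 50) where
  "\<Phi> \<sim>\<^sub>g \<Psi> \<longleftrightarrow> (\<exists>c>0. \<forall>t>0. inverse c * \<Phi> (inverse c * t) \<le> \<Psi> t \<and> \<Psi> t \<le> c * \<Phi> (c * t))"

text \<open>
  The norms take values in \<open>[0,\<infinity>]\<close>, so that the infimum of the empty set is \<open>\<infinity>\<close>.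
\<close>

definition lux_norm :: "(real \<Rightarrow> real) \<Rightarrow> (real \<Rightarrow> complex) \<Rightarrow> ennreal" where
  "lux_norm \<Phi> f =
     Inf {ennreal r | r. r > 0 \<and> (\<integral>\<^sup>+t. ennreal (\<Phi> (cmod (f t) / r)) \<partial>lborel) \<le> 1}"

definition upper_half_plane :: "complex set" where
  "upper_half_plane = {z. Im z > 0}"

definition hardy_norm :: "(real \<Rightarrow> real) \<Rightarrow> (complex \<Rightarrow> complex) \<Rightarrow> ennreal" where
  "hardy_norm \<Phi> F = (SUP y\<in>{0<..}. lux_norm \<Phi> (\<lambda>x. F (Complex x y)))"

definition hardy_orlicz :: "(real \<Rightarrow> real) \<Rightarrow> (complex \<Rightarrow> complex) set" where
  "hardy_orlicz \<Phi> = {F. F holomorphic_on upper_half_plane \<and> hardy_norm \<Phi> F < \<infinity>}"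

end

theory Submission
  imports Defs "HOL-Probability.Sinc_Integral"
begin

text \<open>
  The product estimate is Young's inequality: if \<open>s = max (\<Phi>\<^sub>1 u) (\<Phi>\<^sub>2 v)\<close>, then
  \<open>u v \<le> \<Phi>\<^sub>1\<^sup>-\<^sup>1(s) \<Phi>\<^sub>2\<^sup>-\<^sup>1(s) \<le> c \<Phi>\<^sub>3\<^sup>-\<^sup>1(c s)\<close>.

  The factorization uses neither boundary values nor Blaschke products. Replace \<open>F\<close> by
  \<open>G(z) = F(z + i\<epsilon>) / (1 - i\<epsilon>z)\<^sup>N\<close>, which is continuous up to the real line and decays, and take outer
  functions \<open>O\<^sub>1\<close>, \<open>O\<^sub>2\<close> whose boundary moduli are essentially \<open>\<Phi>\<^sub>j\<^sup>-\<^sup>1(c \<Phi>\<^sub>3(|G|))\<close>, modified so that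
  only Poisson integrals of continuous functions of compact support occur. The maximum principle
  gives \<open>|G| \<le> c |O\<^sub>1 O\<^sub>2|\<close>, so \<open>G = O\<^sub>1 \<cdot> (G / O\<^sub>1)\<close> is a factorization with \<open>|G / O\<^sub>1| \<le> c |O\<^sub>2|\<close>. A
  Jensen type inequality bounds \<open>\<Phi>\<^sub>j(|O\<^sub>j|)\<close> by the Poisson integral of its boundary values, hence both
  factors in norm, uniformly in \<open>\<epsilon>\<close>. As \<open>\<epsilon> \<rightarrow> 0\<close>, Montel's theorem provides limits of the two factors
  and Fatou's lemma preserves the norm bounds.
\<close>

section \<open>Growth functions of positive lower type\<close>

text \<open>For concave \<open>\<Phi>\<close> the function \<open>\<Phi> (exp x)\<close> need not be
  convex, nor \<open>\<Phi> (cmod F)\<close> subharmonic. Positive lower type makes up for both: it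
  yields the Jensen type inequality and the local bound on \<open>cmod F\<close>. It also exchanges
  a constant outside \<open>\<Phi>\<close> for one inside, which turns uniform bounds on integrals
  into norm bounds.

  Both outer moduli need a positive floor: the wanted boundary modulus may vanish, where it has no
  logarithm, and far away the product of the two must dominate \<open>G\<close>. A floor \<delta> /
  |1 - i \<epsilon> z|^m serves both ends. It is the modulus of an explicit holomorphic function, so
  only a compactly supported rest of the logarithm is left to Poisson integrals. The exponent
  depends on the growth functions alone; \<delta> depends on \<epsilon> and is so small that the
  floor adds at most 1 to each integral. Hence no bound depends on \<epsilon>.

  The zeros of \<open>F\<close> all go into one factor: only the other one is outer, and the
  quotient is bounded by comparing moduli.\<close>

definition admissible :: "(real \<Rightarrow> real) \<Rightarrow> bool" where
  "admissible \<Phi> \<longleftrightarrow> \<Phi> 0 = 0 \<and> strict_mono_on {0..} \<Phi> \<and> continuous_on {0..} \<Phi> \<and>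
     filterlim \<Phi> at_top at_top \<and> (\<exists>p>0. lower_type p \<Phi>)"

text \<open>Both classes meet in positive lower type. In \<open>class_L\<close> it is part of the
  definition; in \<open>class_U\<close> monotonicity of \<open>\<Phi> t / t\<close> gives
  \<open>\<Phi> (s * t) \<le> t * \<Phi> s\<close> for \<open>t \<le> 1\<close>, which is lower type
  1.\<close>

lemma class_L_U_admissible:
  assumes "\<Phi> \<in> class_L \<union> class_U"
  shows "admissible \<Phi>"
proof (cases "\<Phi> \<in> class_L")
  case True
  then show ?thesis
    by (force simp: class_L_def L_type_def admissible_def growth_function_def smooth_increasing_def)
next
  case False
  with assms have U: "\<Phi> \<in> class_U" by auto
  then have gf: "growth_function \<Phi>" and m: "mono_on {0<..} (\<lambda>t. \<Phi> t / t)" and "smooth_increasing \<Phi>"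
    by (auto simp: class_U_def U_type_def)
  \<comment> \<open>The estimate itself has constant 1; \<open>lower_type\<close> asks for one
    strictly above 1, hence the 2.\<close>
  have "\<Phi> (s * t) \<le> 2 * t powr 1 * \<Phi> s" if "s \<ge> 0" "t \<in> {0..1}" for s t
  proof (cases "s = 0 \<or> t = 0")
    case True
    then show ?thesis using gf by (auto simp: growth_function_def)
  next
    case False
    then have pos: "s > 0" "t > 0" "t \<le> 1" using that by auto
    then have "\<Phi> (s * t) / (s * t) \<le> \<Phi> s / s"
      by (intro mono_onD[OF m]) (auto simp: mult_le_cancel_left2)
    then have "\<Phi> (s * t) \<le> t * \<Phi> s" using pos by (simp add: field_simps)
    moreover have "\<Phi> s > 0" using gf pos by (auto simp: growth_function_def)
    then have "t * \<Phi> s \<le> 2 * (t * \<Phi> s)" using pos by simp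
    ultimately have "\<Phi> (s * t) \<le> 2 * (t * \<Phi> s)" by linarith
    then show ?thesis using pos by (simp add: mult.assoc)
  qed
  then have "lower_type 1 \<Phi>" unfolding lower_type_def by (intro exI[of _ 2]) auto
  then show ?thesis using gf \<open>smooth_increasing \<Phi>\<close>
    by (auto simp: admissible_def growth_function_def smooth_increasing_def intro!: exI[of _ 1])
qed

context
  fixes \<Phi> :: "real \<Rightarrow> real"
  assumes adm: "admissible \<Phi>"
begin

lemma admissible_zero: "\<Phi> 0 = 0"
  using adm by (simp add: admissible_def)

lemma admissible_less: "0 \<le> s \<Longrightarrow> s < t \<Longrightarrow> \<Phi> s < \<Phi> t"
  using adm by (auto simp: admissible_def strict_mono_on_def)

lemma admissible_mono: "0 \<le> s \<Longrightarrow> s \<le> t \<Longrightarrow> \<Phi> s \<le> \<Phi> t"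
  using admissible_less[of s t] by (cases "s = t") auto

lemma admissible_pos: "0 < t \<Longrightarrow> 0 < \<Phi> t"
  using admissible_less[of 0 t] admissible_zero by simp

lemma admissible_nonneg: "0 \<le> t \<Longrightarrow> 0 \<le> \<Phi> t"
  using admissible_mono[of 0 t] admissible_zero by simp

lemma admissible_less_cancel: "0 \<le> s \<Longrightarrow> 0 \<le> t \<Longrightarrow> \<Phi> s \<le> \<Phi> t \<longleftrightarrow> s \<le> t"
  using admissible_less admissible_mono by (meson linorder_not_le)

lemma admissible_lower_type:
  obtains p C where "p > 0" "C > 0" "\<And>s t. 0 \<le> s \<Longrightarrow> 0 \<le> t \<Longrightarrow> t \<le> 1 \<Longrightarrow> \<Phi> (s * t) \<le> C * t powr p * \<Phi> s"
  using adm unfolding admissible_def lower_type_def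
  by (metis atLeastAtMost_iff less_trans zero_less_one)

text \<open>Shrinking the argument by \<open>t\<close> gains the factor \<open>C * t powr p\<close>;
  take \<open>t\<close> with \<open>K * C * t powr p \<le> 1\<close> and \<open>k = 1 / t\<close>.
  This is how a constant bound on an integral of \<open>\<Phi>\<close> becomes a constant factor in
  the norm.\<close>

lemma admissible_cmult_le:
  assumes "K > 0"
  obtains k where "k > 0" "\<And>s. 0 \<le> s \<Longrightarrow> K * \<Phi> (s / k) \<le> \<Phi> s"
proof -
  obtain p C where p: "p > 0" "C > 0"
    and lt: "\<And>s t. 0 \<le> s \<Longrightarrow> 0 \<le> t \<Longrightarrow> t \<le> 1 \<Longrightarrow> \<Phi> (s * t) \<le> C * t powr p * \<Phi> s"
    using admissible_lower_type by metis
  define t where "t = min 1 ((1 / (K * C)) powr (1 / p))"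
  have t: "0 < t" "t \<le> 1" using assms p by (auto simp: t_def)
  have "t powr p \<le> ((1 / (K * C)) powr (1 / p)) powr p"
    by (rule powr_mono2) (use p t in \<open>auto simp: t_def\<close>)
  also have "\<dots> = 1 / (K * C)" using p assms by (simp add: powr_powr)
  finally have tp: "K * C * t powr p \<le> 1" using p assms by (simp add: field_simps)
  have "K * \<Phi> (s / (1 / t)) \<le> \<Phi> s" if "0 \<le> s" for s
  proof -
    have "K * \<Phi> (s * t) \<le> K * (C * t powr p * \<Phi> s)"
      using lt[of s t] that t assms by simp
    also have "\<dots> = (K * C * t powr p) * \<Phi> s" by simp
    also have "\<dots> \<le> 1 * \<Phi> s"
      by (rule mult_right_mono[OF tp]) (use admissible_nonneg that in auto)
    finally show ?thesis by simp
  qed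
  then show thesis using that[of "1 / t"] t by simp
qed

lemma admissible_unbounded: obtains B where "B > 0" "\<And>s. 0 \<le> s \<Longrightarrow> \<Phi> s \<le> K \<Longrightarrow> s \<le> B"
proof -
  have "filterlim \<Phi> at_top at_top" using adm by (simp add: admissible_def)
  then obtain B where "\<And>s. s \<ge> B \<Longrightarrow> \<Phi> s \<ge> K + 1"
    by (auto simp: filterlim_at_top eventually_at_top_linorder)
  then have "s \<le> max B 1" if "\<Phi> s \<le> K" for s
    using that by (smt (verit, best))
  then show thesis using that[of "max B 1"] by simp
qed

lemma admissible_continuous_compose:
  "continuous_on S f \<Longrightarrow> (\<And>x. x \<in> S \<Longrightarrow> 0 \<le> f x) \<Longrightarrow> continuous_on S (\<lambda>x. \<Phi> (f x))"
  using adm unfolding admissible_def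
  by (auto intro!: continuous_on_compose2[of "{0..}" \<Phi> S f])

lemma admissible_measurable:
  assumes "f \<in> borel_measurable M" "\<And>x. 0 \<le> f x"
  shows "(\<lambda>x. \<Phi> (f x)) \<in> borel_measurable M"
proof -
  \<comment> \<open>Continuity of \<open>\<Phi>\<close> is known on the half-line only;
    \<open>max 0\<close> produces a function continuous on all reals with the same values
    there.\<close>
  have "continuous_on UNIV (\<lambda>x. \<Phi> (max 0 x))"
    by (intro admissible_continuous_compose continuous_intros) auto
  then have "(\<lambda>x. \<Phi> (max 0 x)) \<in> borel_measurable borel"
    by (rule borel_measurable_continuous_onI)
  from measurable_compose[OF assms(1) this] show ?thesis
    using assms(2) by (simp add: max_absorb2)
qed

section \<open>The inverse of a growth function\<close>

lemma admissible_surj: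
  assumes "0 \<le> s" obtains u where "0 \<le> u" "\<Phi> u = s"
proof -
  obtain B where B: "B > 0" "\<And>u. 0 \<le> u \<Longrightarrow> \<Phi> u \<le> s \<Longrightarrow> u \<le> B"
    using admissible_unbounded[of s] by metis
  then have "s \<le> \<Phi> (B + 1)" by (smt (verit))
  moreover have "continuous_on {0..B+1} \<Phi>"
    using adm unfolding admissible_def by (auto intro: continuous_on_subset)
  ultimately show thesis
    using IVT'[of \<Phi> 0 s "B+1"] B assms that admissible_zero by auto
qed

lemma
  assumes "0 \<le> s"
  shows growth_inv_nonneg: "0 \<le> growth_inv \<Phi> s" and growth_inv_right: "\<Phi> (growth_inv \<Phi> s) = s"
proof -
  have "s \<in> \<Phi> ` {0..}" using admissible_surj[OF assms] by (metis atLeast_iff imageI)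
  then show "0 \<le> growth_inv \<Phi> s" "\<Phi> (growth_inv \<Phi> s) = s"
    unfolding growth_inv_def using inv_into_into[of s \<Phi> "{0..}"] by (auto intro: f_inv_into_f)
qed

lemma growth_inv_left: "0 \<le> u \<Longrightarrow> growth_inv \<Phi> (\<Phi> u) = u"
  using admissible_less_cancel growth_inv_nonneg growth_inv_right
  by (metis admissible_nonneg order_antisym order_refl)

lemma growth_inv_mono: "0 \<le> s \<Longrightarrow> s \<le> t \<Longrightarrow> growth_inv \<Phi> s \<le> growth_inv \<Phi> t"
  by (metis admissible_less_cancel growth_inv_nonneg growth_inv_right order_trans)

text \<open>A continuous injection on a compact set has a continuous inverse, hence the restriction
  to bounded intervals. It is applied to bounded boundary functions, for which this is
  enough.\<close>

lemma growth_inv_continuous: "continuous_on {0..X} (growth_inv \<Phi>)"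
proof (cases "X \<ge> 0")
  case True
  define u where "u = growth_inv \<Phi> X"
  have "continuous_on {0..u} \<Phi>"
    using adm unfolding admissible_def by (auto intro: continuous_on_subset)
  then have "continuous_on (\<Phi> ` {0..u}) (growth_inv \<Phi>)"
    by (rule continuous_on_inv) (auto simp: growth_inv_left)
  moreover have "{0..X} \<subseteq> \<Phi> ` {0..u}"
  proof
    fix s assume "s \<in> {0..X}"
    then show "s \<in> \<Phi> ` {0..u}"
      by (intro image_eqI[of _ _ "growth_inv \<Phi> s"])
        (auto simp: growth_inv_right growth_inv_nonneg growth_inv_mono u_def)
  qed
  ultimately show ?thesis by (rule continuous_on_subset)
qed auto

end

section \<open>Poisson integrals on the upper half-plane\<close>

text \<open>The Poisson kernel of the point \<open>i\<close>. After the substitution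
  \<open>t = x + y * s\<close> this single probability measure represents the kernel of every point
  \<open>x + i y\<close>.\<close>

definition cauchy_measure :: "real measure" where
  "cauchy_measure = density lborel (\<lambda>s. ennreal (1 / (pi * (1 + s\<^sup>2))))"

lemma sets_cauchy_measure [measurable_cong, simp]: "sets cauchy_measure = sets borel"
  by (simp add: cauchy_measure_def)

lemma space_cauchy_measure [simp]: "space cauchy_measure = UNIV"
  by (simp add: cauchy_measure_def)

lemma nn_integral_inverse_1_plus_square: "(\<integral>\<^sup>+s. ennreal (1 / (1 + s\<^sup>2)) \<partial>lborel) = ennreal pi"
proof -
  have "(\<integral>\<^sup>+s. ennreal (1 / (1 + s\<^sup>2)) \<partial>lborel) = ennreal (\<integral>s. 1 / (1 + s\<^sup>2) \<partial>lborel)"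
    using integrable_inverse_1_plus_square
    by (intro nn_integral_eq_integral)
      (auto simp: set_integrable_def inverse_eq_divide)
  also have "(\<integral>s. 1 / (1 + s\<^sup>2) \<partial>lborel) = pi"
    using LBINT_inverse_1_plus_square
    by (simp add: interval_lebesgue_integral_def set_lebesgue_integral_def inverse_eq_divide)
  finally show ?thesis .
qed

lemma prob_space_cauchy_measure: "prob_space cauchy_measure"
proof
  have "emeasure cauchy_measure UNIV = (\<integral>\<^sup>+s. ennreal (1 / pi) * ennreal (1 / (1 + s\<^sup>2)) \<partial>lborel)"
    by (simp add: cauchy_measure_def emeasure_density ennreal_mult''[symmetric])
  also have "\<dots> = ennreal (1 / pi) * ennreal pi"
    by (subst nn_integral_cmult) (auto simp: nn_integral_inverse_1_plus_square)
  also have "\<dots> = 1" by (simp flip: ennreal_mult'')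
  finally show "emeasure cauchy_measure (space cauchy_measure) = 1" by simp
qed

text \<open>At height \<open>y\<close> the Poisson kernel is at most \<open>1 / (pi * y)\<close>,
  here in the form \<open>1 / (1 + s^2) \<le> 1\<close>. The pointwise bounds of order
  \<open>1 / Im z\<close> that produce normal families come from this.\<close>

lemma nn_integral_cauchy_measure_le:
  assumes [measurable]: "h \<in> borel_measurable borel" and "y > 0"
  shows "(\<integral>\<^sup>+s. h (x + y * s) \<partial>cauchy_measure) \<le> ennreal (1 / (pi * y)) * (\<integral>\<^sup>+t. h t \<partial>lborel)"
proof -
  have "(\<integral>\<^sup>+s. h (x + y * s) \<partial>cauchy_measure)
      = (\<integral>\<^sup>+s. ennreal (1 / (pi * (1 + s\<^sup>2))) * h (x + y * s) \<partial>lborel)"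
    unfolding cauchy_measure_def by (subst nn_integral_density) auto
  also have "\<dots> \<le> (\<integral>\<^sup>+s. ennreal (1 / pi) * h (x + y * s) \<partial>lborel)"
    by (intro nn_integral_mono mult_right_mono ennreal_leI divide_left_mono)
      (auto intro!: mult_pos_pos add_pos_nonneg)
  also have "\<dots> = ennreal (1 / pi) * (\<integral>\<^sup>+s. h (x + y * s) \<partial>lborel)"
    by (subst nn_integral_cmult) auto
  also have "(\<integral>\<^sup>+t. h t \<partial>lborel) = ennreal y * (\<integral>\<^sup>+s. h (x + y * s) \<partial>lborel)"
    using nn_integral_real_affine[of h y x] assms by simp
  then have "ennreal (1 / pi) * (\<integral>\<^sup>+s. h (x + y * s) \<partial>lborel)
      = ennreal (1 / (pi * y)) * (\<integral>\<^sup>+t. h t \<partial>lborel)"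
    using assms by (simp add: mult.assoc[symmetric] flip: ennreal_mult'')
  finally show ?thesis .
qed

text \<open>By Fubini, averaging translates against a probability measure preserves the integral
  over the line. Line integrals of outer functions are thereby bounded independently of the
  height.\<close>

lemma nn_integral_cauchy_measure_translate:
  fixes h :: "real \<Rightarrow> ennreal"
  assumes [measurable]: "h \<in> borel_measurable borel"
  shows "(\<integral>\<^sup>+x. \<integral>\<^sup>+s. h (x + y * s) \<partial>cauchy_measure \<partial>lborel) = (\<integral>\<^sup>+t. h t \<partial>lborel)"
proof -
  interpret prob_space cauchy_measure by (rule prob_space_cauchy_measure)
  interpret pair_sigma_finite lborel cauchy_measure ..
  have "(\<integral>\<^sup>+x. \<integral>\<^sup>+s. h (x + y * s) \<partial>cauchy_measure \<partial>lborel)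
      = (\<integral>\<^sup>+s. \<integral>\<^sup>+x. h (x + y * s) \<partial>lborel \<partial>cauchy_measure)"
    by (rule Fubini'[symmetric]) simp
  also have "\<dots> = (\<integral>\<^sup>+s. \<integral>\<^sup>+t. h t \<partial>lborel \<partial>cauchy_measure)"
  proof (rule nn_integral_cong)
    fix s
    show "(\<integral>\<^sup>+x. h (x + y * s) \<partial>lborel) = (\<integral>\<^sup>+t. h t \<partial>lborel)"
      using nn_integral_real_affine[of h 1 "y * s"] by (simp add: add.commute)
  qed
  also have "\<dots> = (\<integral>\<^sup>+t. h t \<partial>lborel)" using emeasure_space_1 by simp
  finally show ?thesis .
qed

text \<open>For \<open>Im z = 0\<close> the formula returns \<open>\<phi> (Re z)\<close>: boundary
  values are built in, and continuity up to the real line is plain dominated convergence.\<close>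

definition poisson :: "(real \<Rightarrow> real) \<Rightarrow> complex \<Rightarrow> real" where
  "poisson \<phi> z = (\<integral>s. \<phi> (Re z + Im z * s) \<partial>cauchy_measure)"

lemma integrable_poisson:
  fixes \<phi> :: "real \<Rightarrow> real"
  assumes "continuous_on UNIV \<phi>" "\<And>t. \<bar>\<phi> t\<bar> \<le> B"
  shows "integrable cauchy_measure (\<lambda>s. \<phi> (x + y * s))"
proof -
  interpret prob_space cauchy_measure by (rule prob_space_cauchy_measure)
  have [measurable]: "\<phi> \<in> borel_measurable borel"
    using assms(1) by (rule borel_measurable_continuous_onI)
  show ?thesis
    by (rule integrable_const_bound[of _ B]) (use assms(2) in auto)
qed

lemma poisson_real: "Im z = 0 \<Longrightarrow> poisson \<phi> z = \<phi> (Re z)"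
  using prob_space.prob_space[OF prob_space_cauchy_measure] by (simp add: poisson_def)

lemma poisson_nonneg: "(\<And>t. 0 \<le> \<phi> t) \<Longrightarrow> 0 \<le> poisson \<phi> z"
  by (simp add: poisson_def)

lemma poisson_le:
  assumes "continuous_on UNIV \<phi>" "\<And>t. \<bar>\<phi> t\<bar> \<le> B"
  shows "poisson \<phi> z \<le> B"
proof -
  interpret prob_space cauchy_measure by (rule prob_space_cauchy_measure)
  have "poisson \<phi> z \<le> (\<integral>s. B \<partial>cauchy_measure)"
    unfolding poisson_def
    by (intro integral_mono integrable_poisson assms) (use assms(2) abs_le_D1 in auto)
  then show ?thesis using prob_space by simp
qed

lemma poisson_continuous:
  assumes \<phi>: "continuous_on UNIV \<phi>" and B: "\<And>t. \<bar>\<phi> t\<bar> \<le> B"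
  shows "continuous_on UNIV (poisson \<phi>)"
  unfolding continuous_on_sequentially
proof safe
  interpret prob_space cauchy_measure by (rule prob_space_cauchy_measure)
  have [measurable]: "\<phi> \<in> borel_measurable borel"
    using assms(1) by (rule borel_measurable_continuous_onI)
  fix u :: "nat \<Rightarrow> complex" and a assume u: "u \<longlonglongrightarrow> a"
  have m: "(\<lambda>s. \<phi> (Re z + Im z * s)) \<in> borel_measurable cauchy_measure" for z
    by measurable
  have "(\<lambda>n. \<phi> (Re (u n) + Im (u n) * s)) \<longlonglongrightarrow> \<phi> (Re a + Im a * s)" for s
    by (intro continuous_on_tendsto_compose[OF \<phi>] tendsto_intros u) auto
  then show "(poisson \<phi> \<circ> u) \<longlonglongrightarrow> poisson \<phi> a"
    unfolding poisson_def comp_def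
    by (intro integral_dominated_convergence[where w="\<lambda>_. B"]) (auto simp: B m)
qed

text \<open>
  No convexity of \<open>\<lambda>x. \<Phi> (exp x)\<close> is available, but the lower type makes \<open>x \<mapsto> p x\<close> a linear
  minorant of \<open>C \<Phi> (a exp x) / \<Phi> a\<close>; taking \<open>a\<close> to be half the geometric mean of \<open>g\<close> leaves the
  positive average \<open>p ln 2\<close>.
\<close>

lemma admissible_jensen:
  assumes adm: "admissible \<Phi>"
  obtains K where "K > 0"
    "\<And>M g. prob_space M \<Longrightarrow> g \<in> borel_measurable M \<Longrightarrow> (\<And>x. 0 < g x) \<Longrightarrow> integrable M (\<lambda>x. ln (g x)) \<Longrightarrow>
       ennreal (\<Phi> (exp (\<integral>x. ln (g x) \<partial>M) / 2)) \<le> ennreal K * (\<integral>\<^sup>+x. ennreal (\<Phi> (g x)) \<partial>(M::real measure))"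
proof -
  obtain p C where p: "p > 0" "C > 0"
    and lt: "\<And>s t. 0 \<le> s \<Longrightarrow> 0 \<le> t \<Longrightarrow> t \<le> 1 \<Longrightarrow> \<Phi> (s * t) \<le> C * t powr p * \<Phi> s"
    using admissible_lower_type[OF adm] by metis
  define K where "K = C / (p * ln 2)"
  show thesis
  proof (rule that[of K])
    show "K > 0" using p by (simp add: K_def)
    fix M :: "real measure" and g :: "real \<Rightarrow> real"
    assume M: "prob_space M" and g [measurable]: "g \<in> borel_measurable M"
      and gpos: "\<And>x. 0 < g x" and int: "integrable M (\<lambda>x. ln (g x))"
    interpret prob_space M by fact
    have [measurable]: "(\<lambda>x. \<Phi> (g x)) \<in> borel_measurable M"
      using gpos by (intro admissible_measurable[OF adm]) (auto intro: less_imp_le)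
    define m where "m = (\<integral>x. ln (g x) \<partial>M)"
    define a where "a = exp m / 2"
    have a: "a > 0" by (simp add: a_def)
    \<comment> \<open>Put \<open>x = ln (g / a)\<close>. For \<open>x \<ge> 0\<close> lower type
      bounds \<open>exp (p * x)\<close> by \<open>C * \<Phi> g / \<Phi> a\<close>, and
      \<open>p * x \<le> exp (p * x)\<close>. For \<open>x < 0\<close> the left side is negative and
      the right side positive.\<close>
    have pt: "p / C * \<Phi> a * (ln (g x) - ln a) \<le> \<Phi> (g x)" for x
    proof (cases "g x \<ge> a")
      case True
      have "\<Phi> (g x * (a / g x)) \<le> C * (a / g x) powr p * \<Phi> (g x)"
        using True gpos[of x] a by (intro lt) auto
      then have "\<Phi> a \<le> C * (a / g x) powr p * \<Phi> (g x)" using gpos[of x] by simp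
      then have 1: "\<Phi> a * (g x / a) powr p \<le> C * \<Phi> (g x)"
        using gpos[of x] a by (simp add: powr_divide field_simps)
      have "p * (ln (g x) - ln a) \<le> exp (p * (ln (g x) - ln a))"
        using exp_ge_add_one_self[of "p * (ln (g x) - ln a)"] by linarith
      also have "\<dots> = (g x / a) powr p" using gpos[of x] a by (simp add: powr_def ln_div)
      finally have "\<Phi> a * (p * (ln (g x) - ln a)) \<le> \<Phi> a * (g x / a) powr p"
        using admissible_pos[OF adm a] by simp
      with 1 have "\<Phi> a * (p * (ln (g x) - ln a)) \<le> C * \<Phi> (g x)" by linarith
      then show ?thesis using p by (simp add: field_simps)
    next
      case False
      then have "ln (g x) - ln a \<le> 0" using gpos[of x] a by simp
      then have "p / C * \<Phi> a * (ln (g x) - ln a) \<le> 0"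
        using p admissible_pos[OF adm a] by (intro mult_nonneg_nonpos) auto
      then show ?thesis using admissible_pos[OF adm gpos[of x]] by linarith
    qed
    show "ennreal (\<Phi> (exp m / 2)) \<le> ennreal K * (\<integral>\<^sup>+x. ennreal (\<Phi> (g x)) \<partial>M)"
    \<comment> \<open>A Bochner integral that does not exist is 0 by convention, so an infinite
      right side is split off before real integrals are compared.\<close>
    proof (cases "(\<integral>\<^sup>+x. ennreal (\<Phi> (g x)) \<partial>M) = \<infinity>")
      case True
      then show ?thesis using \<open>K > 0\<close> by (simp add: ennreal_mult_top)
    next
      case False
      then have i: "integrable M (\<lambda>x. \<Phi> (g x))"
        using admissible_pos[OF adm gpos]
        by (intro integrableI_nonneg) (auto intro: less_imp_le simp: top.not_eq_extremum)
      have "p / C * \<Phi> a * (m - ln a) = (\<integral>x. p / C * \<Phi> a * (ln (g x) - ln a) \<partial>M)"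
        using int prob_space by (simp add: m_def)
      also have "\<dots> \<le> (\<integral>x. \<Phi> (g x) \<partial>M)"
        using int i pt by (intro integral_mono) auto
      also have "m - ln a = ln 2" by (simp add: a_def ln_div)
      finally have "\<Phi> a \<le> K * (\<integral>x. \<Phi> (g x) \<partial>M)"
        using p by (simp add: K_def field_simps)
      then have "ennreal (\<Phi> a) \<le> ennreal (K * (\<integral>x. \<Phi> (g x) \<partial>M))" by (rule ennreal_leI)
      also have "\<dots> = ennreal K * ennreal (\<integral>x. \<Phi> (g x) \<partial>M)"
        using \<open>K > 0\<close> by (simp add: ennreal_mult')
      also have "ennreal (\<integral>x. \<Phi> (g x) \<partial>M) = (\<integral>\<^sup>+x. ennreal (\<Phi> (g x)) \<partial>M)"
        using i admissible_pos[OF adm gpos]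
        by (intro nn_integral_eq_integral[symmetric]) (auto intro: less_imp_le)
      finally show ?thesis by (simp add: a_def)
    qed
  qed
qed

section \<open>Maximum principle on the half-plane\<close>

lemma open_upper_half_plane: "open upper_half_plane"
  by (simp add: upper_half_plane_def open_halfspace_Im_gt)

lemma convex_upper_half_plane: "convex upper_half_plane"
  by (simp add: upper_half_plane_def convex_halfspace_Im_gt)

text \<open>\<open>W\<close> is holomorphic only inside, while its modulus extends continuously to
  the real line; \<open>w\<close> is that extension. A value above 1 would force a maximum at an
  interior point, because boundary and far region stay below 1. Then \<open>W\<close> is constant,
  against its size far away.\<close>

lemma half_plane_maximum_principle:
  assumes W: "W holomorphic_on upper_half_plane"
    and w: "continuous_on {z. Im z \<ge> 0} w" "\<And>z. Im z > 0 \<Longrightarrow> w z = cmod (W z)"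
    and bd: "\<And>z. Im z = 0 \<Longrightarrow> w z \<le> 1"
    and inf: "\<And>z. Im z \<ge> 0 \<Longrightarrow> cmod z \<ge> \<rho> \<Longrightarrow> w z \<le> 1"
    and z: "Im z > 0"
  shows "w z \<le> 1"
proof (rule ccontr)
  assume z1: "\<not> w z \<le> 1"
  define K where "K = cball 0 \<rho> \<inter> {z. Im z \<ge> 0}"
  have "compact K" unfolding K_def
    by (intro compact_Int_closed closed_halfspace_Im_ge) auto
  have zK: "z \<in> K" using inf[of z] z z1 by (force simp: K_def)
  moreover have "continuous_on K w" using w(1) by (rule continuous_on_subset) (auto simp: K_def)
  ultimately obtain a where a: "a \<in> K" "\<And>v. v \<in> K \<Longrightarrow> w v \<le> w a"
    using continuous_attains_sup[of K w] \<open>compact K\<close> by auto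
  have wa: "w a > 1" using a(2)[OF zK] z1 by simp
  with a bd[of a] have "Im a \<noteq> 0" by auto
  with a have ima: "Im a > 0" by (auto simp: K_def)
  have max: "w v \<le> w a" if "Im v \<ge> 0" for v
  proof (cases "v \<in> K")
    case False
    then have "w v \<le> 1" using inf[of v] that by (auto simp: K_def)
    then show ?thesis using wa by simp
  qed (use a in auto)
  have "W constant_on upper_half_plane"
  proof (rule maximum_modulus_principle[OF W open_upper_half_plane _ open_upper_half_plane order.refl])
    show "connected upper_half_plane" by (intro convex_connected convex_upper_half_plane)
    show "a \<in> upper_half_plane" using ima by (simp add: upper_half_plane_def)
    show "cmod (W v) \<le> cmod (W a)" if "v \<in> upper_half_plane" for v
      using max[of v] w(2)[of v] w(2)[of a] ima that by (auto simp: upper_half_plane_def)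
  qed
  \<comment> \<open>An interior point beyond radius \<open>\<rho>\<close>; the absolute value covers
    a negative \<open>\<rho>\<close>.\<close>
  moreover define b where "b = Complex 0 (\<bar>\<rho>\<bar> + 1)"
  ultimately have "W a = W b"
    using ima by (auto simp: constant_on_def upper_half_plane_def b_def)
  then have "w a = w b" using w(2)[of a] w(2)[of b] ima by (simp add: b_def)
  moreover have "w b \<le> 1" by (rule inf) (auto simp: b_def cmod_def)
  ultimately show False using wa by simp
qed

section \<open>Outer functions\<close>

text \<open>For data supported in \<open>[-R, R]\<close> the real part of this Cauchy integral is
  the Poisson integral, so its exponential is an outer function. The compact interval permits
  differentiation under the integral sign.\<close>

definition herglotz :: "real \<Rightarrow> (real \<Rightarrow> real) \<Rightarrow> complex \<Rightarrow> complex" where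
  "herglotz R \<phi> z =
     integral (cbox (- R) R) (\<lambda>t. complex_of_real (\<phi> t) / (complex_of_real t - z)) / (\<i> * pi)"

lemma herglotz_holomorphic:
  assumes "continuous_on UNIV \<phi>"
  shows "herglotz R \<phi> holomorphic_on upper_half_plane"
proof -
  have ne: "complex_of_real t \<noteq> z" if "z \<in> upper_half_plane" for t z
    using that by (auto simp: upper_half_plane_def)
  have c: "continuous_on S \<phi>" for S using assms by (rule continuous_on_subset) auto
  have "(\<lambda>z. integral (cbox (- R) R) (\<lambda>t. complex_of_real (\<phi> t) / (complex_of_real t - z)))
      holomorphic_on upper_half_plane"
  proof (rule leibniz_rule_holomorphic[where fx = "\<lambda>z t. complex_of_real (\<phi> t) / (complex_of_real t - z)\<^sup>2"])
    show "((\<lambda>z. complex_of_real (\<phi> t) / (complex_of_real t - z)) has_field_derivative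
        complex_of_real (\<phi> t) / (complex_of_real t - z)\<^sup>2) (at z within upper_half_plane)"
      if "z \<in> upper_half_plane" for z t
      using ne[OF that, of t] by (auto intro!: derivative_eq_intros simp: power2_eq_square)
    show "(\<lambda>t. complex_of_real (\<phi> t) / (complex_of_real t - z)) integrable_on cbox (- R) R"
      if "z \<in> upper_half_plane" for z
      using ne[OF that] by (intro integrable_continuous continuous_intros c) auto
    have "continuous_on (upper_half_plane \<times> cbox (- R) R) (\<lambda>p. \<phi> (snd p))"
      by (intro continuous_on_compose2[OF c[of UNIV]] continuous_intros) auto
    then show "continuous_on (upper_half_plane \<times> cbox (- R) R)
        (\<lambda>(z, t). complex_of_real (\<phi> t) / (complex_of_real t - z)\<^sup>2)"
      using ne unfolding case_prod_beta by (intro continuous_intros) auto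
  qed (rule convex_upper_half_plane)
  then show ?thesis unfolding herglotz_def[abs_def] by (intro holomorphic_intros) auto
qed

text \<open>The real part of \<open>1 / (pi * i * (t - z))\<close> is the Poisson kernel
  \<open>y / (pi * (y^2 + (t - x)^2))\<close>. As \<open>\<phi>\<close> vanishes off the interval,
  the integral extends to the line, and \<open>t = x + y * s\<close> brings in
  \<open>cauchy_measure\<close>.\<close>

lemma Re_herglotz:
  assumes c: "continuous_on UNIV \<phi>" and supp: "\<And>t. \<bar>t\<bar> > R \<Longrightarrow> \<phi> t = 0" and z: "Im z > 0"
  shows "Re (herglotz R \<phi> z) = poisson \<phi> z"
proof -
  have [measurable]: "\<phi> \<in> borel_measurable borel"
    using c by (rule borel_measurable_continuous_onI)
  define x y where "x = Re z" and "y = Im z"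
  have y: "y > 0" using z by (simp add: y_def)
  define g where "g t = y / (pi * (y\<^sup>2 + (t - x)\<^sup>2)) * \<phi> t" for t
  have den: "y\<^sup>2 + (t - x)\<^sup>2 > 0" for t using y by (simp add: add_pos_nonneg)
  have ne: "complex_of_real t \<noteq> z" for t using z by auto
  have gc: "continuous_on S g" for S
    unfolding g_def using den
    by (intro continuous_intros continuous_on_subset[OF c]) (use y in auto)
  have Re_eq: "Re (complex_of_real (\<phi> t) / (complex_of_real t - z) / (\<i> * pi)) = g t" for t
  proof -
    have "complex_of_real (\<phi> t) / (complex_of_real t - z) / (\<i> * pi)
        = complex_of_real (\<phi> t / pi) * inverse (\<i> * (complex_of_real t - z))"
      by (simp add: field_simps)
    also have "Re \<dots> = \<phi> t / pi * (y / (y\<^sup>2 + (t - x)\<^sup>2))"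
    proof -
      have "Re (complex_of_real a * v) = a * Re v" for a v by simp
      then show ?thesis by (simp only:) (simp add: x_def y_def)
    qed
    finally show ?thesis by (simp add: g_def field_simps)
  qed
  have int: "(\<lambda>t. complex_of_real (\<phi> t) / (complex_of_real t - z)) integrable_on cbox (- R) R"
    using ne by (intro integrable_continuous continuous_intros continuous_on_subset[OF c]) auto
  then have int': "(\<lambda>t. complex_of_real (\<phi> t) / (complex_of_real t - z) / (\<i> * pi)) integrable_on cbox (- R) R"
    by (intro integrable_on_divide) 
  have "herglotz R \<phi> z = integral (cbox (- R) R) (\<lambda>t. complex_of_real (\<phi> t) / (complex_of_real t - z) / (\<i> * pi))"
    unfolding herglotz_def by (rule integral_divide[symmetric])
  then have "Re (herglotz R \<phi> z) = integral (cbox (- R) R) g"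
    using integral_linear[OF int' bounded_linear_Re] by (simp only: comp_def Re_eq)
  also have "\<dots> = (LINT t:cbox (- R) R|lborel. g t)"
  proof (rule set_borel_integral_eq_integral(2)[symmetric])
    show "set_integrable lborel (cbox (- R) R) g"
      unfolding set_integrable_def by (rule borel_integrable_compact[OF compact_cbox gc])
  qed
  also have "\<dots> = (\<integral>t. g t \<partial>lborel)"
    unfolding set_lebesgue_integral_def
  proof (intro Bochner_Integration.integral_cong refl)
    fix t
    show "indicat_real (cbox (- R) R) t *\<^sub>R g t = g t"
    proof (cases "\<bar>t\<bar> > R")
      case True
      then show ?thesis using supp by (simp add: g_def)
    qed (auto simp: indicator_def)
  qed
  also have "\<dots> = y * (\<integral>s. g (x + y * s) \<partial>lborel)"
    using lborel_integral_real_affine[of y g x] y by simp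
  also have "\<dots> = (\<integral>s. y * g (x + y * s) \<partial>lborel)" by simp
  also have "\<dots> = (\<integral>s. (1 / (pi * (1 + s\<^sup>2))) *\<^sub>R \<phi> (x + y * s) \<partial>lborel)"
  proof (intro Bochner_Integration.integral_cong refl)
    fix s
    have "y\<^sup>2 + (x + y * s - x)\<^sup>2 = y * y * (1 + s\<^sup>2)" by (simp add: power2_eq_square algebra_simps)
    then show "y * g (x + y * s) = (1 / (pi * (1 + s\<^sup>2))) *\<^sub>R \<phi> (x + y * s)"
      using y by (simp add: g_def)
  qed
  also have "\<dots> = poisson \<phi> z"
    unfolding poisson_def cauchy_measure_def x_def y_def by (subst integral_density) auto
  finally show ?thesis .
qed

lemma nn_integral_le_of_tendsto:
  fixes f :: "nat \<Rightarrow> 'a \<Rightarrow> ennreal"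
  assumes "\<And>n. f n \<in> borel_measurable M" "\<And>x. (\<lambda>n. f n x) \<longlonglongrightarrow> g x"
    and "\<And>n. (\<integral>\<^sup>+x. f n x \<partial>M) \<le> B"
  shows "(\<integral>\<^sup>+x. g x \<partial>M) \<le> B"
proof -
  have "(\<integral>\<^sup>+x. g x \<partial>M) = (\<integral>\<^sup>+x. liminf (\<lambda>n. f n x) \<partial>M)"
    by (intro nn_integral_cong lim_imp_Liminf[symmetric] assms(2)) simp
  also have "\<dots> \<le> liminf (\<lambda>n. \<integral>\<^sup>+x. f n x \<partial>M)"
    by (rule nn_integral_liminf) (rule assms(1))
  also have "\<dots> \<le> limsup (\<lambda>n. \<integral>\<^sup>+x. f n x \<partial>M)" by (rule Liminf_le_Limsup) simp
  also have "\<dots> \<le> B" by (rule Limsup_bounded) (simp add: assms(3))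
  finally show ?thesis .
qed

section \<open>Truncation and the damping factor\<close>

definition cutoff :: "real \<Rightarrow> real \<Rightarrow> real" where
  "cutoff R t = max 0 (min 1 (R + 1 - \<bar>t\<bar>))"

lemma cutoff_bounds: "0 \<le> cutoff R t" "cutoff R t \<le> 1"
  by (auto simp: cutoff_def)

lemma cutoff_eq: "\<bar>t\<bar> \<le> R \<Longrightarrow> cutoff R t = 1" "\<bar>t\<bar> \<ge> R + 1 \<Longrightarrow> cutoff R t = 0"
  by (auto simp: cutoff_def)

lemma cutoff_continuous [continuous_intros]: "continuous_on S (cutoff R)"
  unfolding cutoff_def[abs_def] by (intro continuous_intros)

lemma cutoff_mult_bounded:
  assumes "continuous_on UNIV \<psi>"
  obtains B where "\<And>t. \<bar>cutoff R t * \<psi> t\<bar> \<le> B"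
proof -
  have "bounded (\<psi> ` {- R - 1..R + 1})"
    by (intro compact_imp_bounded compact_continuous_image continuous_on_subset[OF assms]) auto
  then obtain B where B: "B > 0" "\<And>t. t \<in> {- R - 1..R + 1} \<Longrightarrow> \<bar>\<psi> t\<bar> \<le> B"
    by (auto simp: bounded_pos)
  have "\<bar>cutoff R t * \<psi> t\<bar> \<le> B" for t
  proof (cases "t \<in> {- R - 1..R + 1}")
    case True
    have "cutoff R t * \<bar>\<psi> t\<bar> \<le> 1 * B"
      using cutoff_bounds[of R t] B(2)[OF True] by (intro mult_mono) auto
    then show ?thesis using cutoff_bounds[of R t] by (simp add: abs_mult)
  next
    case False
    then show ?thesis using B(1) cutoff_eq(2)[of R t] by auto
  qed
  then show thesis by (rule that)
qed

text \<open>
  Its modulus is at least 1 on the closed half-plane, so dividing by its powers enforces decay at infinity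
  without increasing any norm.
\<close>

definition growth_factor :: "real \<Rightarrow> complex \<Rightarrow> complex" where
  "growth_factor \<epsilon> z = 1 - \<i> * complex_of_real \<epsilon> * z"

lemma growth_factor_holomorphic [holomorphic_intros]: "growth_factor \<epsilon> holomorphic_on S"
  unfolding growth_factor_def[abs_def] by (intro holomorphic_intros)

lemma growth_factor_continuous [continuous_intros]:
  "continuous_on S f \<Longrightarrow> continuous_on S (\<lambda>x. growth_factor \<epsilon> (f x))"
  unfolding growth_factor_def by (intro continuous_intros)

lemma growth_factor_ge_1:
  assumes "\<epsilon> \<ge> 0" "Im z \<ge> 0" shows "1 \<le> cmod (growth_factor \<epsilon> z)"
proof -
  have "1 \<le> Re (growth_factor \<epsilon> z)" using assms by (simp add: growth_factor_def)
  then show ?thesis using complex_Re_le_cmod[of "growth_factor \<epsilon> z"] by linarith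
qed

lemma growth_factor_ge: "\<epsilon> \<ge> 0 \<Longrightarrow> \<epsilon> * cmod z - 1 \<le> cmod (growth_factor \<epsilon> z)"
  using norm_triangle_ineq2[of "\<i> * complex_of_real \<epsilon> * z" 1]
  by (simp add: growth_factor_def norm_mult norm_minus_commute)

lemma growth_factor_real: "(cmod (growth_factor \<epsilon> (complex_of_real t)))\<^sup>2 = 1 + \<epsilon>\<^sup>2 * t\<^sup>2"
  by (simp add: growth_factor_def cmod_power2 power_mult_distrib)

text \<open>The boundary function \<open>L\<close> is unbounded, so truncations of it are used:
  \<open>exp (herglotz \<phi>) / growth_factor\<close> has modulus at most 1 on the real line, and
  also far away, where the denominator outgrows the bounded numerator. Fatou's lemma removes the
  truncation and yields integrability and the inequality together.\<close>

lemma
  assumes \<epsilon>: "\<epsilon> > 0" and z: "Im z > 0"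
  defines "L \<equiv> \<lambda>t. ln (cmod (growth_factor \<epsilon> (complex_of_real t)))"
  shows integrable_ln_growth_factor: "integrable cauchy_measure (\<lambda>s. L (Re z + Im z * s))"
    and poisson_ln_growth_factor_le: "poisson L z \<le> ln (cmod (growth_factor \<epsilon> z))"
proof -
  have ge1: "1 \<le> cmod (growth_factor \<epsilon> v)" if "Im v \<ge> 0" for v
    using growth_factor_ge_1[of \<epsilon> v] \<epsilon> that by simp
  have ne0: "growth_factor \<epsilon> v \<noteq> 0" if "Im v \<ge> 0" for v
    using ge1[OF that] by auto
  have L0: "L t \<ge> 0" for t unfolding L_def using ge1 by (intro ln_ge_zero) auto
  have Lc: "continuous_on UNIV L"
    unfolding L_def using ne0 by (intro continuous_intros) auto
  have [measurable]: "L \<in> borel_measurable borel"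
    using Lc by (rule borel_measurable_continuous_onI)
  define \<phi> where "\<phi> n t = cutoff (real n) t * L t" for n t
  have \<phi>c: "continuous_on UNIV (\<phi> n)" for n
    unfolding \<phi>_def by (intro continuous_intros Lc)
  have \<phi>0: "0 \<le> \<phi> n t" and \<phi>L: "\<phi> n t \<le> L t" for n t
    using cutoff_bounds[of n t] L0[of t] by (auto simp: \<phi>_def mult_left_le_one_le)
  have main: "poisson (\<phi> n) z \<le> ln (cmod (growth_factor \<epsilon> z))" for n
  proof -
    obtain B where B: "\<And>t. \<bar>\<phi> n t\<bar> \<le> B"
      using cutoff_mult_bounded[OF Lc, of "real n"] unfolding \<phi>_def by metis
    define W where "W v = exp (herglotz (n + 1) (\<phi> n) v) / growth_factor \<epsilon> v" for v
    define w where "w v = exp (poisson (\<phi> n) v) / cmod (growth_factor \<epsilon> v)" for v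
    have "w z \<le> 1"
    \<comment> \<open>\<open>B\<close> bounds the truncated data; beyond this radius
      \<open>growth_factor_ge\<close> makes the denominator at least \<open>exp B\<close>.\<close>
    proof (rule half_plane_maximum_principle[where W=W and \<rho>="(exp B + 1) / \<epsilon>"])
      show "W holomorphic_on upper_half_plane"
        unfolding W_def using ne0
        by (intro holomorphic_intros herglotz_holomorphic \<phi>c) (auto simp: upper_half_plane_def)
      have "continuous_on {z. 0 \<le> Im z} (poisson (\<phi> n))"
        by (rule continuous_on_subset[OF poisson_continuous[OF \<phi>c B]]) auto
      then show "continuous_on {z. 0 \<le> Im z} w"
        unfolding w_def using ne0 by (intro continuous_intros) auto
      show "w v = cmod (W v)" if "Im v > 0" for v
        using Re_herglotz[OF \<phi>c _ that, of "n+1" n] cutoff_eq(2)[of n]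
        by (simp add: w_def W_def norm_divide \<phi>_def)
      show "w v \<le> 1" if "Im v = 0" for v
      proof -
        have v: "v = complex_of_real (Re v)" using that by (simp add: complex_eq_iff)
        have "w v = exp (\<phi> n (Re v)) / cmod (growth_factor \<epsilon> v)"
          by (simp add: w_def poisson_real that)
        also have "exp (\<phi> n (Re v)) \<le> exp (L (Re v))" using \<phi>L by simp
        also have "exp (L (Re v)) = cmod (growth_factor \<epsilon> v)"
          unfolding L_def using ne0[of v] that v by simp
        finally show ?thesis using ne0[of v] that by (simp add: divide_right_mono)
      qed
      show "w v \<le> 1" if "Im v \<ge> 0" "cmod v \<ge> (exp B + 1) / \<epsilon>" for v
      proof -
        have "exp B \<le> \<epsilon> * cmod v - 1" using that \<epsilon> by (simp add: field_simps)
        also have "\<dots> \<le> cmod (growth_factor \<epsilon> v)" using growth_factor_ge \<epsilon> by simp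
        finally have "exp B \<le> cmod (growth_factor \<epsilon> v)" .
        moreover have "exp (poisson (\<phi> n) v) \<le> exp B" using poisson_le[OF \<phi>c B] by simp
        ultimately have "exp (poisson (\<phi> n) v) \<le> cmod (growth_factor \<epsilon> v)" by (metis order_trans)
        then show ?thesis unfolding w_def using ne0[of v] that by simp
      qed
    qed (rule z)
    then have "exp (poisson (\<phi> n) z) \<le> cmod (growth_factor \<epsilon> z)"
      using ne0[of z] z by (simp add: w_def)
    then show ?thesis using ne0[of z] z by (simp add: ln_ge_iff)
  qed
  have "(\<integral>\<^sup>+s. ennreal (L (Re z + Im z * s)) \<partial>cauchy_measure) \<le> ennreal (ln (cmod (growth_factor \<epsilon> z)))"
  proof (rule nn_integral_le_of_tendsto[where f="\<lambda>n s. ennreal (\<phi> n (Re z + Im z * s))"])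
    show "(\<lambda>s. ennreal (\<phi> n (Re z + Im z * s))) \<in> borel_measurable cauchy_measure" for n
    proof -
      have [measurable]: "\<phi> n \<in> borel_measurable borel"
        using \<phi>c by (rule borel_measurable_continuous_onI)
      show ?thesis by measurable
    qed
    show "(\<lambda>n. ennreal (\<phi> n (Re z + Im z * s))) \<longlonglongrightarrow> ennreal (L (Re z + Im z * s))" for s
    proof (rule tendsto_eventually)
      define t where "t = Re z + Im z * s"
      have "eventually (\<lambda>n. \<bar>t\<bar> \<le> real n) sequentially"
        using eventually_ge_at_top[of "nat \<lceil>\<bar>t\<bar>\<rceil>"] by eventually_elim linarith
      then show "\<forall>\<^sub>F n in sequentially. ennreal (\<phi> n (Re z + Im z * s)) = ennreal (L (Re z + Im z * s))"
        by eventually_elim (simp add: \<phi>_def cutoff_eq t_def)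
    qed
    show "(\<integral>\<^sup>+s. ennreal (\<phi> n (Re z + Im z * s)) \<partial>cauchy_measure) \<le> ennreal (ln (cmod (growth_factor \<epsilon> z)))" for n
    proof -
      obtain B where B: "\<And>t. \<bar>\<phi> n t\<bar> \<le> B"
        using cutoff_mult_bounded[OF Lc, of "real n"] unfolding \<phi>_def by metis
      have "(\<integral>\<^sup>+s. ennreal (\<phi> n (Re z + Im z * s)) \<partial>cauchy_measure) = ennreal (poisson (\<phi> n) z)"
        unfolding poisson_def
        by (intro nn_integral_eq_integral integrable_poisson[OF \<phi>c B]) (simp add: \<phi>0)
      then show ?thesis using main[of n] by (simp add: ennreal_leI)
    qed
  qed
  note bound = this
  show int: "integrable cauchy_measure (\<lambda>s. L (Re z + Im z * s))"
    using bound by (intro integrableI_nonneg) (auto simp: L0 intro: le_less_trans)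
  have "ennreal (poisson L z) \<le> ennreal (ln (cmod (growth_factor \<epsilon> z)))"
    using bound nn_integral_eq_integral[OF int] L0 by (simp add: poisson_def)
  then show "poisson L z \<le> ln (cmod (growth_factor \<epsilon> z))"
    using ge1[of z] z by (simp add: ennreal_le_iff)
qed

text \<open>Jensen's inequality for a boundary modulus \<open>b\<close> with
  \<open>ln b = ln \<delta> - N * L + \<phi>\<close>. The Poisson integral of \<open>L\<close> is at
  most \<open>ln (cmod (growth_factor \<epsilon> z))\<close>; owing to the minus sign the geometric
  mean of \<open>b\<close> is at least the modulus of the outer function at \<open>z\<close>. The
  \<open>1 / 2\<close> is inherited from \<open>admissible_jensen\<close>.\<close>

lemma outer_mean_bound:
  assumes adm: "admissible \<Phi>"
  obtains K where "K > 0"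
    "\<And>\<epsilon> \<delta> N \<phi> B z. \<epsilon> > 0 \<Longrightarrow> \<delta> > 0 \<Longrightarrow> continuous_on UNIV \<phi> \<Longrightarrow> (\<And>t. \<bar>\<phi> t\<bar> \<le> B) \<Longrightarrow> Im z > 0 \<Longrightarrow>
      ennreal (\<Phi> (\<delta> / cmod (growth_factor \<epsilon> z) ^ N * exp (poisson \<phi> z) / 2)) \<le>
      ennreal K * (\<integral>\<^sup>+s. ennreal (\<Phi> (\<delta> / cmod (growth_factor \<epsilon> (complex_of_real (Re z + Im z * s))) ^ N
        * exp (\<phi> (Re z + Im z * s)))) \<partial>cauchy_measure)"
proof -
  obtain K where K: "K > 0" and J: "\<And>M g. prob_space M \<Longrightarrow> g \<in> borel_measurable M \<Longrightarrow> (\<And>x. 0 < g x) \<Longrightarrow> integrable M (\<lambda>x. ln (g x)) \<Longrightarrow>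
       ennreal (\<Phi> (exp (\<integral>x. ln (g x) \<partial>M) / 2)) \<le> ennreal K * (\<integral>\<^sup>+x. ennreal (\<Phi> (g x)) \<partial>(M::real measure))"
    using admissible_jensen[OF adm] by metis
  show thesis
  proof (rule that[OF K])
    fix \<epsilon> \<delta> B :: real and N :: nat and \<phi> :: "real \<Rightarrow> real" and z :: complex
    assume \<epsilon>: "\<epsilon> > 0" and \<delta>: "\<delta> > 0" and \<phi>c: "continuous_on UNIV \<phi>" and B: "\<And>t. \<bar>\<phi> t\<bar> \<le> B" and z: "Im z > 0"
    interpret prob_space cauchy_measure by (rule prob_space_cauchy_measure)
    have pos: "0 < cmod (growth_factor \<epsilon> v)" if "Im v \<ge> 0" for v
      using growth_factor_ge_1[of \<epsilon> v] \<epsilon> that by linarith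
    define L where "L t = ln (cmod (growth_factor \<epsilon> (complex_of_real t)))" for t
    define b where "b t = \<delta> / cmod (growth_factor \<epsilon> (complex_of_real t)) ^ N * exp (\<phi> t)" for t
    have bpos: "b t > 0" for t using pos[of "complex_of_real t"] \<delta> by (simp add: b_def)
    have "continuous_on UNIV b"
      unfolding b_def using pos by (intro continuous_intros \<phi>c) (auto simp: less_imp_neq)
    then have [measurable]: "b \<in> borel_measurable borel" by (rule borel_measurable_continuous_onI)
    have lnb: "ln (b t) = ln \<delta> - N * L t + \<phi> t" for t
      using pos[of "complex_of_real t"] \<delta> by (simp add: b_def L_def ln_mult ln_div ln_realpow)
    have i1: "integrable cauchy_measure (\<lambda>s. L (Re z + Im z * s))"
      unfolding L_def by (rule integrable_ln_growth_factor[OF \<epsilon> z])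
    have i2: "integrable cauchy_measure (\<lambda>s. \<phi> (Re z + Im z * s))"
      by (rule integrable_poisson[OF \<phi>c B])
    have "(\<integral>s. ln (b (Re z + Im z * s)) \<partial>cauchy_measure) = ln \<delta> - N * poisson L z + poisson \<phi> z"
      unfolding lnb poisson_def using i1 i2 prob_space by simp
    moreover have "N * poisson L z \<le> N * ln (cmod (growth_factor \<epsilon> z))"
      unfolding L_def by (intro mult_left_mono poisson_ln_growth_factor_le[OF \<epsilon> z]) auto
    ultimately have "exp (ln \<delta> - N * ln (cmod (growth_factor \<epsilon> z)) + poisson \<phi> z)
        \<le> exp (\<integral>s. ln (b (Re z + Im z * s)) \<partial>cauchy_measure)" by simp
    also have "exp (ln \<delta> - N * ln (cmod (growth_factor \<epsilon> z)) + poisson \<phi> z)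
        = \<delta> / cmod (growth_factor \<epsilon> z) ^ N * exp (poisson \<phi> z)"
      using \<delta> pos[of z] z by (simp add: exp_add exp_diff exp_of_nat_mult)
    finally have "ennreal (\<Phi> (\<delta> / cmod (growth_factor \<epsilon> z) ^ N * exp (poisson \<phi> z) / 2))
        \<le> ennreal (\<Phi> (exp (\<integral>s. ln (b (Re z + Im z * s)) \<partial>cauchy_measure) / 2))"
      using \<delta> by (intro ennreal_leI admissible_mono[OF adm] divide_right_mono) auto
    also have "\<dots> \<le> ennreal K * (\<integral>\<^sup>+s. ennreal (\<Phi> (b (Re z + Im z * s))) \<partial>cauchy_measure)"
      using bpos i1 i2 by (intro J prob_space_axioms) (auto simp: lnb)
    finally show "ennreal (\<Phi> (\<delta> / cmod (growth_factor \<epsilon> z) ^ N * exp (poisson \<phi> z) / 2)) \<le>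
      ennreal K * (\<integral>\<^sup>+s. ennreal (\<Phi> (\<delta> / cmod (growth_factor \<epsilon> (complex_of_real (Re z + Im z * s))) ^ N
        * exp (\<phi> (Re z + Im z * s)))) \<partial>cauchy_measure)"
      by (simp add: b_def)
  qed
qed

section \<open>Pointwise bounds for functions in Hardy--Orlicz spaces\<close>

text \<open>Cauchy's formula on the square with centre \<open>w\<close> and half-side
  \<open>s\<close>. The shape is chosen because horizontal sides lie on lines where integrals are
  controlled, and vertical sides sweep out an area as \<open>s\<close> varies.\<close>

lemma cauchy_square_bound:
  assumes f: "f holomorphic_on upper_half_plane" and s: "0 < s" "s < Im w"
  defines "a1 \<equiv> w + Complex (- s) (- s)" and "a2 \<equiv> w + Complex s (- s)"
    and "a3 \<equiv> w + Complex s s" and "a4 \<equiv> w + Complex (- s) s"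
  shows "pi * cmod (f w) \<le> integral {0..1} (\<lambda>t. cmod (f (linepath a1 a2 t)))
    + integral {0..1} (\<lambda>t. cmod (f (linepath a2 a3 t)))
    + integral {0..1} (\<lambda>t. cmod (f (linepath a3 a4 t)))
    + integral {0..1} (\<lambda>t. cmod (f (linepath a4 a1 t)))"
proof -
  define g where "g v = f v / (v - w)" for v
  have Re1: "Re w - s < Re w + s" "Im w - s < Im w + s" using s by auto
  have rect: "rectpath a1 a3 = linepath a1 a2 +++ linepath a2 a3 +++ linepath a3 a4 +++ linepath a4 a1"
  proof -
    have "a2 = Complex (Re a3) (Im a1)" "a4 = Complex (Re a1) (Im a3)"
      by (auto simp: a1_def a2_def a3_def a4_def complex_eq_iff)
    then show ?thesis by (simp add: rectpath_def Let_def)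
  qed
  have far: "s \<le> cmod (v - w)" "v \<in> upper_half_plane" if "v \<in> path_image (rectpath a1 a3)" for v
  proof -
    have *: "\<bar>Re (v - w)\<bar> = s \<or> \<bar>Im (v - w)\<bar> = s" "Im v \<ge> Im w - s"
      using that s by (auto simp: path_image_rectpath a1_def a3_def)
    then show "s \<le> cmod (v - w)"
      using abs_Re_le_cmod[of "v - w"] abs_Im_le_cmod[of "v - w"] by auto
    show "v \<in> upper_half_plane" using * s by (auto simp: upper_half_plane_def)
  qed
  have sub: "closed_segment a1 a2 \<subseteq> path_image (rectpath a1 a3)" "closed_segment a2 a3 \<subseteq> path_image (rectpath a1 a3)"
     "closed_segment a3 a4 \<subseteq> path_image (rectpath a1 a3)" "closed_segment a4 a1 \<subseteq> path_image (rectpath a1 a3)"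
    by (auto simp: rect path_image_join)
  have cf: "continuous_on upper_half_plane f" by (rule holomorphic_on_imp_continuous_on[OF f])
  have cg: "continuous_on (path_image (rectpath a1 a3)) g"
    unfolding g_def using far s
    by (intro continuous_intros continuous_on_subset[OF cf]) force+
  have ic: "g contour_integrable_on linepath b c" "continuous_on {0..1} (\<lambda>t. g (linepath b c t))"
       "continuous_on {0..1} (\<lambda>t. cmod (f (linepath b c t)))"
    if "closed_segment b c \<subseteq> path_image (rectpath a1 a3)" for b c
  proof -
    show "g contour_integrable_on linepath b c"
      by (intro contour_integrable_continuous_linepath continuous_on_subset[OF cg] that)
    have l: "continuous_on {0..1} (linepath b c)" "linepath b c ` {0..1} \<subseteq> path_image (rectpath a1 a3)"
      using that linepath_image_01[of b c] by auto
    show "continuous_on {0..1} (\<lambda>t. g (linepath b c t))"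
      using l by (intro continuous_on_compose2[OF cg])
    show "continuous_on {0..1} (\<lambda>t. cmod (f (linepath b c t)))"
      using l far by (intro continuous_intros continuous_on_compose2[OF cf]) auto
  qed
  \<comment> \<open>The 2 is the side length \<open>2 * s\<close> divided by the least distance
    \<open>s\<close> from a side to the centre. It cancels against the \<open>2 * pi\<close> of
    Cauchy's formula.\<close>
  have part: "cmod (contour_integral (linepath b c) g) \<le> 2 * integral {0..1} (\<lambda>t. cmod (f (linepath b c t)))"
    if bc: "closed_segment b c \<subseteq> path_image (rectpath a1 a3)" "cmod (c - b) = 2 * s" for b c
  proof -
    have "contour_integral (linepath b c) g = integral {0..1} (\<lambda>t. g (linepath b c t) * (c - b))"
      by (simp add: contour_integral_integral)
    also have "cmod \<dots> \<le> integral {0..1} (\<lambda>t. 2 * cmod (f (linepath b c t)))"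
    proof (rule integral_norm_bound_integral)
      show "(\<lambda>t. g (linepath b c t) * (c - b)) integrable_on {0..1}"
        by (intro integrable_continuous_interval continuous_intros ic bc)
      show "(\<lambda>t. 2 * cmod (f (linepath b c t))) integrable_on {0..1}"
        by (intro integrable_continuous_interval continuous_on_mult_left ic bc)
      fix t :: real assume "t \<in> {0..1}"
      then have "linepath b c t \<in> path_image (rectpath a1 a3)"
        using bc(1) linepath_image_01[of b c] by auto
      from far(1)[OF this] s have *: "s \<le> cmod (linepath b c t - w)" "0 < cmod (linepath b c t - w)" by auto
      have "cmod (g (linepath b c t) * (c - b)) = cmod (f (linepath b c t)) * (2 * s / cmod (linepath b c t - w))"
        using bc(2) by (simp add: g_def norm_mult norm_divide)
      also have "\<dots> \<le> cmod (f (linepath b c t)) * 2"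
        using * s by (intro mult_left_mono) (auto simp: field_simps)
      finally show "cmod (g (linepath b c t) * (c - b)) \<le> 2 * cmod (f (linepath b c t))" by simp
    qed
    finally show ?thesis by simp
  qed
  have "(g has_contour_integral (2 * pi * \<i> * winding_number (rectpath a1 a3) w * f w)) (rectpath a1 a3)"
    unfolding g_def
  proof (rule Cauchy_integral_formula_convex_simple[OF convex_upper_half_plane f])
    show "w \<in> interior upper_half_plane"
      using s by (simp add: interior_open open_upper_half_plane) (simp add: upper_half_plane_def)
    show "path_image (rectpath a1 a3) \<subseteq> upper_half_plane - {w}"
      using far s by force
  qed auto
  moreover have "winding_number (rectpath a1 a3) w = 1"
    using s by (intro winding_number_rectpath) (auto simp: in_box_complex_iff a1_def a3_def)
  ultimately have "2 * pi * \<i> * f w = contour_integral (rectpath a1 a3) g"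
    by (simp add: contour_integral_unique)
  also have "\<dots> = contour_integral (linepath a1 a2) g + (contour_integral (linepath a2 a3) g +
      (contour_integral (linepath a3 a4) g + contour_integral (linepath a4 a1) g))"
    unfolding rect using ic(1) sub by (simp add: contour_integral_join valid_path_join contour_integrable_joinI)
  finally have eq: "2 * pi * \<i> * f w = \<dots>" .
  have "2 * pi * cmod (f w) = cmod (2 * pi * \<i> * f w)" by (simp add: norm_mult)
  also have "\<dots> \<le> cmod (contour_integral (linepath a1 a2) g) + (cmod (contour_integral (linepath a2 a3) g) +
      (cmod (contour_integral (linepath a3 a4) g) + cmod (contour_integral (linepath a4 a1) g)))"
    unfolding eq by (intro norm_triangle_mono order.refl)
  also have "\<dots> \<le> 2 * integral {0..1} (\<lambda>t. cmod (f (linepath a1 a2 t)))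
    + (2 * integral {0..1} (\<lambda>t. cmod (f (linepath a2 a3 t)))
    + (2 * integral {0..1} (\<lambda>t. cmod (f (linepath a3 a4 t)))
    + 2 * integral {0..1} (\<lambda>t. cmod (f (linepath a4 a1 t)))))"
    using s sub by (intro add_mono part) (auto simp: a1_def a2_def a3_def a4_def cmod_def real_sqrt_mult)
  finally show ?thesis by simp
qed

text \<open>Passes from one parametrised side of a square to an integral over a whole line; negative
  \<open>c\<close> covers the sides that are run backwards.\<close>

lemma nn_integral_affine_ge:
  fixes k :: "real \<Rightarrow> real"
  assumes F: "F \<in> borel_measurable borel" and k: "continuous_on {0..1} k" "\<And>t. 0 \<le> k t" and "c \<noteq> 0"
    and le: "\<And>t. t \<in> {0..1} \<Longrightarrow> ennreal (k t) \<le> F (b + c * t)"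
  shows "ennreal (\<bar>c\<bar> * integral {0..1} k) \<le> (\<integral>\<^sup>+\<tau>. F \<tau> \<partial>lborel)"
proof -
  have i: "set_integrable lborel {0..1} k"
    unfolding set_integrable_def by (rule borel_integrable_compact[OF compact_Icc k(1)])
  have "integral {0..1} k = (\<integral>t. indicator {0..1} t *\<^sub>R k t \<partial>lborel)"
    using set_borel_integral_eq_integral(2)[OF i] by (simp add: set_lebesgue_integral_def)
  also have "ennreal \<dots> = (\<integral>\<^sup>+t. ennreal (indicator {0..1} t *\<^sub>R k t) \<partial>lborel)"
    using i k(2) unfolding set_integrable_def by (intro nn_integral_eq_integral[symmetric]) auto
  also have "\<dots> \<le> (\<integral>\<^sup>+t. F (b + c * t) \<partial>lborel)"
    by (intro nn_integral_mono) (auto simp: le indicator_def)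
  finally have "ennreal \<bar>c\<bar> * ennreal (integral {0..1} k) \<le> ennreal \<bar>c\<bar> * (\<integral>\<^sup>+t. F (b + c * t) \<partial>lborel)"
    by (intro mult_left_mono) auto
  also have "\<dots> = (\<integral>\<^sup>+\<tau>. F \<tau> \<partial>lborel)"
    by (rule nn_integral_real_affine[OF F \<open>c \<noteq> 0\<close>, symmetric])
  finally show ?thesis by (simp add: ennreal_mult')
qed

text \<open>Cauchy's estimate is linear in \<open>cmod f\<close>, but only integrals of
  \<open>\<Phi> (cmod f)\<close> are known. The a priori bound \<open>sq\<close> mediates: on the
  square, small values of \<open>cmod f\<close> cost a quarter of \<open>cmod (f w)\<close>, large
  ones a multiple of \<open>\<Phi> (cmod f)\<close>. Horizontal sides are controlled by
  \<open>lines\<close>, vertical ones only on average over the half-side \<open>s\<close>.\<close>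

lemma local_mean_bound:
  assumes adm: "admissible \<Phi>" and f: "f holomorphic_on upper_half_plane"
    and lines: "\<And>y. y > 0 \<Longrightarrow> (\<integral>\<^sup>+x. ennreal (\<Phi> (cmod (f (Complex x y)))) \<partial>lborel) \<le> 1"
    and d: "0 < d" "d < Im w" and a: "0 < cmod (f w)" and T: "T \<ge> 1"
    and sq: "\<And>v. \<bar>Re v - Re w\<bar> \<le> d \<Longrightarrow> \<bar>Im v - Im w\<bar> \<le> d \<Longrightarrow> cmod (f v) \<le> T * cmod (f w)"
  shows "d * \<Phi> (cmod (f w) / 4) \<le> 5 * T"
proof -
  define a where "a = cmod (f w)"
  have a0: "a > 0" using a by (simp add: a_def)
  have \<Phi>a: "\<Phi> (a / 4) > 0" using admissible_pos[OF adm] a0 by simp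
  \<comment> \<open>With this constant \<open>c * \<Phi> u \<ge> T * a\<close> as soon as
    \<open>u > a / 4\<close>.\<close>
  define c where "c = T * a / \<Phi> (a / 4)"
  have c0: "c > 0" using a0 \<Phi>a T by (simp add: c_def)
  have pt: "u \<le> a / 4 + c * \<Phi> u" if "0 \<le> u" "u \<le> T * a" for u
  proof (cases "u \<le> a / 4")
    case True
    then show ?thesis using admissible_nonneg[OF adm that(1)] c0 by (simp add: add_increasing2)
  next
    case False
    then have "\<Phi> (a / 4) \<le> \<Phi> u" using a0 by (intro admissible_mono[OF adm]) auto
    then have "T * a * 1 \<le> T * a * (\<Phi> u / \<Phi> (a / 4))"
      using T a0 \<Phi>a by (intro mult_left_mono) auto
    then show ?thesis using that a0 by (simp add: c_def)
  qed
  define h where "h v = indicator upper_half_plane v *\<^sub>R \<Phi> (cmod (f v))" for v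
  have cf: "continuous_on upper_half_plane f" by (rule holomorphic_on_imp_continuous_on[OF f])
  have [measurable]: "h \<in> borel_measurable borel"
    unfolding h_def using open_upper_half_plane
    by (intro borel_measurable_continuous_on_indicator admissible_continuous_compose[OF adm]
        continuous_intros cf) auto
  have lines': "(\<integral>\<^sup>+x. ennreal (h (Complex (b + x) y)) \<partial>lborel) \<le> 1"
    and lines'': "(\<integral>\<^sup>+x. ennreal (h (Complex (b - x) y)) \<partial>lborel) \<le> 1" for b y
  proof -
    have m: "(\<lambda>x. ennreal (h (Complex x y))) \<in> borel_measurable borel"
      unfolding Complex_eq by measurable
    have *: "(\<integral>\<^sup>+x. ennreal (h (Complex x y)) \<partial>lborel) \<le> 1"
    proof (cases "y > 0")
      case True
      then show ?thesis using lines[OF True] by (simp add: h_def upper_half_plane_def)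
    next
      case False
      then show ?thesis by (simp add: h_def upper_half_plane_def)
    qed
    show "(\<integral>\<^sup>+x. ennreal (h (Complex (b + x) y)) \<partial>lborel) \<le> 1"
      using nn_integral_real_affine[OF m, of 1 b] * by simp
    show "(\<integral>\<^sup>+x. ennreal (h (Complex (b - x) y)) \<partial>lborel) \<le> 1"
      using nn_integral_real_affine[OF m, of "-1" b] * by simp
  qed
  \<comment> \<open>The vertical line at distance \<open>s\<close> from \<open>Re w\<close>, on the
    side given by the sign \<open>\<sigma>\<close>. A single one is not controlled; integrated over
    \<open>s\<close> it becomes an integral over a strip of height \<open>2 * d\<close>, to which
    each horizontal line contributes at most 1.\<close>
  define V where "V \<sigma> s = (\<integral>\<^sup>+\<tau>. indicator {- d..d} \<tau> * ennreal (h (Complex (Re w + \<sigma> * s) (Im w + \<tau>))) \<partial>lborel)" for \<sigma> s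
  have Vint: "(\<integral>\<^sup>+s. V \<sigma> s \<partial>lborel) \<le> ennreal (2 * d)" if "\<sigma> \<in> {1, -1}" for \<sigma>
  proof -
    have m: "(\<lambda>(s, \<tau>). indicator {- d..d} \<tau> * ennreal (h (Complex (Re w + \<sigma> * s) (Im w + \<tau>))))
        \<in> borel_measurable (lborel \<Otimes>\<^sub>M lborel)"
      unfolding Complex_eq by measurable
    have "(\<integral>\<^sup>+s. V \<sigma> s \<partial>lborel) =
        (\<integral>\<^sup>+\<tau>. \<integral>\<^sup>+s. indicator {- d..d} \<tau> * ennreal (h (Complex (Re w + \<sigma> * s) (Im w + \<tau>))) \<partial>lborel \<partial>lborel)"
      unfolding V_def by (rule lborel_pair.Fubini'[OF m, symmetric])
    also have "\<dots> \<le> (\<integral>\<^sup>+\<tau>. indicator {- d..d} \<tau> \<partial>lborel)"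
    proof (rule nn_integral_mono)
      fix \<tau>
      have "(\<integral>\<^sup>+s. ennreal (h (Complex (Re w + \<sigma> * s) (Im w + \<tau>))) \<partial>lborel) \<le> 1"
        using that lines'[of "Re w" "Im w + \<tau>"] lines''[of "Re w" "Im w + \<tau>"] by auto
      then show "(\<integral>\<^sup>+s. indicator {- d..d} \<tau> * ennreal (h (Complex (Re w + \<sigma> * s) (Im w + \<tau>))) \<partial>lborel)
          \<le> indicator {- d..d} \<tau>"
        by (cases "\<tau> \<in> {- d..d}") auto
    qed
    also have "\<dots> = ennreal (2 * d)" using d by simp
    finally show ?thesis .
  qed
  have Vm: "V \<sigma> \<in> borel_measurable lborel" for \<sigma>
    unfolding V_def Complex_eq by measurable
  have key: "ennreal (2 * d * \<Phi> (a / 4)) \<le> ennreal T * (2 + (V 1 s + V (-1) s))" if s: "d / 2 \<le> s" "s \<le> d" for s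
  proof -
    define a1 a2 a3 a4 where "a1 = w + Complex (- s) (- s)" and "a2 = w + Complex s (- s)"
      and "a3 = w + Complex s s" and "a4 = w + Complex (- s) s"
    note a_defs = a1_def a2_def a3_def a4_def
    have s0: "s > 0" "s < Im w" using s d by auto
    have l1: "linepath a1 a2 t = Complex (Re w + (- s + 2 * s * t)) (Im w - s)" for t
      by (simp add: a_defs linepath_def complex_eq_iff algebra_simps)
    have l2: "linepath a2 a3 t = Complex (Re w + 1 * s) (Im w + (- s + 2 * s * t))" for t
      by (simp add: a_defs linepath_def complex_eq_iff algebra_simps)
    have l3: "linepath a3 a4 t = Complex (Re w + (s + (- 2 * s) * t)) (Im w + s)" for t
      by (simp add: a_defs linepath_def complex_eq_iff algebra_simps)
    have l4: "linepath a4 a1 t = Complex (Re w + - 1 * s) (Im w + (s + (- 2 * s) * t))" for t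
      by (simp add: a_defs linepath_def complex_eq_iff algebra_simps)
    have bnd: "0 \<le> s * t" "s * t \<le> s" if "t \<in> {0..1}" for t
      using that s0 by (auto simp: mult_left_le)
    define I where "I b e = integral {0..1} (\<lambda>t. \<Phi> (cmod (f (linepath b e t))))" for b e
    define Q where "Q = {(a1, a2), (a2, a3), (a3, a4), (a4, a1)}"
    have inQ: "linepath b e t \<in> upper_half_plane" "cmod (f (linepath b e t)) \<le> T * a"
      if "(b, e) \<in> Q" "t \<in> {0..1}" for b e t
    proof -
      have "\<bar>2 * s * t - s\<bar> \<le> d" "\<bar>s - 2 * s * t\<bar> \<le> d"
        unfolding abs_le_iff mult.assoc using bnd[OF that(2)] s by linarith+
      then have *: "\<bar>Re (linepath b e t) - Re w\<bar> \<le> d" "\<bar>Im (linepath b e t) - Im w\<bar> \<le> d"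
        using that(1) s s0 by (auto simp: Q_def l1 l2 l3 l4)
      then show "cmod (f (linepath b e t)) \<le> T * a" using sq by (simp add: a_def)
      show "linepath b e t \<in> upper_half_plane" using * d by (auto simp: upper_half_plane_def)
    qed
    have cont: "continuous_on {0..1} (\<lambda>t. cmod (f (linepath b e t)))"
      "continuous_on {0..1} (\<lambda>t. \<Phi> (cmod (f (linepath b e t))))" if "(b, e) \<in> Q" for b e
    proof -
      show *: "continuous_on {0..1} (\<lambda>t. cmod (f (linepath b e t)))"
        using inQ[OF that] by (intro continuous_intros continuous_on_compose2[OF cf]) auto
      show "continuous_on {0..1} (\<lambda>t. \<Phi> (cmod (f (linepath b e t))))"
        by (intro admissible_continuous_compose[OF adm] *) auto
    qed
    have le: "integral {0..1} (\<lambda>t. cmod (f (linepath b e t))) \<le> a / 4 + c * I b e" if "(b, e) \<in> Q" for b e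
    proof -
      have "integral {0..1} (\<lambda>t. cmod (f (linepath b e t)))
          \<le> integral {0..1} (\<lambda>t. a / 4 + c * \<Phi> (cmod (f (linepath b e t))))"
        using inQ[OF that] that
        by (intro integral_le integrable_continuous_interval continuous_intros cont pt) auto
      also have "\<dots> = a / 4 + c * I b e"
        unfolding I_def using that
        by (subst integral_add) (auto intro!: integrable_continuous_interval continuous_intros cont)
      finally show ?thesis .
    qed
    have "pi * a \<le> a + c * (I a1 a2 + I a2 a3 + I a3 a4 + I a4 a1)"
      using cauchy_square_bound[OF f s0] le[of a1 a2] le[of a2 a3] le[of a3 a4] le[of a4 a1]
      by (simp add: Q_def a_def a_defs algebra_simps)
    \<comment> \<open>The four copies of \<open>a / 4\<close> use up one \<open>a\<close>; since
      \<open>pi > 3\<close>, at least \<open>2 * a\<close> remains for the terms with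
      \<open>\<Phi>\<close>.\<close>
    moreover have "3 * a \<le> pi * a" using pi_gt3 a0 by simp
    ultimately have "2 * a \<le> c * (I a1 a2 + I a2 a3 + I a3 a4 + I a4 a1)" by linarith
    then have "a * (2 * \<Phi> (a / 4)) \<le> a * (T * (I a1 a2 + I a2 a3 + I a3 a4 + I a4 a1))"
      using \<Phi>a by (simp add: c_def field_simps)
    then have "2 * \<Phi> (a / 4) \<le> T * (I a1 a2 + I a2 a3 + I a3 a4 + I a4 a1)"
      using a0 by simp
    \<comment> \<open>The factor \<open>2 * s\<close> turns parametrised integrals into arc length;
      on the left \<open>s \<ge> d / 2\<close> replaces it by \<open>d\<close>.\<close>
    then have "s * (2 * (2 * \<Phi> (a / 4))) \<le> s * (2 * (T * (I a1 a2 + I a2 a3 + I a3 a4 + I a4 a1)))"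
      using s0 by (intro mult_left_mono) auto
    moreover have "d / 2 * (2 * (2 * \<Phi> (a / 4))) \<le> s * (2 * (2 * \<Phi> (a / 4)))"
      using s \<Phi>a by (intro mult_right_mono) auto
    ultimately have le1: "2 * d * \<Phi> (a / 4) \<le> T * (2 * s * I a1 a2 + 2 * s * I a3 a4 + (2 * s * I a2 a3 + 2 * s * I a4 a1))"
      by (simp add: algebra_simps)
    have I0: "I b e \<ge> 0" if "(b, e) \<in> Q" for b e
      unfolding I_def using that
      by (intro integral_nonneg integrable_continuous_interval cont admissible_nonneg[OF adm]) auto
    have mh: "(\<lambda>\<tau>. ennreal (h (Complex (Re w + \<tau>) y))) \<in> borel_measurable borel"
       "(\<lambda>\<tau>. indicator {- d..d} \<tau> * ennreal (h (Complex x (Im w + \<tau>)))) \<in> borel_measurable borel" for x y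
      unfolding Complex_eq by measurable
    have h_eq: "h (linepath b e t) = \<Phi> (cmod (f (linepath b e t)))" if "(b, e) \<in> Q" "t \<in> {0..1}" for b e t
      using inQ(1)[OF that] by (simp add: h_def)
    have "ennreal (2 * s * I a1 a2) \<le> 1"
    proof -
      have "ennreal (\<bar>2 * s\<bar> * I a1 a2) \<le> (\<integral>\<^sup>+\<tau>. ennreal (h (Complex (Re w + \<tau>) (Im w - s))) \<partial>lborel)"
        unfolding I_def
      proof (rule nn_integral_affine_ge[where b="-s", OF mh(1)])
        fix t :: real assume t: "t \<in> {0..1}"
        then show "ennreal (\<Phi> (cmod (f (linepath a1 a2 t))))
            \<le> ennreal (h (Complex (Re w + (- s + 2 * s * t)) (Im w - s)))"
          using h_eq[of a1 a2 t] unfolding l1 by (simp add: Q_def)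
      qed (use s0 in \<open>auto simp: Q_def intro!: cont admissible_nonneg[OF adm]\<close>)
      from order_trans[OF this lines'] show ?thesis using s0 by simp
    qed
    moreover have "ennreal (2 * s * I a3 a4) \<le> 1"
    proof -
      have "ennreal (\<bar>- 2 * s\<bar> * I a3 a4) \<le> (\<integral>\<^sup>+\<tau>. ennreal (h (Complex (Re w + \<tau>) (Im w + s))) \<partial>lborel)"
        unfolding I_def
      proof (rule nn_integral_affine_ge[where b="s", OF mh(1)])
        fix t :: real assume t: "t \<in> {0..1}"
        then show "ennreal (\<Phi> (cmod (f (linepath a3 a4 t))))
            \<le> ennreal (h (Complex (Re w + (s + - 2 * s * t)) (Im w + s)))"
          using h_eq[of a3 a4 t] unfolding l3 by (simp add: Q_def)
      qed (use s0 in \<open>auto simp: Q_def intro!: cont admissible_nonneg[OF adm]\<close>)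
      from order_trans[OF this lines'] show ?thesis using s0 by simp
    qed
    moreover have "ennreal (2 * s * I a2 a3) \<le> V 1 s"
    proof -
      have "ennreal (\<bar>2 * s\<bar> * I a2 a3) \<le> V 1 s"
        unfolding I_def V_def
      proof (rule nn_integral_affine_ge[where b="-s", OF mh(2)])
        fix t :: real assume t: "t \<in> {0..1}"
        have "- s + 2 * s * t \<in> {- d..d}"
          unfolding atLeastAtMost_iff mult.assoc using bnd[OF t] s by linarith
        with t show "ennreal (\<Phi> (cmod (f (linepath a2 a3 t)))) \<le>
           indicator {- d..d} (- s + 2 * s * t) * ennreal (h (Complex (Re w + 1 * s) (Im w + (- s + 2 * s * t))))"
          using h_eq[of a2 a3 t] unfolding l2 by (simp add: Q_def indicator_def)
      qed (use s0 in \<open>auto simp: Q_def intro!: cont admissible_nonneg[OF adm]\<close>)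
      then show ?thesis using s0 by simp
    qed
    moreover have "ennreal (2 * s * I a4 a1) \<le> V (-1) s"
    proof -
      have "ennreal (\<bar>- 2 * s\<bar> * I a4 a1) \<le> V (-1) s"
        unfolding I_def V_def
      proof (rule nn_integral_affine_ge[where b="s", OF mh(2)])
        fix t :: real assume t: "t \<in> {0..1}"
        have "s + - 2 * s * t \<in> {- d..d}"
          unfolding atLeastAtMost_iff mult.assoc using bnd[OF t] s by linarith
        with t show "ennreal (\<Phi> (cmod (f (linepath a4 a1 t)))) \<le>
           indicator {- d..d} (s + - 2 * s * t) * ennreal (h (Complex (Re w + - 1 * s) (Im w + (s + - 2 * s * t))))"
          using h_eq[of a4 a1 t] unfolding l4 by (simp add: Q_def indicator_def)
      qed (use s0 in \<open>auto simp: Q_def intro!: cont admissible_nonneg[OF adm]\<close>)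
      then show ?thesis using s0 by simp
    qed
    ultimately have le2: "ennreal (2 * s * I a1 a2) + ennreal (2 * s * I a3 a4) +
       (ennreal (2 * s * I a2 a3) + ennreal (2 * s * I a4 a1)) \<le> 1 + 1 + (V 1 s + V (-1) s)"
      by (intro add_mono)
    have "ennreal (2 * d * \<Phi> (a / 4)) \<le> ennreal (T * (2 * s * I a1 a2 + 2 * s * I a3 a4 + (2 * s * I a2 a3 + 2 * s * I a4 a1)))"
      by (rule ennreal_leI[OF le1])
    also have "\<dots> = ennreal T * (ennreal (2 * s * I a1 a2) + ennreal (2 * s * I a3 a4) +
       (ennreal (2 * s * I a2 a3) + ennreal (2 * s * I a4 a1)))"
    proof -
      have "0 \<le> 2 * s * I b e" if "(b, e) \<in> Q" for b e using I0[OF that] s0 by simp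
      then have "0 \<le> 2 * s * I a1 a2" "0 \<le> 2 * s * I a3 a4" "0 \<le> 2 * s * I a2 a3" "0 \<le> 2 * s * I a4 a1"
        by (auto simp only: Q_def insert_iff)
      then show ?thesis using T by (subst ennreal_mult') (auto simp only: ennreal_plus add_nonneg_nonneg)
    qed
    also have "\<dots> \<le> ennreal T * (1 + 1 + (V 1 s + V (-1) s))"
      by (intro mult_left_mono le2) simp
    finally show ?thesis by simp
  qed
  \<comment> \<open>Integration over \<open>s\<close> in \<open>[d / 2, d]\<close>: the two
    horizontal sides give \<open>d\<close> together, the vertical ones \<open>2 * d\<close> each,
    hence the 5.\<close>
  have "ennreal (2 * d * \<Phi> (a / 4)) * ennreal (d / 2) = (\<integral>\<^sup>+s. ennreal (2 * d * \<Phi> (a / 4)) * indicator {d / 2..d} s \<partial>lborel)"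
    using d by (simp add: nn_integral_cmult_indicator)
  also have "\<dots> \<le> (\<integral>\<^sup>+s. ennreal T * (2 * indicator {d / 2..d} s + (V 1 s + V (-1) s)) \<partial>lborel)"
    by (intro nn_integral_mono) (use key in \<open>auto simp: indicator_def\<close>)
  also have "\<dots> = ennreal T * (2 * ennreal (d / 2) + ((\<integral>\<^sup>+s. V 1 s \<partial>lborel) + (\<integral>\<^sup>+s. V (-1) s \<partial>lborel)))"
    using Vm d by (simp add: nn_integral_cmult nn_integral_add)
  also have "\<dots> \<le> ennreal T * (2 * ennreal (d / 2) + (ennreal (2 * d) + ennreal (2 * d)))"
    by (intro mult_left_mono add_mono Vint order.refl) auto
  also have "\<dots> = ennreal (T * (5 * d))"
  proof -
    have "2 * ennreal (d / 2) = ennreal d" using d ennreal_mult'[of 2 "d / 2"] by simp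
    then have "2 * ennreal (d / 2) + (ennreal (2 * d) + ennreal (2 * d)) = ennreal (5 * d)"
      using d by (simp flip: ennreal_plus)
    then show ?thesis using T by (simp add: ennreal_mult')
  qed
  finally have "ennreal (2 * d * \<Phi> (a / 4) * (d / 2)) \<le> ennreal (T * (5 * d))"
    by (subst ennreal_mult'') (use d in auto)
  then have "2 * d * \<Phi> (a / 4) * (d / 2) \<le> T * (5 * d)"
    using d T by (simp add: ennreal_le_iff)
  then have "d * (d * \<Phi> (a / 4)) \<le> d * (5 * T)" by (simp add: algebra_simps)
  then show ?thesis using d by (simp add: a_def)
qed

text \<open>
  Maximising \<open>|f w| (R - |w - z|) powr (1 / p)\<close> over the closed disc makes \<open>|f|\<close> comparable to its
  value at the maximum point on a square around it; this replaces the subharmonicity of \<open>|f| powr p\<close>.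
\<close>

lemma hardy_pointwise_bound:
  assumes adm: "admissible \<Phi>" and R: "R > 0"
  obtains M where "M > 0"
    "\<And>f z. f holomorphic_on upper_half_plane \<Longrightarrow>
      (\<And>y. y > 0 \<Longrightarrow> (\<integral>\<^sup>+x. ennreal (\<Phi> (cmod (f (Complex x y)))) \<partial>lborel) \<le> 1) \<Longrightarrow> R < Im z \<Longrightarrow> cmod (f z) \<le> M"
proof -
  obtain p C where p: "p > 0" "C > 0"
    and lt: "\<And>s t. 0 \<le> s \<Longrightarrow> 0 \<le> t \<Longrightarrow> t \<le> 1 \<Longrightarrow> \<Phi> (s * t) \<le> C * t powr p * \<Phi> s"
    using admissible_lower_type[OF adm] by metis
  \<comment> \<open>This exponent fits the bound \<open>\<rho> * (a / 4) powr p \<le> D\<close>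
    below: raised to the power \<open>1 / p\<close> it bounds \<open>a * \<rho> powr m\<close>, the
    quantity that is maximised.\<close>
  define m where "m = 1 / p"
  have m: "m > 0" using p by (simp add: m_def)
  define D where "D = 20 * 2 powr m * C / \<Phi> 1"
  have \<Phi>1: "\<Phi> 1 > 0" using admissible_pos[OF adm] by simp
  have D: "D > 0" using p \<Phi>1 by (simp add: D_def)
  \<comment> \<open>The entry 4 settles the case \<open>a \<le> 4\<close>; the other one settles
    \<open>a > 4\<close>, where lower type applies with the ratio \<open>4 / a\<close>.\<close>
  define M where "M = max 4 (4 * D powr m / R powr m)"
  show thesis
  proof (rule that[of M])
    show "M > 0" by (simp add: M_def)
    fix f z assume f: "f holomorphic_on upper_half_plane"
      and lines: "\<And>y. y > 0 \<Longrightarrow> (\<integral>\<^sup>+x. ennreal (\<Phi> (cmod (f (Complex x y)))) \<partial>lborel) \<le> 1"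
      and z: "R < Im z"
    define F where "F v = cmod (f v) * (R - cmod (v - z)) powr m" for v
    show "cmod (f z) \<le> M"
    proof (cases "f z = 0")
      case True
      then show ?thesis by (simp add: M_def)
    next
      case False
      have cb: "cball z R \<subseteq> upper_half_plane"
      proof
        fix v assume "v \<in> cball z R"
        then have "cmod (z - v) \<le> R" by (simp add: dist_norm)
        then show "v \<in> upper_half_plane"
          using abs_Im_le_cmod[of "z - v"] z by (simp add: upper_half_plane_def)
      qed
      have "continuous_on (cball z R) F"
        unfolding F_def using m
        by (intro continuous_intros continuous_on_powr' continuous_on_subset[OF holomorphic_on_imp_continuous_on[OF f] cb])
          (auto simp: dist_norm norm_minus_commute)
      then obtain w where w: "w \<in> cball z R" and max: "\<And>v. v \<in> cball z R \<Longrightarrow> F v \<le> F w"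
        using continuous_attains_sup[of "cball z R" F] R by auto
      have Fz: "F z = cmod (f z) * R powr m" by (simp add: F_def)
      then have "0 < F z" using False R by simp
      then have Fw: "0 < F w" using max[of z] R by simp
      define \<rho> where "\<rho> = R - cmod (w - z)"
      define a where "a = cmod (f w)"
      have Fw_eq: "F w = a * \<rho> powr m" by (simp add: F_def a_def \<rho>_def)
      have \<rho>: "0 < \<rho>" "\<rho> \<le> R"
        using Fw w by (auto simp: Fw_eq \<rho>_def dist_norm norm_minus_commute less_le)
      have a: "0 < a" using Fw by (auto simp: Fw_eq a_def)
      \<comment> \<open>Points of the square with half-side \<open>\<rho> / 4\<close> are within
        \<open>\<rho> / 2\<close> of \<open>w\<close>, so the weight drops by at most
        \<open>2 powr m\<close> there; maximality then gives \<open>T = 2 powr m\<close>. Clearing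
        the 4 leads to the 20 in \<open>D\<close>.\<close>
      have "\<rho> / 4 * \<Phi> (cmod (f w) / 4) \<le> 5 * (2 powr m)"
      proof (rule local_mean_bound[OF adm f lines])
        show "\<rho> / 4 < Im w"
          using \<rho> z abs_Im_le_cmod[of "w - z"] by (simp add: \<rho>_def abs_le_iff)
        show "1 \<le> (2::real) powr m" using m by (simp add: ge_one_powr_ge_zero)
        fix v assume v: "\<bar>Re v - Re w\<bar> \<le> \<rho> / 4" "\<bar>Im v - Im w\<bar> \<le> \<rho> / 4"
        have "cmod (v - w) \<le> \<rho> / 2" using cmod_le[of "v - w"] v by simp
        then have *: "\<rho> / 2 \<le> R - cmod (v - z)"
          using norm_triangle_ineq[of "v - w" "w - z"] by (simp add: \<rho>_def)
        then have "v \<in> cball z R" using \<rho> by (simp add: dist_norm norm_minus_commute)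
        have "cmod (f v) * (\<rho> / 2) powr m \<le> F v"
          unfolding F_def using * \<rho> m by (intro mult_left_mono powr_mono2) auto
        also have "\<dots> \<le> a * \<rho> powr m" using max[OF \<open>v \<in> cball z R\<close>] by (simp add: Fw_eq)
        finally show "cmod (f v) \<le> 2 powr m * cmod (f w)"
          using \<rho> by (simp add: powr_divide field_simps a_def)
      qed (use \<rho> a in \<open>auto simp: a_def\<close>)
      then have mean: "\<rho> * \<Phi> (a / 4) \<le> 20 * 2 powr m" by (simp add: a_def)
      have "a * \<rho> powr m \<le> M * R powr m"
      proof (cases "a \<le> 4")
        case True
        then have "a * \<rho> powr m \<le> M * R powr m"
          using a \<rho> m by (intro mult_mono powr_mono2) (auto simp: M_def)
        then show ?thesis .
      next
        case False
        have "\<Phi> (a / 4 * (4 / a)) \<le> C * (4 / a) powr p * \<Phi> (a / 4)"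
          using False by (intro lt) auto
        then have "\<Phi> 1 * (a / 4) powr p \<le> C * \<Phi> (a / 4)"
          using False by (simp add: powr_divide field_simps)
        then have "\<rho> * (\<Phi> 1 * (a / 4) powr p) \<le> \<rho> * (C * \<Phi> (a / 4))"
          using \<rho> by (intro mult_left_mono) auto
        also have "\<dots> \<le> C * (20 * 2 powr m)"
          using mean p by (simp add: mult.left_commute)
        finally have "\<rho> * (a / 4) powr p \<le> D" using \<Phi>1 by (simp add: D_def field_simps)
        then have "(\<rho> * (a / 4) powr p) powr m \<le> D powr m"
          using \<rho> m by (intro powr_mono2) auto
        also have "(\<rho> * (a / 4) powr p) powr m = \<rho> powr m * (a / 4)"
          using \<rho> a p by (simp add: powr_mult powr_powr m_def)
        finally have "a * \<rho> powr m \<le> 4 * D powr m" by (simp add: field_simps)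
        also have "\<dots> = (4 * D powr m / R powr m) * R powr m" using R by simp
        also have "\<dots> \<le> M * R powr m" unfolding M_def by (intro mult_right_mono) auto
        finally show ?thesis .
      qed
      moreover have "F z \<le> F w" using max[of z] R by simp
      ultimately have "cmod (f z) * R powr m \<le> M * R powr m" unfolding Fz Fw_eq by linarith
      then show ?thesis using R by (simp add: mult_le_cancel_right)
    qed
  qed
qed

section \<open>Factorization\<close>

text \<open>\<open>A\<close> is the wanted boundary modulus, the term with \<open>\<delta>\<close>
  the floor. The modulus built is their maximum on \<open>[-R, R]\<close> and returns to the floor
  outside \<open>[-R - 1, R + 1]\<close>; \<open>v\<close> is \<open>cmod P\<close> continued to the
  real line. \<open>K\<close> depends on \<open>\<Phi>\<close> only, which is what later survives
  the limit.\<close>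

lemma outer_function_exists:
  assumes adm: "admissible \<Phi>"
  obtains K where "K > 0"
    "\<And>\<epsilon> \<delta> N R A L. \<epsilon> > 0 \<Longrightarrow> \<delta> > 0 \<Longrightarrow> L \<ge> 0 \<Longrightarrow> continuous_on UNIV A \<Longrightarrow> (\<And>t. 0 \<le> A t) \<Longrightarrow>
      (\<integral>\<^sup>+t. ennreal (\<Phi> (A t)) \<partial>lborel) +
      (\<integral>\<^sup>+t. ennreal (\<Phi> (\<delta> / cmod (growth_factor \<epsilon> (complex_of_real t)) ^ N)) \<partial>lborel) \<le> ennreal L \<Longrightarrow>
      \<exists>P v. P holomorphic_on upper_half_plane \<and> continuous_on {z. Im z \<ge> 0} v \<and>
        (\<forall>z. Im z > 0 \<longrightarrow> cmod (P z) = v z) \<and>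
        (\<forall>z. Im z \<ge> 0 \<longrightarrow> \<delta> / cmod (growth_factor \<epsilon> z) ^ N \<le> v z) \<and>
        (\<forall>t. \<bar>t\<bar> \<le> R \<longrightarrow> A t \<le> v (complex_of_real t)) \<and>
        (\<forall>z. Im z > 0 \<longrightarrow> \<Phi> (v z / 2) \<le> K * L / Im z) \<and>
        (\<forall>y>0. (\<integral>\<^sup>+x. ennreal (\<Phi> (v (Complex x y) / 2)) \<partial>lborel) \<le> ennreal (K * L))"
proof (rule outer_mean_bound[OF adm])
  fix K :: real
  assume K: "K > 0" and mean: "\<And>\<epsilon> \<delta> N \<phi> B z. \<epsilon> > 0 \<Longrightarrow> \<delta> > 0 \<Longrightarrow> continuous_on UNIV \<phi> \<Longrightarrow>
      (\<And>t. \<bar>\<phi> t\<bar> \<le> B) \<Longrightarrow> Im z > 0 \<Longrightarrow>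
      ennreal (\<Phi> (\<delta> / cmod (growth_factor \<epsilon> z) ^ N * exp (poisson \<phi> z) / 2)) \<le>
      ennreal K * (\<integral>\<^sup>+s. ennreal (\<Phi> (\<delta> / cmod (growth_factor \<epsilon> (complex_of_real (Re z + Im z * s))) ^ N
        * exp (\<phi> (Re z + Im z * s)))) \<partial>cauchy_measure)"
  show thesis
  proof (rule that[OF K])
    fix \<epsilon> \<delta> R L :: real and N :: nat and A :: "real \<Rightarrow> real"
    assume \<epsilon>: "\<epsilon> > 0" and \<delta>: "\<delta> > 0" and L: "L \<ge> 0" and Ac: "continuous_on UNIV A" and A0: "\<And>t. 0 \<le> A t"
      and int: "(\<integral>\<^sup>+t. ennreal (\<Phi> (A t)) \<partial>lborel) +
        (\<integral>\<^sup>+t. ennreal (\<Phi> (\<delta> / cmod (growth_factor \<epsilon> (complex_of_real t)) ^ N)) \<partial>lborel) \<le> ennreal L"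
    have pos: "0 < cmod (growth_factor \<epsilon> v)" if "Im v \<ge> 0" for v
      using growth_factor_ge_1[of \<epsilon> v] \<epsilon> that by linarith
    define E where "E z = \<delta> / cmod (growth_factor \<epsilon> z) ^ N" for z
    have Epos: "E z > 0" if "Im z \<ge> 0" for z using pos[OF that] \<delta> by (simp add: E_def)
    have Ec: "continuous_on {z. Im z \<ge> 0} E"
      unfolding E_def using pos by (intro continuous_intros) (auto simp: less_imp_neq)
    define e where "e t = E (complex_of_real t)" for t
    have epos: "e t > 0" for t by (simp add: e_def Epos)
    have ec: "continuous_on UNIV e"
      unfolding e_def by (intro continuous_on_compose2[OF Ec] continuous_intros) auto
    \<comment> \<open>Logarithm of the excess over the floor. Being nonnegative it can be cut off:
      the modulus sinks towards the floor and never below.\<close>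
    define \<psi> where "\<psi> t = ln (max (A t) (e t) / e t)" for t
    have \<psi>0: "\<psi> t \<ge> 0" for t using epos[of t] by (simp add: \<psi>_def)
    have "max (A t) (e t) > 0" for t using epos[of t] by (simp add: less_max_iff_disj)
    then have \<psi>c: "continuous_on UNIV \<psi>"
      unfolding \<psi>_def using epos by (intro continuous_intros Ac ec) (auto simp: less_imp_neq[symmetric])
    have exp\<psi>: "e t * exp (\<psi> t) = max (A t) (e t)" for t
      using epos[of t] by (simp add: \<psi>_def exp_ln less_max_iff_disj)
    define \<phi> where "\<phi> t = cutoff R t * \<psi> t" for t
    have \<phi>c: "continuous_on UNIV \<phi>" unfolding \<phi>_def by (intro continuous_intros \<psi>c)
    have \<phi>0: "0 \<le> \<phi> t" and \<phi>\<psi>: "\<phi> t \<le> \<psi> t" for t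
      using cutoff_bounds[of R t] \<psi>0[of t] by (auto simp: \<phi>_def mult_left_le_one_le)
    obtain B where B: "\<And>t. \<bar>\<phi> t\<bar> \<le> B"
      using cutoff_mult_bounded[OF \<psi>c, of R] unfolding \<phi>_def by metis
    have supp: "\<phi> t = 0" if "\<bar>t\<bar> > R + 1" for t using cutoff_eq(2)[of R t] that by (simp add: \<phi>_def)
    define b where "b t = e t * exp (\<phi> t)" for t
    have bpos: "b t > 0" for t using epos by (simp add: b_def)
    have bc: "continuous_on UNIV b" unfolding b_def by (intro continuous_intros ec \<phi>c)
    have b_le: "b t \<le> max (A t) (e t)" for t
      using epos[of t] \<phi>\<psi>[of t] unfolding exp\<psi>[symmetric] b_def by (intro mult_left_mono) auto
    have [measurable]: "(\<lambda>t. \<Phi> (A t)) \<in> borel_measurable borel" "(\<lambda>t. \<Phi> (e t)) \<in> borel_measurable borel"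
      "(\<lambda>t. \<Phi> (b t)) \<in> borel_measurable borel"
      by (intro borel_measurable_continuous_onI admissible_continuous_compose[OF adm] Ac ec bc A0
          less_imp_le[OF epos] less_imp_le[OF bpos])+
    have bint: "(\<integral>\<^sup>+t. ennreal (\<Phi> (b t)) \<partial>lborel) \<le> ennreal L"
    proof -
      have "\<Phi> (b t) \<le> \<Phi> (A t) + \<Phi> (e t)" for t
        using admissible_mono[OF adm less_imp_le[OF bpos] b_le, of t]
          admissible_nonneg[OF adm A0, of t] admissible_pos[OF adm epos, of t]
        by (auto simp: max_def split: if_splits)
      then have "(\<integral>\<^sup>+t. ennreal (\<Phi> (b t)) \<partial>lborel) \<le> (\<integral>\<^sup>+t. ennreal (\<Phi> (A t)) + ennreal (\<Phi> (e t)) \<partial>lborel)"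
        using admissible_nonneg[OF adm A0] admissible_pos[OF adm epos]
        by (intro nn_integral_mono) (simp add: ennreal_leI less_imp_le flip: ennreal_plus)
      also have "\<dots> \<le> ennreal L" using int[folded E_def, folded e_def] by (subst nn_integral_add) auto
      finally show ?thesis .
    qed
    \<comment> \<open>The part of the logarithm without compact support sits in the explicit
      quotient; \<open>herglotz\<close> sees only \<open>\<phi>\<close>.\<close>
    define P where "P z = of_real \<delta> / growth_factor \<epsilon> z ^ N * exp (herglotz (R + 1) \<phi> z)" for z
    define v where "v z = E z * exp (poisson \<phi> z)" for z
    have mean': "ennreal (\<Phi> (v z / 2)) \<le> ennreal K * (\<integral>\<^sup>+s. ennreal (\<Phi> (b (Re z + Im z * s))) \<partial>cauchy_measure)"
      if "Im z > 0" for z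
      using mean[OF \<epsilon> \<delta> \<phi>c B that] unfolding v_def E_def b_def e_def .
    have "P holomorphic_on upper_half_plane"
      unfolding P_def using pos
      by (intro holomorphic_intros herglotz_holomorphic \<phi>c) (auto simp: upper_half_plane_def)
    moreover have "continuous_on {z. Im z \<ge> 0} v"
      unfolding v_def
      by (intro continuous_intros Ec continuous_on_subset[OF poisson_continuous[OF \<phi>c B]]) auto
    moreover have "cmod (P z) = v z" if "Im z > 0" for z
      using Re_herglotz[OF \<phi>c supp that] \<delta>
      by (simp add: P_def v_def E_def norm_mult norm_divide norm_power)
    moreover have "\<delta> / cmod (growth_factor \<epsilon> z) ^ N \<le> v z" if "Im z \<ge> 0" for z
    proof -
      have "E z * 1 \<le> E z * exp (poisson \<phi> z)"
        using Epos[OF that] poisson_nonneg[of \<phi>, OF \<phi>0] by (intro mult_left_mono) auto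
      then show ?thesis by (simp add: v_def E_def)
    qed
    moreover have "A t \<le> v (complex_of_real t)" if "\<bar>t\<bar> \<le> R" for t
      using exp\<psi>[of t] cutoff_eq(1)[OF that] by (simp add: v_def poisson_real e_def \<phi>_def)
    moreover have "\<Phi> (v z / 2) \<le> K * L / Im z" if z: "Im z > 0" for z
    proof -
      have "ennreal (\<Phi> (v z / 2)) \<le> ennreal K * (ennreal (1 / (pi * Im z)) * ennreal L)"
        using mean'[OF z] nn_integral_cauchy_measure_le[of "\<lambda>t. ennreal (\<Phi> (b t))" "Im z" "Re z"] z bint
        by (elim order_trans) (auto intro!: mult_left_mono elim!: order_trans)
      also have "\<dots> = ennreal (K * (1 / (pi * Im z) * L))"
        using K z L unfolding mult.assoc
        by (subst ennreal_mult'[symmetric], simp, subst ennreal_mult'[symmetric], simp, simp)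
      finally have "\<Phi> (v z / 2) \<le> K * (1 / (pi * Im z) * L)"
        using K z L by (subst (asm) ennreal_le_iff) auto
      also have "\<dots> = K * L / Im z / pi" by simp
      also have "\<dots> \<le> K * L / Im z / 1"
        using K L z pi_gt3 by (intro divide_left_mono) auto
      finally show ?thesis by simp
    qed
    moreover have "(\<integral>\<^sup>+x. ennreal (\<Phi> (v (Complex x y) / 2)) \<partial>lborel) \<le> ennreal (K * L)" if y: "y > 0" for y
    proof -
      interpret prob_space cauchy_measure by (rule prob_space_cauchy_measure)
      have "(\<integral>\<^sup>+x. ennreal (\<Phi> (v (Complex x y) / 2)) \<partial>lborel)
          \<le> (\<integral>\<^sup>+x. ennreal K * (\<integral>\<^sup>+s. ennreal (\<Phi> (b (x + y * s))) \<partial>cauchy_measure) \<partial>lborel)"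
        using mean'[of "Complex _ y"] y by (intro nn_integral_mono) simp
      also have "\<dots> = ennreal K * (\<integral>\<^sup>+x. \<integral>\<^sup>+s. ennreal (\<Phi> (b (x + y * s))) \<partial>cauchy_measure \<partial>lborel)"
        by (rule nn_integral_cmult) measurable
      also have "\<dots> = ennreal K * (\<integral>\<^sup>+t. ennreal (\<Phi> (b t)) \<partial>lborel)"
        by (subst nn_integral_cauchy_measure_translate) auto
      also have "\<dots> \<le> ennreal K * ennreal L" by (intro mult_left_mono bint) simp
      finally show ?thesis using K by (simp add: ennreal_mult')
    qed
    ultimately show "\<exists>P v. P holomorphic_on upper_half_plane \<and> continuous_on {z. Im z \<ge> 0} v \<and>
        (\<forall>z. Im z > 0 \<longrightarrow> cmod (P z) = v z) \<and>
        (\<forall>z. Im z \<ge> 0 \<longrightarrow> \<delta> / cmod (growth_factor \<epsilon> z) ^ N \<le> v z) \<and>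
        (\<forall>t. \<bar>t\<bar> \<le> R \<longrightarrow> A t \<le> v (complex_of_real t)) \<and>
        (\<forall>z. Im z > 0 \<longrightarrow> \<Phi> (v z / 2) \<le> K * L / Im z) \<and>
        (\<forall>y>0. (\<integral>\<^sup>+x. ennreal (\<Phi> (v (Complex x y) / 2)) \<partial>lborel) \<le> ennreal (K * L))"
      by blast
  qed
qed

text \<open>Lower type turns decay of order \<open>m\<close> into decay of order
  \<open>m * p\<close> after applying \<open>\<Phi>\<close>, which is integrable once
  \<open>m * p \<ge> 2\<close>. The threshold \<open>N\<close> is fixed by \<open>\<Phi>\<close>;
  \<open>\<delta>0\<close> may shrink with \<open>\<epsilon>\<close>.\<close>

lemma growth_factor_power_integrable:
  assumes adm: "admissible \<Phi>"
  obtains N where "\<And>\<epsilon> m. \<epsilon> > 0 \<Longrightarrow> N \<le> m \<Longrightarrow> \<exists>\<delta>0>0. \<forall>\<delta>. 0 < \<delta> \<and> \<delta> \<le> \<delta>0 \<longrightarrow>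
    (\<integral>\<^sup>+t. ennreal (\<Phi> (\<delta> / cmod (growth_factor \<epsilon> (complex_of_real t)) ^ m)) \<partial>lborel) \<le> 1"
proof -
  obtain p C where p: "p > 0" "C > 0"
    and lt: "\<And>s t. 0 \<le> s \<Longrightarrow> 0 \<le> t \<Longrightarrow> t \<le> 1 \<Longrightarrow> \<Phi> (s * t) \<le> C * t powr p * \<Phi> s"
    using admissible_lower_type[OF adm] by metis
  have \<Phi>1: "\<Phi> 1 > 0" using admissible_pos[OF adm] by simp
  define N where "N = nat \<lceil>2 / p\<rceil>"
  have "2 / p \<le> real N" unfolding N_def by linarith
  then have N: "2 \<le> real N * p" using p by (simp add: field_simps)
  show thesis
  proof (rule that[of N])
    fix \<epsilon> :: real and m assume \<epsilon>: "\<epsilon> > 0" and m: "N \<le> m"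
    have "real N * p \<le> real m * p" using m p by simp
    with N have m2: "2 \<le> real m * p" by linarith
    \<comment> \<open>Solves \<open>C * \<Phi> 1 * q * (pi / \<epsilon>) = 1\<close>, where
      \<open>pi / \<epsilon>\<close> is the integral of
      \<open>1 / (1 + (\<epsilon> * t)^2)\<close>.\<close>
    define q where "q = \<epsilon> / (C * \<Phi> 1 * pi)"
    have q: "q > 0" using \<epsilon> p \<Phi>1 by (simp add: q_def)
    define \<delta>0 where "\<delta>0 = min 1 (q powr (1 / p))"
    have "(\<integral>\<^sup>+t. ennreal (\<Phi> (\<delta> / cmod (growth_factor \<epsilon> (complex_of_real t)) ^ m)) \<partial>lborel) \<le> 1"
      if \<delta>: "0 < \<delta>" "\<delta> \<le> \<delta>0" for \<delta>
    proof -
      have "\<delta> powr p \<le> (q powr (1 / p)) powr p"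
        using \<delta> p by (intro powr_mono2) (auto simp: \<delta>0_def)
      then have \<delta>p: "\<delta> powr p \<le> q" using p q by (simp add: powr_powr)
      have pt: "\<Phi> (\<delta> / cmod (growth_factor \<epsilon> (complex_of_real t)) ^ m) \<le> C * \<Phi> 1 * q * (1 / (1 + (\<epsilon> * t)\<^sup>2))" for t
      proof -
        define r where "r = cmod (growth_factor \<epsilon> (complex_of_real t))"
        have r: "r \<ge> 1" using growth_factor_ge_1[of \<epsilon> "complex_of_real t"] \<epsilon> by (simp add: r_def)
        then have rm: "r ^ m \<ge> 1" by simp
        have "\<delta> \<le> 1" using \<delta> by (simp add: \<delta>0_def)
        then have "\<delta> / r ^ m \<le> 1" using \<delta> rm by (auto simp: divide_le_eq)
        then have "\<Phi> (1 * (\<delta> / r ^ m)) \<le> C * (\<delta> / r ^ m) powr p * \<Phi> 1"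
          using \<delta> r by (intro lt) auto
        also have "(\<delta> / r ^ m) powr p = \<delta> powr p / r powr (real m * p)"
          using \<delta> r by (simp add: powr_divide powr_powr flip: powr_realpow)
        also have "C * (\<delta> powr p / r powr (real m * p)) * \<Phi> 1 \<le> C * (q / r powr 2) * \<Phi> 1"
          using p \<Phi>1 \<delta>p m2 r q
          by (intro mult_right_mono mult_left_mono frac_le powr_mono) auto
        also have "r powr 2 = 1 + (\<epsilon> * t)\<^sup>2"
          using r growth_factor_real[of \<epsilon> t] by (simp add: r_def powr_numeral power_mult_distrib)
        finally show ?thesis by (simp add: r_def mult_ac)
      qed
      have "(\<integral>\<^sup>+t. ennreal (\<Phi> (\<delta> / cmod (growth_factor \<epsilon> (complex_of_real t)) ^ m)) \<partial>lborel)
          \<le> (\<integral>\<^sup>+t. ennreal (C * \<Phi> 1 * q) * ennreal (1 / (1 + (\<epsilon> * t)\<^sup>2)) \<partial>lborel)"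
        by (intro nn_integral_mono) (subst ennreal_mult''[symmetric], simp, rule ennreal_leI, rule pt)
      also have "\<dots> = ennreal (C * \<Phi> 1 * q) * (\<integral>\<^sup>+t. ennreal (1 / (1 + (\<epsilon> * t)\<^sup>2)) \<partial>lborel)"
        by (rule nn_integral_cmult) measurable
      also have "ennreal pi = ennreal \<epsilon> * (\<integral>\<^sup>+t. ennreal (1 / (1 + (\<epsilon> * t)\<^sup>2)) \<partial>lborel)"
        using nn_integral_real_affine[of "\<lambda>s. ennreal (1 / (1 + s\<^sup>2))" \<epsilon> 0] \<epsilon>
        by (simp add: nn_integral_inverse_1_plus_square)
      then have "ennreal (1 / \<epsilon>) * ennreal pi = ennreal (1 / \<epsilon>) * ennreal \<epsilon> * (\<integral>\<^sup>+t. ennreal (1 / (1 + (\<epsilon> * t)\<^sup>2)) \<partial>lborel)"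
        by (simp add: mult.assoc)
      then have "(\<integral>\<^sup>+t. ennreal (1 / (1 + (\<epsilon> * t)\<^sup>2)) \<partial>lborel) = ennreal (pi / \<epsilon>)"
        using \<epsilon> by (simp flip: ennreal_mult')
      also have "ennreal (C * \<Phi> 1 * q) * ennreal (pi / \<epsilon>) = 1"
        using \<epsilon> p \<Phi>1 by (simp add: q_def flip: ennreal_mult'')
      finally show ?thesis by simp
    qed
    moreover have "\<delta>0 > 0" using q by (simp add: \<delta>0_def)
    ultimately show "\<exists>\<delta>0>0. \<forall>\<delta>. 0 < \<delta> \<and> \<delta> \<le> \<delta>0 \<longrightarrow>
      (\<integral>\<^sup>+t. ennreal (\<Phi> (\<delta> / cmod (growth_factor \<epsilon> (complex_of_real t)) ^ m)) \<partial>lborel) \<le> 1" by blast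
  qed
qed

text \<open>Neither \<open>K\<close> nor \<open>N\<close> depends on \<open>f\<close> or
  \<open>\<epsilon>\<close>. The shift by \<open>\<epsilon>\<close> makes \<open>f\<close>
  continuous and, by the pointwise bound, bounded up to the real line. Pointwise estimates are
  recorded for Montel's theorem, line integrals for Fatou's lemma.\<close>

lemma approximate_factorization:
  assumes adm1: "admissible \<Phi>1" and adm2: "admissible \<Phi>2" and adm3: "admissible \<Phi>3"
    and c: "c > 0" and inv: "\<And>u. 0 \<le> u \<Longrightarrow> u \<le> c * (growth_inv \<Phi>1 (c * \<Phi>3 u) * growth_inv \<Phi>2 (c * \<Phi>3 u))"
  obtains K N where "K > 0"
    "\<And>f \<epsilon>. f holomorphic_on upper_half_plane \<Longrightarrow>
      (\<And>y. y > 0 \<Longrightarrow> (\<integral>\<^sup>+x. ennreal (\<Phi>3 (cmod (f (Complex x y)))) \<partial>lborel) \<le> 1) \<Longrightarrow> \<epsilon> > 0 \<Longrightarrow>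
      \<exists>P Q. P holomorphic_on upper_half_plane \<and> Q holomorphic_on upper_half_plane \<and>
        (\<forall>z. Im z > 0 \<longrightarrow> P z * Q z = f (z + \<i> * of_real \<epsilon>) / growth_factor \<epsilon> z ^ N) \<and>
        (\<forall>z. Im z > 0 \<longrightarrow> \<Phi>1 (cmod (P z) / 2) \<le> K / Im z) \<and>
        (\<forall>z. Im z > 0 \<longrightarrow> \<Phi>2 (cmod (Q z) / (2 * c)) \<le> K / Im z) \<and>
        (\<forall>y>0. (\<integral>\<^sup>+x. ennreal (\<Phi>1 (cmod (P (Complex x y)) / 2)) \<partial>lborel) \<le> ennreal K) \<and>
        (\<forall>y>0. (\<integral>\<^sup>+x. ennreal (\<Phi>2 (cmod (Q (Complex x y)) / (2 * c))) \<partial>lborel) \<le> ennreal K)"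
proof (rule outer_function_exists[OF adm1], rule outer_function_exists[OF adm2],
    rule growth_factor_power_integrable[OF adm1], rule growth_factor_power_integrable[OF adm2])
  fix K1 K2 :: real and N1 N2 :: nat
  assume K1: "K1 > 0" and K2: "K2 > 0"
    and outer1: "\<And>\<epsilon> \<delta> N R A L. \<epsilon> > 0 \<Longrightarrow> \<delta> > 0 \<Longrightarrow> L \<ge> 0 \<Longrightarrow> continuous_on UNIV A \<Longrightarrow> (\<And>t. 0 \<le> A t) \<Longrightarrow>
      (\<integral>\<^sup>+t. ennreal (\<Phi>1 (A t)) \<partial>lborel) +
      (\<integral>\<^sup>+t. ennreal (\<Phi>1 (\<delta> / cmod (growth_factor \<epsilon> (complex_of_real t)) ^ N)) \<partial>lborel) \<le> ennreal L \<Longrightarrow>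
      \<exists>P v. P holomorphic_on upper_half_plane \<and> continuous_on {z. Im z \<ge> 0} v \<and>
        (\<forall>z. Im z > 0 \<longrightarrow> cmod (P z) = v z) \<and>
        (\<forall>z. Im z \<ge> 0 \<longrightarrow> \<delta> / cmod (growth_factor \<epsilon> z) ^ N \<le> v z) \<and>
        (\<forall>t. \<bar>t\<bar> \<le> R \<longrightarrow> A t \<le> v (complex_of_real t)) \<and>
        (\<forall>z. Im z > 0 \<longrightarrow> \<Phi>1 (v z / 2) \<le> K1 * L / Im z) \<and>
        (\<forall>y>0. (\<integral>\<^sup>+x. ennreal (\<Phi>1 (v (Complex x y) / 2)) \<partial>lborel) \<le> ennreal (K1 * L))"
    and outer2: "\<And>\<epsilon> \<delta> N R A L. \<epsilon> > 0 \<Longrightarrow> \<delta> > 0 \<Longrightarrow> L \<ge> 0 \<Longrightarrow> continuous_on UNIV A \<Longrightarrow> (\<And>t. 0 \<le> A t) \<Longrightarrow>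
      (\<integral>\<^sup>+t. ennreal (\<Phi>2 (A t)) \<partial>lborel) +
      (\<integral>\<^sup>+t. ennreal (\<Phi>2 (\<delta> / cmod (growth_factor \<epsilon> (complex_of_real t)) ^ N)) \<partial>lborel) \<le> ennreal L \<Longrightarrow>
      \<exists>P v. P holomorphic_on upper_half_plane \<and> continuous_on {z. Im z \<ge> 0} v \<and>
        (\<forall>z. Im z > 0 \<longrightarrow> cmod (P z) = v z) \<and>
        (\<forall>z. Im z \<ge> 0 \<longrightarrow> \<delta> / cmod (growth_factor \<epsilon> z) ^ N \<le> v z) \<and>
        (\<forall>t. \<bar>t\<bar> \<le> R \<longrightarrow> A t \<le> v (complex_of_real t)) \<and>
        (\<forall>z. Im z > 0 \<longrightarrow> \<Phi>2 (v z / 2) \<le> K2 * L / Im z) \<and>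
        (\<forall>y>0. (\<integral>\<^sup>+x. ennreal (\<Phi>2 (v (Complex x y) / 2)) \<partial>lborel) \<le> ennreal (K2 * L))"
    and tail1: "\<And>\<epsilon> m. \<epsilon> > 0 \<Longrightarrow> N1 \<le> m \<Longrightarrow> \<exists>\<delta>0>0. \<forall>\<delta>. 0 < \<delta> \<and> \<delta> \<le> \<delta>0 \<longrightarrow>
      (\<integral>\<^sup>+t. ennreal (\<Phi>1 (\<delta> / cmod (growth_factor \<epsilon> (complex_of_real t)) ^ m)) \<partial>lborel) \<le> 1"
    and tail2: "\<And>\<epsilon> m. \<epsilon> > 0 \<Longrightarrow> N2 \<le> m \<Longrightarrow> \<exists>\<delta>0>0. \<forall>\<delta>. 0 < \<delta> \<and> \<delta> \<le> \<delta>0 \<longrightarrow>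
      (\<integral>\<^sup>+t. ennreal (\<Phi>2 (\<delta> / cmod (growth_factor \<epsilon> (complex_of_real t)) ^ m)) \<partial>lborel) \<le> 1"
  define m where "m = max N1 N2"
  \<comment> \<open>The two floors together decay with order \<open>2 * m\<close>; the extra 1
    leaves a factor \<open>r\<close> that beats any constant at infinity.\<close>
  define N where "N = 2 * m + 1"
  \<comment> \<open>\<open>c\<close> bounds the integral for the prescribed boundary modulus, 1 the
    integral for the floor.\<close>
  define L where "L = c + 1"
  define K where "K = max K1 K2 * L"
  have L: "L > 0" using c by (simp add: L_def)
  have KK: "K1 * L \<le> K" "K2 * L \<le> K" using L by (auto simp: K_def)
  show thesis
  proof (rule that[of K N])
    show "K > 0" using KK K1 L by (smt (verit) mult_pos_pos)
    fix f :: "complex \<Rightarrow> complex" and \<epsilon> :: real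
    assume f: "f holomorphic_on upper_half_plane"
      and lines: "\<And>y. y > 0 \<Longrightarrow> (\<integral>\<^sup>+x. ennreal (\<Phi>3 (cmod (f (Complex x y)))) \<partial>lborel) \<le> 1"
      and \<epsilon>: "\<epsilon> > 0"
    obtain M where M: "M > 0" "\<And>z. \<epsilon> / 2 < Im z \<Longrightarrow> cmod (f z) \<le> M"
    proof (rule hardy_pointwise_bound[OF adm3, of "\<epsilon> / 2"])
      show "\<epsilon> / 2 > 0" using \<epsilon> by simp
    qed (use f lines that in blast)
    have ge1: "1 \<le> cmod (growth_factor \<epsilon> z)" if "Im z \<ge> 0" for z
      using growth_factor_ge_1[of \<epsilon> z] \<epsilon> that by simp
    then have ne0: "growth_factor \<epsilon> z \<noteq> 0" if "Im z \<ge> 0" for z using that by force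
    obtain \<delta>1 \<delta>2 where \<delta>12: "\<delta>1 > 0" "\<delta>2 > 0"
      "\<And>\<delta>. 0 < \<delta> \<Longrightarrow> \<delta> \<le> \<delta>1 \<Longrightarrow> (\<integral>\<^sup>+t. ennreal (\<Phi>1 (\<delta> / cmod (growth_factor \<epsilon> (complex_of_real t)) ^ m)) \<partial>lborel) \<le> 1"
      "\<And>\<delta>. 0 < \<delta> \<Longrightarrow> \<delta> \<le> \<delta>2 \<Longrightarrow> (\<integral>\<^sup>+t. ennreal (\<Phi>2 (\<delta> / cmod (growth_factor \<epsilon> (complex_of_real t)) ^ m)) \<partial>lborel) \<le> 1"
      using tail1[OF \<epsilon>, of m] tail2[OF \<epsilon>, of m] unfolding m_def by auto
    define \<delta> where "\<delta> = min \<delta>1 \<delta>2"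
    have \<delta>: "\<delta> > 0" "\<delta> \<le> \<delta>1" "\<delta> \<le> \<delta>2" using \<delta>12 by (auto simp: \<delta>_def)
    define G where "G z = f (z + \<i> * of_real \<epsilon>) / growth_factor \<epsilon> z ^ N" for z
    have cf: "continuous_on upper_half_plane f" by (rule holomorphic_on_imp_continuous_on[OF f])
    have Gc: "continuous_on {z. Im z \<ge> 0} G"
      unfolding G_def using \<epsilon> ne0
      by (intro continuous_intros continuous_on_compose2[OF cf]) (auto simp: upper_half_plane_def)
    have Gh: "G holomorphic_on upper_half_plane"
    proof -
      have "(f \<circ> (\<lambda>z. z + \<i> * of_real \<epsilon>)) holomorphic_on upper_half_plane"
        using \<epsilon> by (intro holomorphic_on_compose_gen[OF _ f] holomorphic_intros) (auto simp: upper_half_plane_def)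
      then have "(\<lambda>z. f (z + \<i> * of_real \<epsilon>)) holomorphic_on upper_half_plane" by (simp add: comp_def)
      then show ?thesis
        unfolding G_def using ne0
        by (intro holomorphic_intros) (auto simp: upper_half_plane_def)
    qed
    have G_le: "cmod (G z) \<le> cmod (f (z + \<i> * of_real \<epsilon>))" if "Im z \<ge> 0" for z
    proof -
      have "1 \<le> cmod (growth_factor \<epsilon> z) ^ N" using ge1[OF that] by simp
      then have "cmod (f (z + \<i> * of_real \<epsilon>)) / cmod (growth_factor \<epsilon> z) ^ N \<le> cmod (f (z + \<i> * of_real \<epsilon>)) / 1"
        by (intro divide_left_mono) auto
      then show ?thesis by (simp add: G_def norm_divide norm_power)
    qed
    define H where "H t = cmod (G (complex_of_real t))" for t
    have H0: "0 \<le> H t" for t by (simp add: H_def)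
    have Hc: "continuous_on UNIV H"
      unfolding H_def by (intro continuous_intros continuous_on_compose2[OF Gc]) auto
    have HM: "H t \<le> M" for t
      using G_le[of "complex_of_real t"] M(2)[of "complex_of_real t + \<i> * of_real \<epsilon>"] \<epsilon> by (simp add: H_def)
    have Hint: "(\<integral>\<^sup>+t. ennreal (\<Phi>3 (H t)) \<partial>lborel) \<le> 1"
    proof -
      have "(\<integral>\<^sup>+t. ennreal (\<Phi>3 (H t)) \<partial>lborel) \<le> (\<integral>\<^sup>+t. ennreal (\<Phi>3 (cmod (f (Complex t \<epsilon>)))) \<partial>lborel)"
        using G_le[of "complex_of_real _"]
        by (intro nn_integral_mono ennreal_leI admissible_mono[OF adm3]) (auto simp: H_def Complex_eq)
      also have "\<dots> \<le> 1" by (rule lines[OF \<epsilon>])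
      finally show ?thesis .
    qed
    \<comment> \<open>These are the prescribed moduli: \<open>\<Phi>\<close> of one is
      \<open>c * \<Phi>3 (H t)\<close>, with integral at most \<open>c\<close>, and by
      \<open>inv\<close> the product of the two is at least \<open>H t / c\<close>.\<close>
    have target: "continuous_on UNIV (\<lambda>t. growth_inv \<Phi> (c * \<Phi>3 (H t)))" "0 \<le> growth_inv \<Phi> (c * \<Phi>3 (H t))"
      "(\<integral>\<^sup>+t. ennreal (\<Phi> (growth_inv \<Phi> (c * \<Phi>3 (H t)))) \<partial>lborel) \<le> ennreal c"
      if adm: "admissible \<Phi>" for \<Phi> t
    proof -
      have nn: "0 \<le> c * \<Phi>3 (H t)" for t using c admissible_nonneg[OF adm3 H0] by simp
      show "0 \<le> growth_inv \<Phi> (c * \<Phi>3 (H t))" by (rule growth_inv_nonneg[OF adm nn])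
      have "c * \<Phi>3 (H t) \<le> c * \<Phi>3 M" for t
        using c by (intro mult_left_mono admissible_mono[OF adm3] H0 HM) auto
      then show "continuous_on UNIV (\<lambda>t. growth_inv \<Phi> (c * \<Phi>3 (H t)))"
        using nn
        by (intro continuous_on_compose2[OF growth_inv_continuous[OF adm]] continuous_intros
            admissible_continuous_compose[OF adm3] Hc H0) auto
      have meas: "(\<lambda>t. \<Phi>3 (H t)) \<in> borel_measurable lborel"
        using admissible_continuous_compose[OF adm3 Hc H0] by (simp add: borel_measurable_continuous_onI)
      have "(\<integral>\<^sup>+t. ennreal (\<Phi> (growth_inv \<Phi> (c * \<Phi>3 (H t)))) \<partial>lborel) = (\<integral>\<^sup>+t. ennreal c * ennreal (\<Phi>3 (H t)) \<partial>lborel)"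
        using c by (simp add: growth_inv_right[OF adm nn] ennreal_mult')
      also have "\<dots> = ennreal c * (\<integral>\<^sup>+t. ennreal (\<Phi>3 (H t)) \<partial>lborel)"
        using meas by (intro nn_integral_cmult) auto
      also have "\<dots> \<le> ennreal c * 1" by (intro mult_left_mono Hint) simp
      finally show "(\<integral>\<^sup>+t. ennreal (\<Phi> (growth_inv \<Phi> (c * \<Phi>3 (H t)))) \<partial>lborel) \<le> ennreal c" by simp
    qed
    have L_eq: "ennreal c + 1 = ennreal L" using c by (simp add: L_def)
    \<comment> \<open>With \<open>r = cmod (growth_factor \<epsilon> z)\<close>, the condition
      \<open>r \<ge> D\<close> says \<open>M \<le> c * \<delta>^2 * r\<close>; it holds for
      \<open>cmod z \<ge> R\<close> with the \<open>R\<close> below.\<close>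
    define D where "D = M / (c * \<delta>\<^sup>2)"
    have D: "D > 0" using M c \<delta> by (simp add: D_def)
    define R where "R = (D + 1) / \<epsilon>"
    obtain P v1 where P: "P holomorphic_on upper_half_plane" "continuous_on {z. Im z \<ge> 0} v1"
        "\<And>z. Im z > 0 \<Longrightarrow> cmod (P z) = v1 z"
        and v1: "\<And>z. Im z \<ge> 0 \<Longrightarrow> \<delta> / cmod (growth_factor \<epsilon> z) ^ m \<le> v1 z"
        "\<And>t. \<bar>t\<bar> \<le> R \<Longrightarrow> growth_inv \<Phi>1 (c * \<Phi>3 (H t)) \<le> v1 (complex_of_real t)"
        "\<And>z. Im z > 0 \<Longrightarrow> \<Phi>1 (v1 z / 2) \<le> K1 * L / Im z"
        "\<And>y. y > 0 \<Longrightarrow> (\<integral>\<^sup>+x. ennreal (\<Phi>1 (v1 (Complex x y) / 2)) \<partial>lborel) \<le> ennreal (K1 * L)"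
      using outer1[OF \<epsilon> \<delta>(1) less_imp_le[OF L] target(1,2)[OF adm1]
          add_mono[OF target(3)[OF adm1] \<delta>12(3)[OF \<delta>(1,2)], unfolded L_eq], of R] by blast
    obtain P2 v2 where P2: "P2 holomorphic_on upper_half_plane" "continuous_on {z. Im z \<ge> 0} v2"
        "\<And>z. Im z > 0 \<Longrightarrow> cmod (P2 z) = v2 z"
        and v2: "\<And>z. Im z \<ge> 0 \<Longrightarrow> \<delta> / cmod (growth_factor \<epsilon> z) ^ m \<le> v2 z"
        "\<And>t. \<bar>t\<bar> \<le> R \<Longrightarrow> growth_inv \<Phi>2 (c * \<Phi>3 (H t)) \<le> v2 (complex_of_real t)"
        "\<And>z. Im z > 0 \<Longrightarrow> \<Phi>2 (v2 z / 2) \<le> K2 * L / Im z"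
        "\<And>y. y > 0 \<Longrightarrow> (\<integral>\<^sup>+x. ennreal (\<Phi>2 (v2 (Complex x y) / 2)) \<partial>lborel) \<le> ennreal (K2 * L)"
      using outer2[OF \<epsilon> \<delta>(1) less_imp_le[OF L] target(1,2)[OF adm2]
          add_mono[OF target(3)[OF adm2] \<delta>12(4)[OF \<delta>(1,3)], unfolded L_eq], of R] by blast
    have v_pos: "0 < v1 z" "0 < v2 z" if "Im z \<ge> 0" for z
    proof -
      have "0 < \<delta> / cmod (growth_factor \<epsilon> z) ^ m" using ge1[OF that] \<delta> by (intro divide_pos_pos zero_less_power) auto
      then show "0 < v1 z" "0 < v2 z" using v1(1)[OF that] v2(1)[OF that] by linarith+
    qed
    have P_ne: "P z \<noteq> 0" "P2 z \<noteq> 0" if "z \<in> upper_half_plane" for z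
      using P(3)[of z] P2(3)[of z] v_pos[of z] that by (auto simp: upper_half_plane_def)
    define w where "w z = cmod (G z) / (c * (v1 z * v2 z))" for z
    have far: "w z \<le> 1" if z: "Im z \<ge> 0" "cmod z \<ge> R" for z
    proof -
      define r where "r = cmod (growth_factor \<epsilon> z)"
      have r1: "r \<ge> 1" using ge1[OF z(1)] by (simp add: r_def)
      have "D \<le> \<epsilon> * cmod z - 1" using z(2) \<epsilon> by (simp add: R_def field_simps)
      then have "D \<le> r" using growth_factor_ge[of \<epsilon> z] \<epsilon> by (simp add: r_def)
      then have Mr: "M \<le> c * \<delta>\<^sup>2 * r" using c \<delta> by (simp add: D_def field_simps)
      have "cmod (G z) = cmod (f (z + \<i> * of_real \<epsilon>)) / r ^ N"
        by (simp add: G_def norm_divide norm_power r_def)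
      also have "\<dots> \<le> M / r ^ N"
        using M(2)[of "z + \<i> * of_real \<epsilon>"] z \<epsilon> r1 by (intro divide_right_mono) auto
      also have "\<dots> \<le> c * \<delta>\<^sup>2 * r / r ^ N" using Mr r1 by (intro divide_right_mono) auto
      also have "\<dots> = c * (\<delta> / r ^ m * (\<delta> / r ^ m))"
      proof -
        have "r ^ N = r ^ m * r ^ m * r" by (simp add: N_def mult_2 power_add)
        then show ?thesis using r1 by (simp add: power2_eq_square field_simps)
      qed
      also have "\<dots> \<le> c * (v1 z * v2 z)"
        using c v1(1)[OF z(1)] v2(1)[OF z(1)] \<delta> r1 v_pos[OF z(1)]
        by (intro mult_left_mono mult_mono) (auto simp: r_def)
      finally show ?thesis using c v_pos[OF z(1)] by (simp add: w_def)
    qed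
    have w_le: "w z \<le> 1" if z: "Im z > 0" for z
    proof (rule half_plane_maximum_principle[where W="\<lambda>z. G z / (of_real c * (P z * P2 z))"])
      show "(\<lambda>z. G z / (of_real c * (P z * P2 z))) holomorphic_on upper_half_plane"
        using P_ne c by (intro holomorphic_intros Gh P P2) auto
      show "continuous_on {z. 0 \<le> Im z} w"
        unfolding w_def using v_pos c by (intro continuous_intros Gc P P2) (auto simp: less_imp_neq[symmetric])
      show "w z = cmod (G z / (of_real c * (P z * P2 z)))" if "Im z > 0" for z
        using P(3)[OF that] P2(3)[OF that] c by (simp add: w_def norm_divide norm_mult)
      show "w z \<le> 1" if "Im z = 0" for z
      \<comment> \<open>Within \<open>[-R, R]\<close> both outer moduli reach their targets and
        \<open>inv\<close> applies; beyond it the floors alone suffice.\<close>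
      proof (cases "\<bar>Re z\<bar> \<le> R")
        case True
        define t where "t = Re z"
        have zt: "z = complex_of_real t" using that by (simp add: complex_eq_iff t_def)
        have "cmod (G z) \<le> c * (growth_inv \<Phi>1 (c * \<Phi>3 (H t)) * growth_inv \<Phi>2 (c * \<Phi>3 (H t)))"
          using inv[OF H0[of t]] by (simp add: H_def zt)
        also have "\<dots> \<le> c * (v1 z * v2 z)"
          using c v1(2)[of t] v2(2)[of t] target(2)[OF adm1, of t] target(2)[OF adm2, of t] True v_pos[of z] that
          by (intro mult_left_mono mult_mono) (auto simp: zt)
        finally show ?thesis using c v_pos[of z] that by (simp add: w_def)
      next
        case False
        then show ?thesis using far[of z] that abs_Re_le_cmod[of z] by simp
      qed
    qed (use far z in auto)
    \<comment> \<open>\<open>P\<close> has no zeros, so \<open>Q\<close> takes all those of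
      \<open>G\<close>; \<open>w z \<le> 1\<close> says exactly that
      \<open>cmod (Q z) \<le> c * v2 z\<close>.\<close>
    define Q where "Q z = G z / P z" for z
    have Q_le: "cmod (Q z) / (2 * c) \<le> v2 z / 2" if "Im z > 0" for z
      using w_le[OF that] P(3)[OF that] v_pos[of z] that c by (simp add: w_def Q_def norm_divide field_simps)
    have Qh: "Q holomorphic_on upper_half_plane"
      unfolding Q_def using P_ne by (intro holomorphic_intros Gh P) auto
    have "P z * Q z = f (z + \<i> * of_real \<epsilon>) / growth_factor \<epsilon> z ^ N" if "Im z > 0" for z
      using P_ne(1)[of z] that by (simp add: Q_def G_def upper_half_plane_def)
    moreover have "\<Phi>1 (cmod (P z) / 2) \<le> K / Im z" if "Im z > 0" for z
      using v1(3)[OF that] P(3)[OF that] divide_right_mono[OF KK(1), of "Im z"] that by simp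
    moreover have Q2: "\<Phi>2 (cmod (Q z) / (2 * c)) \<le> \<Phi>2 (v2 z / 2)" if "Im z > 0" for z
      using c by (intro admissible_mono[OF adm2] Q_le that) auto
    then have "\<Phi>2 (cmod (Q z) / (2 * c)) \<le> K / Im z" if "Im z > 0" for z
      using v2(3)[OF that] divide_right_mono[OF KK(2), of "Im z"] Q2[OF that] that by linarith
    moreover have "(\<integral>\<^sup>+x. ennreal (\<Phi>1 (cmod (P (Complex x y)) / 2)) \<partial>lborel) \<le> ennreal K" if "y > 0" for y
      using v1(4)[OF that] P(3)[of "Complex _ y"] that ennreal_leI[OF KK(1)] by simp
    moreover have "(\<integral>\<^sup>+x. ennreal (\<Phi>2 (cmod (Q (Complex x y)) / (2 * c))) \<partial>lborel) \<le> ennreal K" if "y > 0" for y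
    proof -
      have "(\<integral>\<^sup>+x. ennreal (\<Phi>2 (cmod (Q (Complex x y)) / (2 * c))) \<partial>lborel)
          \<le> (\<integral>\<^sup>+x. ennreal (\<Phi>2 (v2 (Complex x y) / 2)) \<partial>lborel)"
        using that by (intro nn_integral_mono ennreal_leI Q2) simp
      then show ?thesis using v2(4)[OF that] ennreal_leI[OF KK(2)] by simp
    qed
    ultimately show "\<exists>P Q. P holomorphic_on upper_half_plane \<and> Q holomorphic_on upper_half_plane \<and>
        (\<forall>z. Im z > 0 \<longrightarrow> P z * Q z = f (z + \<i> * of_real \<epsilon>) / growth_factor \<epsilon> z ^ N) \<and>
        (\<forall>z. Im z > 0 \<longrightarrow> \<Phi>1 (cmod (P z) / 2) \<le> K / Im z) \<and>
        (\<forall>z. Im z > 0 \<longrightarrow> \<Phi>2 (cmod (Q z) / (2 * c)) \<le> K / Im z) \<and>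
        (\<forall>y>0. (\<integral>\<^sup>+x. ennreal (\<Phi>1 (cmod (P (Complex x y)) / 2)) \<partial>lborel) \<le> ennreal K) \<and>
        (\<forall>y>0. (\<integral>\<^sup>+x. ennreal (\<Phi>2 (cmod (Q (Complex x y)) / (2 * c))) \<partial>lborel) \<le> ennreal K)"
      using P(1) Qh by (intro exI[of _ P] exI[of _ Q]) simp
  qed
qed

section \<open>Passage to the limit\<close>

lemma half_plane_normal_family:
  assumes adm: "admissible \<Phi>" and a: "a > 0" and K: "K \<ge> 0"
    and hol: "\<And>n::nat. P n holomorphic_on upper_half_plane"
    and bd: "\<And>n z. Im z > 0 \<Longrightarrow> \<Phi> (cmod (P n z) / a) \<le> K / Im z"
  shows "\<exists>g r. g holomorphic_on upper_half_plane \<and> strict_mono (r :: nat \<Rightarrow> nat) \<and>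
    (\<forall>z. Im z > 0 \<longrightarrow> (\<lambda>n. P (r n) z) \<longlonglongrightarrow> g z)"
proof (rule Montel[OF open_upper_half_plane, of "range P" P])
  show "\<exists>B. \<forall>h\<in>range P. \<forall>z\<in>S. cmod (h z) \<le> B" if S: "compact S" "S \<subseteq> upper_half_plane" for S
  proof (cases "S = {}")
    case False
    \<comment> \<open>\<open>Im\<close> has a positive minimum on \<open>S\<close>, which bounds
      \<open>K / Im z\<close>; since \<open>\<Phi>\<close> tends to infinity, this bounds the
      functions themselves.\<close>
    have "continuous_on S Im" by (intro continuous_intros)
    then obtain z0 where z0: "z0 \<in> S" "\<And>z. z \<in> S \<Longrightarrow> Im z0 \<le> Im z"
      using continuous_attains_inf[OF S(1) False, of Im] by auto
    have im: "Im z0 > 0" using z0 S by (auto simp: upper_half_plane_def)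
    obtain B where B: "B > 0" "\<And>s. 0 \<le> s \<Longrightarrow> \<Phi> s \<le> K / Im z0 \<Longrightarrow> s \<le> B"
      using admissible_unbounded[OF adm, of "K / Im z0"] by metis
    have "cmod (P n z) \<le> a * B" if "z \<in> S" for n z
    proof -
      have "\<Phi> (cmod (P n z) / a) \<le> K / Im z" using that S by (intro bd) (auto simp: upper_half_plane_def)
      also have "\<dots> \<le> K / Im z0" using K z0(2)[OF that] im by (intro divide_left_mono) auto
      finally have "cmod (P n z) / a \<le> B" using a by (intro B) auto
      then show ?thesis using a by (simp add: field_simps)
    qed
    then show ?thesis by blast
  qed auto
  show "h holomorphic_on upper_half_plane" if "h \<in> range P" for h using that hol by auto
  fix g and r :: "nat \<Rightarrow> nat"
  assume "g holomorphic_on upper_half_plane" "strict_mono r"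
    "\<And>z. z \<in> upper_half_plane \<Longrightarrow> (\<lambda>n. P (r n) z) \<longlonglongrightarrow> g z"
  then show ?thesis by (auto simp: upper_half_plane_def)
qed auto

lemma continuous_on_horizontal_line:
  assumes "f holomorphic_on upper_half_plane" "y > 0"
  shows "continuous_on UNIV (\<lambda>x. f (Complex x y))"
proof -
  have "continuous_on UNIV (\<lambda>x. Complex x y)" unfolding Complex_eq by (intro continuous_intros)
  then show ?thesis
    using assms(2)
    by (intro continuous_on_compose2[OF holomorphic_on_imp_continuous_on[OF assms(1)]])
      (auto simp: upper_half_plane_def)
qed

lemma measurable_horizontal_line:
  assumes adm: "admissible \<Phi>" and f: "f holomorphic_on upper_half_plane" "y > 0" and a: "a > 0"
  shows "(\<lambda>x. \<Phi> (cmod (f (Complex x y)) / a)) \<in> borel_measurable borel"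
  using a by (intro borel_measurable_continuous_onI admissible_continuous_compose[OF adm]
      continuous_intros continuous_on_horizontal_line[OF f]) auto

lemma horizontal_line_fatou:
  assumes adm: "admissible \<Phi>" and a: "a > 0" and y: "y > 0"
    and hol: "\<And>n::nat. P n holomorphic_on upper_half_plane"
    and lim: "\<And>z. Im z > 0 \<Longrightarrow> (\<lambda>n. P n z) \<longlonglongrightarrow> g z"
    and bd: "\<And>n. (\<integral>\<^sup>+x. ennreal (\<Phi> (cmod (P n (Complex x y)) / a)) \<partial>lborel) \<le> K"
  shows "(\<integral>\<^sup>+x. ennreal (\<Phi> (cmod (g (Complex x y)) / a)) \<partial>lborel) \<le> K"
proof (rule nn_integral_le_of_tendsto[OF _ _ bd])
  show "(\<lambda>x. ennreal (\<Phi> (cmod (P n (Complex x y)) / a))) \<in> borel_measurable lborel" for n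
    using measurable_horizontal_line[OF adm hol y a, of n] by simp
  fix x
  have \<Phi>c: "continuous_on {0..} \<Phi>" using adm by (simp add: admissible_def)
  have "(\<lambda>n. cmod (P n (Complex x y)) / a) \<longlonglongrightarrow> cmod (g (Complex x y)) / a"
    using y a by (intro tendsto_intros lim) auto
  then show "(\<lambda>n. ennreal (\<Phi> (cmod (P n (Complex x y)) / a))) \<longlonglongrightarrow> ennreal (\<Phi> (cmod (g (Complex x y)) / a))"
    using a by (intro tendsto_ennrealI continuous_on_tendsto_compose[OF \<Phi>c]) auto
qed

lemma normalized_factorization:
  assumes adm1: "admissible \<Phi>1" and adm2: "admissible \<Phi>2" and adm3: "admissible \<Phi>3"
    and c: "c > 0" and inv: "\<And>u. 0 \<le> u \<Longrightarrow> u \<le> c * (growth_inv \<Phi>1 (c * \<Phi>3 u) * growth_inv \<Phi>2 (c * \<Phi>3 u))"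
  obtains K where "K > 0"
    "\<And>f. f holomorphic_on upper_half_plane \<Longrightarrow>
      (\<And>y. y > 0 \<Longrightarrow> (\<integral>\<^sup>+x. ennreal (\<Phi>3 (cmod (f (Complex x y)))) \<partial>lborel) \<le> 1) \<Longrightarrow>
      \<exists>f1 f2. f1 holomorphic_on upper_half_plane \<and> f2 holomorphic_on upper_half_plane \<and>
        (\<forall>z. Im z > 0 \<longrightarrow> f z = f1 z * f2 z) \<and>
        (\<forall>y>0. (\<integral>\<^sup>+x. ennreal (\<Phi>1 (cmod (f1 (Complex x y)) / 2)) \<partial>lborel) \<le> ennreal K) \<and>
        (\<forall>y>0. (\<integral>\<^sup>+x. ennreal (\<Phi>2 (cmod (f2 (Complex x y)) / (2 * c))) \<partial>lborel) \<le> ennreal K)"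
proof (rule approximate_factorization[OF adm1 adm2 adm3 c inv])
  fix K :: real and N :: nat
  assume K: "K > 0" and approx: "\<And>f \<epsilon>. f holomorphic_on upper_half_plane \<Longrightarrow>
      (\<And>y. y > 0 \<Longrightarrow> (\<integral>\<^sup>+x. ennreal (\<Phi>3 (cmod (f (Complex x y)))) \<partial>lborel) \<le> 1) \<Longrightarrow> \<epsilon> > 0 \<Longrightarrow>
      \<exists>P Q. P holomorphic_on upper_half_plane \<and> Q holomorphic_on upper_half_plane \<and>
        (\<forall>z. Im z > 0 \<longrightarrow> P z * Q z = f (z + \<i> * of_real \<epsilon>) / growth_factor \<epsilon> z ^ N) \<and>
        (\<forall>z. Im z > 0 \<longrightarrow> \<Phi>1 (cmod (P z) / 2) \<le> K / Im z) \<and>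
        (\<forall>z. Im z > 0 \<longrightarrow> \<Phi>2 (cmod (Q z) / (2 * c)) \<le> K / Im z) \<and>
        (\<forall>y>0. (\<integral>\<^sup>+x. ennreal (\<Phi>1 (cmod (P (Complex x y)) / 2)) \<partial>lborel) \<le> ennreal K) \<and>
        (\<forall>y>0. (\<integral>\<^sup>+x. ennreal (\<Phi>2 (cmod (Q (Complex x y)) / (2 * c))) \<partial>lborel) \<le> ennreal K)"
  show thesis
  proof (rule that[OF K])
    fix f
    assume f: "f holomorphic_on upper_half_plane"
      and lines: "\<And>y. y > 0 \<Longrightarrow> (\<integral>\<^sup>+x. ennreal (\<Phi>3 (cmod (f (Complex x y)))) \<partial>lborel) \<le> 1"
    define \<epsilon> where "\<epsilon> n = inverse (real (Suc n))" for n
    have \<epsilon>: "\<epsilon> n > 0" for n by (simp add: \<epsilon>_def)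
    have \<epsilon>_lim: "\<epsilon> \<longlonglongrightarrow> 0" unfolding \<epsilon>_def by (rule LIMSEQ_inverse_real_of_nat)
    define A where "A n P Q \<longleftrightarrow> P holomorphic_on upper_half_plane \<and> Q holomorphic_on upper_half_plane \<and>
        (\<forall>z. Im z > 0 \<longrightarrow> P z * Q z = f (z + \<i> * of_real (\<epsilon> n)) / growth_factor (\<epsilon> n) z ^ N) \<and>
        (\<forall>z. Im z > 0 \<longrightarrow> \<Phi>1 (cmod (P z) / 2) \<le> K / Im z) \<and>
        (\<forall>z. Im z > 0 \<longrightarrow> \<Phi>2 (cmod (Q z) / (2 * c)) \<le> K / Im z) \<and>
        (\<forall>y>0. (\<integral>\<^sup>+x. ennreal (\<Phi>1 (cmod (P (Complex x y)) / 2)) \<partial>lborel) \<le> ennreal K) \<and>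
        (\<forall>y>0. (\<integral>\<^sup>+x. ennreal (\<Phi>2 (cmod (Q (Complex x y)) / (2 * c))) \<partial>lborel) \<le> ennreal K)"
      for n P Q
    have "\<exists>P Q. A n P Q" for n using approx[OF f lines \<epsilon>, of n] by (simp add: A_def)
    then obtain P Q where "\<And>n. A n (P n) (Q n)" by metis
    then have P: "\<And>n. P n holomorphic_on upper_half_plane"
      and Q: "\<And>n. Q n holomorphic_on upper_half_plane"
      and PQ: "\<And>n z. Im z > 0 \<Longrightarrow> P n z * Q n z = f (z + \<i> * of_real (\<epsilon> n)) / growth_factor (\<epsilon> n) z ^ N"
      and bP: "\<And>n z. Im z > 0 \<Longrightarrow> \<Phi>1 (cmod (P n z) / 2) \<le> K / Im z"
      and bQ: "\<And>n z. Im z > 0 \<Longrightarrow> \<Phi>2 (cmod (Q n z) / (2 * c)) \<le> K / Im z"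
      and iP: "\<And>n y. y > 0 \<Longrightarrow> (\<integral>\<^sup>+x. ennreal (\<Phi>1 (cmod (P n (Complex x y)) / 2)) \<partial>lborel) \<le> ennreal K"
      and iQ: "\<And>n y. y > 0 \<Longrightarrow> (\<integral>\<^sup>+x. ennreal (\<Phi>2 (cmod (Q n (Complex x y)) / (2 * c))) \<partial>lborel) \<le> ennreal K"
      by (simp_all add: A_def)
    obtain f1 r where f1: "f1 holomorphic_on upper_half_plane" and r: "strict_mono (r :: nat \<Rightarrow> nat)"
      and lim1: "\<And>z. Im z > 0 \<Longrightarrow> (\<lambda>n. P (r n) z) \<longlonglongrightarrow> f1 z"
    proof -
      have "\<exists>g r. g holomorphic_on upper_half_plane \<and> strict_mono (r :: nat \<Rightarrow> nat) \<and>
          (\<forall>z. Im z > 0 \<longrightarrow> (\<lambda>n. P (r n) z) \<longlonglongrightarrow> g z)"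
        by (rule half_plane_normal_family[OF adm1 _ less_imp_le[OF K] P bP]) auto
      then show thesis using that by blast
    qed
    have c2: "2 * c > 0" using c by simp
    \<comment> \<open>Extracted inside the first subsequence, so that both factors converge along
      the same indices.\<close>
    obtain f2 r' where f2: "f2 holomorphic_on upper_half_plane" and r': "strict_mono (r' :: nat \<Rightarrow> nat)"
      and lim2: "\<And>z. Im z > 0 \<Longrightarrow> (\<lambda>n. Q (r (r' n)) z) \<longlonglongrightarrow> f2 z"
    proof -
      have "\<exists>g r'. g holomorphic_on upper_half_plane \<and> strict_mono (r' :: nat \<Rightarrow> nat) \<and>
          (\<forall>z. Im z > 0 \<longrightarrow> (\<lambda>n. Q (r (r' n)) z) \<longlonglongrightarrow> g z)"
        by (rule half_plane_normal_family[OF adm2 c2 less_imp_le[OF K] Q bQ])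
      then show thesis using that by blast
    qed
    define q where "q = r \<circ> r'"
    have q: "strict_mono q" unfolding q_def by (rule strict_mono_o[OF r r'])
    have limP: "(\<lambda>n. P (q n) z) \<longlonglongrightarrow> f1 z" and limQ: "(\<lambda>n. Q (q n) z) \<longlonglongrightarrow> f2 z" if "Im z > 0" for z
      using LIMSEQ_subseq_LIMSEQ[OF lim1[OF that] r'] lim2[OF that] by (simp_all add: q_def comp_def)
    have "f z = f1 z * f2 z" if z: "Im z > 0" for z
    proof (rule LIMSEQ_unique)
      have "(\<lambda>n. \<epsilon> (q n)) \<longlonglongrightarrow> 0"
        using LIMSEQ_subseq_LIMSEQ[OF \<epsilon>_lim q] by (simp add: comp_def)
      then have e: "(\<lambda>n. complex_of_real (\<epsilon> (q n))) \<longlonglongrightarrow> complex_of_real 0" by (rule tendsto_of_real)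
      have "isCont f z"
        using holomorphic_on_imp_continuous_on[OF f] open_upper_half_plane z
        by (auto simp: continuous_on_eq_continuous_at upper_half_plane_def)
      moreover have "(\<lambda>n. z + \<i> * of_real (\<epsilon> (q n))) \<longlonglongrightarrow> z + \<i> * of_real 0"
        by (intro tendsto_intros e)
      ultimately have "(\<lambda>n. f (z + \<i> * of_real (\<epsilon> (q n)))) \<longlonglongrightarrow> f z"
        by (auto intro: isCont_tendsto_compose)
      \<comment> \<open>The damping factor tends to 1 at each point, so its \<open>N\<close>-th
        power leaves no trace in the limit.\<close>
      then have "(\<lambda>n. f (z + \<i> * of_real (\<epsilon> (q n))) / growth_factor (\<epsilon> (q n)) z ^ N)
          \<longlonglongrightarrow> f z / (1 - \<i> * complex_of_real 0 * z) ^ N"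
        unfolding growth_factor_def by (intro tendsto_intros e) auto
      then show "(\<lambda>n. P (q n) z * Q (q n) z) \<longlonglongrightarrow> f z" by (simp add: PQ[OF z])
      show "(\<lambda>n. P (q n) z * Q (q n) z) \<longlonglongrightarrow> f1 z * f2 z" by (intro tendsto_intros limP limQ z)
    qed
    moreover have "(\<integral>\<^sup>+x. ennreal (\<Phi>1 (cmod (f1 (Complex x y)) / 2)) \<partial>lborel) \<le> ennreal K" if "y > 0" for y
      by (rule horizontal_line_fatou[OF adm1 _ that P limP iP[OF that]]) auto
    moreover have "(\<integral>\<^sup>+x. ennreal (\<Phi>2 (cmod (f2 (Complex x y)) / (2 * c))) \<partial>lborel) \<le> ennreal K" if "y > 0" for y
      by (rule horizontal_line_fatou[OF adm2 c2 that Q limQ iQ[OF that]])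
    ultimately show "\<exists>f1 f2. f1 holomorphic_on upper_half_plane \<and> f2 holomorphic_on upper_half_plane \<and>
        (\<forall>z. Im z > 0 \<longrightarrow> f z = f1 z * f2 z) \<and>
        (\<forall>y>0. (\<integral>\<^sup>+x. ennreal (\<Phi>1 (cmod (f1 (Complex x y)) / 2)) \<partial>lborel) \<le> ennreal K) \<and>
        (\<forall>y>0. (\<integral>\<^sup>+x. ennreal (\<Phi>2 (cmod (f2 (Complex x y)) / (2 * c))) \<partial>lborel) \<le> ennreal K)"
      using f1 f2 by blast
  qed
qed

section \<open>Hardy--Orlicz norms\<close>

lemma hardy_norm_le:
  assumes "r > 0" "\<And>y. y > 0 \<Longrightarrow> (\<integral>\<^sup>+x. ennreal (\<Phi> (cmod (F (Complex x y)) / r)) \<partial>lborel) \<le> 1"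
  shows "hardy_norm \<Phi> F \<le> ennreal r"
  unfolding hardy_norm_def lux_norm_def
  by (intro SUP_least Inf_lower) (use assms in auto)

text \<open>A norm strictly below \<open>r\<close> provides some smaller \<open>r'\<close> in the
  set whose infimum is taken, and monotonicity of \<open>\<Phi>\<close> passes from
  \<open>r'\<close> to \<open>r\<close>. Strictness avoids the question whether the infimum is
  attained.\<close>

lemma hardy_norm_lessD:
  assumes adm: "admissible \<Phi>" and less: "hardy_norm \<Phi> F < ennreal r" and y: "y > 0"
  shows "(\<integral>\<^sup>+x. ennreal (\<Phi> (cmod (F (Complex x y)) / r)) \<partial>lborel) \<le> 1"
proof -
  have "lux_norm \<Phi> (\<lambda>x. F (Complex x y)) \<le> hardy_norm \<Phi> F"
    unfolding hardy_norm_def using y by (intro SUP_upper) auto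
  then have "lux_norm \<Phi> (\<lambda>x. F (Complex x y)) < ennreal r" using less by (rule le_less_trans)
  then obtain r' where r': "r' > 0" "ennreal r' < ennreal r"
    and int: "(\<integral>\<^sup>+x. ennreal (\<Phi> (cmod (F (Complex x y)) / r')) \<partial>lborel) \<le> 1"
    unfolding lux_norm_def Inf_less_iff by blast
  have "r' < r" using r' by (simp add: ennreal_less_iff)
  then have "(\<integral>\<^sup>+x. ennreal (\<Phi> (cmod (F (Complex x y)) / r)) \<partial>lborel)
      \<le> (\<integral>\<^sup>+x. ennreal (\<Phi> (cmod (F (Complex x y)) / r')) \<partial>lborel)"
    using r'(1) by (intro nn_integral_mono ennreal_leI admissible_mono[OF adm] divide_left_mono) auto
  then show ?thesis using int by (rule order_trans)
qed

text \<open>Functions are total but factorizations hold on the half-plane only; this transfers norms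
  between the two sides.\<close>

lemma hardy_norm_cong:
  "(\<And>z. z \<in> upper_half_plane \<Longrightarrow> F z = G z) \<Longrightarrow> hardy_norm \<Phi> F = hardy_norm \<Phi> G"
  unfolding hardy_norm_def by (intro SUP_cong refl) (auto simp: upper_half_plane_def)

lemma hardy_norm_zero:
  assumes "admissible \<Phi>" "\<And>z. z \<in> upper_half_plane \<Longrightarrow> F z = 0"
  shows "hardy_norm \<Phi> F = 0"
proof -
  have le: "hardy_norm \<Phi> F \<le> 0 + ennreal r" if "r > 0" for r
  proof -
    have "F (Complex x y) = 0" if "y > 0" for x y
      using assms(2) that by (simp add: upper_half_plane_def)
    then show ?thesis
      unfolding add_0 using admissible_zero[OF assms(1)] by (intro hardy_norm_le that) simp
  qed
  have "hardy_norm \<Phi> F \<le> 0" by (rule ennreal_le_epsilon) (rule le)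
  then show ?thesis by simp
qed

text \<open>The pointwise bound \<open>M\<close> is uniform over functions whose line integrals are
  at most 1, and norm 0 admits \<open>F / r\<close> for every \<open>r > 0\<close>. Hence
  \<open>cmod (F z) \<le> M * r\<close> for all such \<open>r\<close>. This covers the one
  \<open>F\<close> that cannot be normalised.\<close>

lemma hardy_norm_eq_zeroD:
  assumes adm: "admissible \<Phi>" and F: "F holomorphic_on upper_half_plane" "hardy_norm \<Phi> F = 0"
    and z: "z \<in> upper_half_plane"
  shows "F z = 0"
proof -
  have im: "Im z > 0" using z by (simp add: upper_half_plane_def)
  then have im2: "Im z / 2 > 0" by simp
  show ?thesis
  proof (rule hardy_pointwise_bound[OF adm im2])
    fix M :: real
    assume M: "M > 0" and bd: "\<And>f w. f holomorphic_on upper_half_plane \<Longrightarrow>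
      (\<And>y. y > 0 \<Longrightarrow> (\<integral>\<^sup>+x. ennreal (\<Phi> (cmod (f (Complex x y)))) \<partial>lborel) \<le> 1) \<Longrightarrow> Im z / 2 < Im w \<Longrightarrow> cmod (f w) \<le> M"
    have "cmod (F z) \<le> 0 + e" if e: "e > 0" for e
    proof -
      define r where "r = e / M"
      have r: "r > 0" using e M by (simp add: r_def)
      then have less: "hardy_norm \<Phi> F < ennreal r" using F(2) by simp
      have "cmod (F z) / r \<le> M"
        using r im hardy_norm_lessD[OF adm less]
          bd[of "\<lambda>w. F w / of_real r" z] holomorphic_on_divide[OF F(1) holomorphic_on_const, of "of_real r"]
        by (simp add: norm_divide)
      then have "cmod (F z) \<le> M * r" using r by (simp add: field_simps)
      then show ?thesis using M by (simp add: r_def)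
    qed
    then have "cmod (F z) \<le> 0" by (rule field_le_epsilon)
    then show ?thesis by simp
  qed
qed

section \<open>Hoelder's inequality for products\<close>

lemma hardy_norm_mult_le_of_less:
  assumes adm1: "admissible \<Phi>1" and adm2: "admissible \<Phi>2" and adm3: "admissible \<Phi>3"
    and c: "c > 0" and inv: "\<And>t. t > 0 \<Longrightarrow> growth_inv \<Phi>1 t * growth_inv \<Phi>2 t \<le> c * growth_inv \<Phi>3 (c * t)"
  shows "\<exists>C>0. \<forall>F1 F2 r1 r2. F1 holomorphic_on upper_half_plane \<longrightarrow> F2 holomorphic_on upper_half_plane \<longrightarrow>
    0 < r1 \<longrightarrow> 0 < r2 \<longrightarrow> hardy_norm \<Phi>1 F1 < ennreal r1 \<longrightarrow> hardy_norm \<Phi>2 F2 < ennreal r2 \<longrightarrow>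
    hardy_norm \<Phi>3 (\<lambda>z. F1 z * F2 z) \<le> ennreal (C * r1 * r2)"
proof -
  \<comment> \<open>\<open>k\<close> absorbs two factors: \<open>c\<close> from Young's inequality,
    and 2, which turns the sum of two integrals, each at most 1, into their average.\<close>
  have "2 * c > 0" using c by simp
  then obtain k where k: "k > 0" "\<And>s. 0 \<le> s \<Longrightarrow> 2 * c * \<Phi>3 (s / k) \<le> \<Phi>3 s"
    using admissible_cmult_le[OF adm3] by metis
  have young: "2 * \<Phi>3 (u * v / (c * k)) \<le> \<Phi>1 u + \<Phi>2 v" if uv: "0 \<le> u" "0 \<le> v" for u v
  proof -
    define s where "s = max (\<Phi>1 u) (\<Phi>2 v)"
    have nn: "0 \<le> \<Phi>1 u" "0 \<le> \<Phi>2 v" using admissible_nonneg adm1 adm2 uv by auto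
    have s_le: "s \<le> \<Phi>1 u + \<Phi>2 v" using nn by (simp add: s_def)
    have "\<Phi>3 (u * v / c) \<le> c * s"
    \<comment> \<open>\<open>inv\<close> speaks of positive arguments only; for \<open>s = 0\<close>
      the factor \<open>u\<close> vanishes.\<close>
    proof (cases "s = 0")
      case True
      then have "\<Phi>1 u = 0" using nn by (auto simp: s_def max_def split: if_splits)
      then have "u = 0" using admissible_pos[OF adm1, of u] uv by force
      then show ?thesis using True admissible_zero[OF adm3] by simp
    next
      case False
      then have s: "s > 0" using nn by (auto simp: s_def less_max_iff_disj)
      have "u = growth_inv \<Phi>1 (\<Phi>1 u)" "v = growth_inv \<Phi>2 (\<Phi>2 v)"
        using uv growth_inv_left adm1 adm2 by auto
      then have "u \<le> growth_inv \<Phi>1 s" "v \<le> growth_inv \<Phi>2 s"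
        using growth_inv_mono[OF adm1 nn(1), of s] growth_inv_mono[OF adm2 nn(2), of s] by (auto simp: s_def)
      then have "u * v \<le> growth_inv \<Phi>1 s * growth_inv \<Phi>2 s"
        using uv s growth_inv_nonneg[OF adm1, of s] by (intro mult_mono) auto
      also have "\<dots> \<le> c * growth_inv \<Phi>3 (c * s)" by (rule inv[OF s])
      finally have "u * v / c \<le> growth_inv \<Phi>3 (c * s)" using c by (simp add: field_simps)
      then have "\<Phi>3 (u * v / c) \<le> \<Phi>3 (growth_inv \<Phi>3 (c * s))"
        using uv c by (intro admissible_mono[OF adm3]) auto
      then show ?thesis using growth_inv_right[OF adm3, of "c * s"] c s by simp
    qed
    moreover have "2 * c * \<Phi>3 (u * v / c / k) \<le> \<Phi>3 (u * v / c)"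
      using uv c by (intro k(2)) auto
    ultimately have "c * (2 * \<Phi>3 (u * v / (c * k))) \<le> c * s" by (simp add: mult_ac)
    then show ?thesis using c s_le by simp
  qed
  show ?thesis
  proof (intro exI[of _ "c * k"] conjI allI impI)
    show "c * k > 0" using c k by simp
    fix F1 F2 and r1 r2 :: real
    assume F: "F1 holomorphic_on upper_half_plane" "F2 holomorphic_on upper_half_plane"
      and r: "0 < r1" "0 < r2" and less: "hardy_norm \<Phi>1 F1 < ennreal r1" "hardy_norm \<Phi>2 F2 < ennreal r2"
    show "hardy_norm \<Phi>3 (\<lambda>z. F1 z * F2 z) \<le> ennreal (c * k * r1 * r2)"
    proof (rule hardy_norm_le)
      fix y :: real assume y: "y > 0"
      let ?u = "\<lambda>x. cmod (F1 (Complex x y)) / r1" and ?v = "\<lambda>x. cmod (F2 (Complex x y)) / r2"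
      have [measurable]: "(\<lambda>x. \<Phi>1 (?u x)) \<in> borel_measurable borel" "(\<lambda>x. \<Phi>2 (?v x)) \<in> borel_measurable borel"
        using measurable_horizontal_line adm1 adm2 F y r by auto
      have nn: "0 \<le> \<Phi>1 (?u x)" "0 \<le> \<Phi>2 (?v x)" for x
        using admissible_nonneg adm1 adm2 r by auto
      have pt: "\<Phi>3 (cmod (F1 (Complex x y) * F2 (Complex x y)) / (c * k * r1 * r2)) \<le> 1 / 2 * (\<Phi>1 (?u x) + \<Phi>2 (?v x))" for x
        using young[of "?u x" "?v x"] r by (simp add: norm_mult mult_ac)
      have "(\<integral>\<^sup>+x. ennreal (\<Phi>3 (cmod (F1 (Complex x y) * F2 (Complex x y)) / (c * k * r1 * r2))) \<partial>lborel)
          \<le> (\<integral>\<^sup>+x. ennreal (1 / 2) * (ennreal (\<Phi>1 (?u x)) + ennreal (\<Phi>2 (?v x))) \<partial>lborel)"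
      proof (rule nn_integral_mono)
        fix x
        have "ennreal (\<Phi>3 (cmod (F1 (Complex x y) * F2 (Complex x y)) / (c * k * r1 * r2)))
            \<le> ennreal (1 / 2 * (\<Phi>1 (?u x) + \<Phi>2 (?v x)))" by (rule ennreal_leI[OF pt])
        also have "\<dots> = ennreal (1 / 2) * (ennreal (\<Phi>1 (?u x)) + ennreal (\<Phi>2 (?v x)))"
          using nn[of x] by (subst ennreal_mult') (simp_all add: ennreal_plus)
        finally show "ennreal (\<Phi>3 (cmod (F1 (Complex x y) * F2 (Complex x y)) / (c * k * r1 * r2)))
            \<le> ennreal (1 / 2) * (ennreal (\<Phi>1 (?u x)) + ennreal (\<Phi>2 (?v x)))" .
      qed
      also have "\<dots> = ennreal (1 / 2) * ((\<integral>\<^sup>+x. ennreal (\<Phi>1 (?u x)) \<partial>lborel) + (\<integral>\<^sup>+x. ennreal (\<Phi>2 (?v x)) \<partial>lborel))"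
        by (subst nn_integral_cmult, measurable) (subst nn_integral_add, auto)
      also have "\<dots> \<le> ennreal (1 / 2) * (1 + 1)"
        by (intro mult_left_mono add_mono hardy_norm_lessD[OF adm1 less(1) y] hardy_norm_lessD[OF adm2 less(2) y]) simp
      also have "\<dots> = ennreal (1 / 2 * 2)" by (subst ennreal_mult') auto
      finally show "(\<integral>\<^sup>+x. ennreal (\<Phi>3 (cmod (F1 (Complex x y) * F2 (Complex x y)) / (c * k * r1 * r2))) \<partial>lborel) \<le> 1"
        by simp
    qed (use c k r in simp)
  qed
qed

text \<open>The strict version wants positive radii above the norms. Radii \<open>a1 + d\<close> and
  \<open>a2 + d\<close> with \<open>d\<close> tending to 0 reach the norms themselves, including
  norm 0.\<close>

lemma hardy_norm_mult_le:
  assumes adm1: "admissible \<Phi>1" and adm2: "admissible \<Phi>2" and adm3: "admissible \<Phi>3"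
    and c: "c > 0" and inv: "\<And>t. t > 0 \<Longrightarrow> growth_inv \<Phi>1 t * growth_inv \<Phi>2 t \<le> c * growth_inv \<Phi>3 (c * t)"
  shows "\<exists>C>0. \<forall>F1 \<in> hardy_orlicz \<Phi>1. \<forall>F2 \<in> hardy_orlicz \<Phi>2.
    hardy_norm \<Phi>3 (\<lambda>z. F1 z * F2 z) \<le> ennreal C * (hardy_norm \<Phi>1 F1 * hardy_norm \<Phi>2 F2)"
proof -
  obtain C where C: "C > 0" and le: "\<And>F1 F2 r1 r2. F1 holomorphic_on upper_half_plane \<Longrightarrow>
      F2 holomorphic_on upper_half_plane \<Longrightarrow> 0 < r1 \<Longrightarrow> 0 < r2 \<Longrightarrow> hardy_norm \<Phi>1 F1 < ennreal r1 \<Longrightarrow>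
      hardy_norm \<Phi>2 F2 < ennreal r2 \<Longrightarrow> hardy_norm \<Phi>3 (\<lambda>z. F1 z * F2 z) \<le> ennreal (C * r1 * r2)"
    using hardy_norm_mult_le_of_less[OF assms] by blast
  have "hardy_norm \<Phi>3 (\<lambda>z. F1 z * F2 z) \<le> ennreal C * (hardy_norm \<Phi>1 F1 * hardy_norm \<Phi>2 F2)"
    if F: "F1 \<in> hardy_orlicz \<Phi>1" "F2 \<in> hardy_orlicz \<Phi>2" for F1 F2
  proof -
    obtain a1 where a1: "hardy_norm \<Phi>1 F1 = ennreal a1" "a1 \<ge> 0"
      using F(1) by (cases "hardy_norm \<Phi>1 F1") (auto simp: hardy_orlicz_def)
    obtain a2 where a2: "hardy_norm \<Phi>2 F2 = ennreal a2" "a2 \<ge> 0"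
      using F(2) by (cases "hardy_norm \<Phi>2 F2") (auto simp: hardy_orlicz_def)
    have le': "hardy_norm \<Phi>3 (\<lambda>z. F1 z * F2 z) \<le> ennreal (C * (a1 + d) * (a2 + d))" if "d > 0" for d
      using F a1 a2 that by (intro le) (auto simp: hardy_orlicz_def ennreal_less_iff)
    have "((\<lambda>d. ennreal (C * (a1 + d) * (a2 + d))) \<longlongrightarrow> ennreal (C * (a1 + 0) * (a2 + 0))) (at_right 0)"
      by (intro tendsto_intros tendsto_ennrealI)
    moreover have "eventually (\<lambda>d. hardy_norm \<Phi>3 (\<lambda>z. F1 z * F2 z) \<le> ennreal (C * (a1 + d) * (a2 + d))) (at_right 0)"
      using le' by (auto simp: eventually_at_right_less eventually_at_filter)
    ultimately have "hardy_norm \<Phi>3 (\<lambda>z. F1 z * F2 z) \<le> ennreal (C * (a1 + 0) * (a2 + 0))"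
      by (rule tendsto_lowerbound) simp
    also have "\<dots> = ennreal C * (hardy_norm \<Phi>1 F1 * hardy_norm \<Phi>2 F2)"
      using C a1 a2 by (simp add: ennreal_mult' mult.assoc)
    finally show ?thesis .
  qed
  then show ?thesis using C by blast
qed

text \<open>Dividing by twice the norm, strictly more than the norm itself, makes all line integrals
  at most 1, so the normalised factorization applies. The scale is then put back into the first
  factor.\<close>

lemma hardy_factorization:
  assumes adm1: "admissible \<Phi>1" and adm2: "admissible \<Phi>2" and adm3: "admissible \<Phi>3"
    and c: "c > 0" and inv: "\<And>u. 0 \<le> u \<Longrightarrow> u \<le> c * (growth_inv \<Phi>1 (c * \<Phi>3 u) * growth_inv \<Phi>2 (c * \<Phi>3 u))"
  shows "\<exists>C>0. \<forall>F \<in> hardy_orlicz \<Phi>3. \<exists>F1 \<in> hardy_orlicz \<Phi>1. \<exists>F2 \<in> hardy_orlicz \<Phi>2.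
        (\<forall>z \<in> upper_half_plane. F z = F1 z * F2 z) \<and>
        hardy_norm \<Phi>1 F1 * hardy_norm \<Phi>2 F2 \<le> ennreal C * hardy_norm \<Phi>3 F"
proof (rule normalized_factorization[OF adm1 adm2 adm3 c inv])
  fix K :: real
  assume K: "K > 0" and fact: "\<And>f. f holomorphic_on upper_half_plane \<Longrightarrow>
      (\<And>y. y > 0 \<Longrightarrow> (\<integral>\<^sup>+x. ennreal (\<Phi>3 (cmod (f (Complex x y)))) \<partial>lborel) \<le> 1) \<Longrightarrow>
      \<exists>f1 f2. f1 holomorphic_on upper_half_plane \<and> f2 holomorphic_on upper_half_plane \<and>
        (\<forall>z. Im z > 0 \<longrightarrow> f z = f1 z * f2 z) \<and>
        (\<forall>y>0. (\<integral>\<^sup>+x. ennreal (\<Phi>1 (cmod (f1 (Complex x y)) / 2)) \<partial>lborel) \<le> ennreal K) \<and>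
        (\<forall>y>0. (\<integral>\<^sup>+x. ennreal (\<Phi>2 (cmod (f2 (Complex x y)) / (2 * c))) \<partial>lborel) \<le> ennreal K)"
  obtain k1 where k1: "k1 > 0" "\<And>s. 0 \<le> s \<Longrightarrow> K * \<Phi>1 (s / k1) \<le> \<Phi>1 s"
    using admissible_cmult_le[OF adm1 K] by metis
  obtain k2 where k2: "k2 > 0" "\<And>s. 0 \<le> s \<Longrightarrow> K * \<Phi>2 (s / k2) \<le> \<Phi>2 s"
    using admissible_cmult_le[OF adm2 K] by metis
  \<comment> \<open>The factor \<open>k\<close> lowers an integral bound from \<open>K\<close> to 1;
    the scalar \<open>b\<close> is the normalisation of \<open>F\<close> returned to a
    factor.\<close>
  have shrink: "hardy_norm \<Phi> (\<lambda>z. of_real b * g z) \<le> ennreal (b * (a * k))"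
    if adm: "admissible \<Phi>" and a: "a > 0" and b: "b > 0" and k: "k > 0" "\<And>s. 0 \<le> s \<Longrightarrow> K * \<Phi> (s / k) \<le> \<Phi> s"
      and g: "g holomorphic_on upper_half_plane"
        "\<And>y. y > 0 \<Longrightarrow> (\<integral>\<^sup>+x. ennreal (\<Phi> (cmod (g (Complex x y)) / a)) \<partial>lborel) \<le> ennreal K" for \<Phi> a b k g
  proof (rule hardy_norm_le)
    fix y :: real assume y: "y > 0"
    have [measurable]: "(\<lambda>x. \<Phi> (cmod (g (Complex x y)) / a)) \<in> borel_measurable borel"
      by (rule measurable_horizontal_line[OF adm g(1) y a])
    have "\<Phi> (cmod (of_real b * g (Complex x y)) / (b * (a * k))) \<le> 1 / K * \<Phi> (cmod (g (Complex x y)) / a)" for x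
      using k(2)[of "cmod (g (Complex x y)) / a"] a b K by (simp add: norm_mult field_simps)
    then have "(\<integral>\<^sup>+x. ennreal (\<Phi> (cmod (of_real b * g (Complex x y)) / (b * (a * k)))) \<partial>lborel)
        \<le> (\<integral>\<^sup>+x. ennreal (1 / K) * ennreal (\<Phi> (cmod (g (Complex x y)) / a)) \<partial>lborel)"
      using K by (intro nn_integral_mono) (simp only: ennreal_leI ennreal_mult'[symmetric] zero_le_divide_1_iff less_imp_le)
    also have "\<dots> = ennreal (1 / K) * (\<integral>\<^sup>+x. ennreal (\<Phi> (cmod (g (Complex x y)) / a)) \<partial>lborel)"
      by (rule nn_integral_cmult) measurable
    also have "\<dots> \<le> ennreal (1 / K) * ennreal K" by (intro mult_left_mono g y) simp
    also have "\<dots> = 1" using K by (simp flip: ennreal_mult')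
    finally show "(\<integral>\<^sup>+x. ennreal (\<Phi> (cmod (of_real b * g (Complex x y)) / (b * (a * k)))) \<partial>lborel) \<le> 1" .
  qed (use a b k in simp)
  \<comment> \<open>The product of 2 from \<open>b = 2 * a\<close>, \<open>2 * k1\<close> from the
    first factor and \<open>2 * c * k2\<close> from the second.\<close>
  define C where "C = 8 * c * k1 * k2"
  have C: "C > 0" using c k1 k2 by (simp add: C_def)
  have "\<exists>F1 \<in> hardy_orlicz \<Phi>1. \<exists>F2 \<in> hardy_orlicz \<Phi>2. (\<forall>z \<in> upper_half_plane. F z = F1 z * F2 z) \<and>
      hardy_norm \<Phi>1 F1 * hardy_norm \<Phi>2 F2 \<le> ennreal C * hardy_norm \<Phi>3 F" if F: "F \<in> hardy_orlicz \<Phi>3" for F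
  proof -
    have Fh: "F holomorphic_on upper_half_plane" using F by (simp add: hardy_orlicz_def)
    obtain a where a: "hardy_norm \<Phi>3 F = ennreal a" "a \<ge> 0"
      using F by (cases "hardy_norm \<Phi>3 F") (auto simp: hardy_orlicz_def)
    show ?thesis
    proof (cases "a = 0")
      case True
      then have "F z = 0" if "z \<in> upper_half_plane" for z
        using hardy_norm_eq_zeroD[OF adm3 Fh _ that] a by simp
      moreover have "hardy_norm \<Phi>1 (\<lambda>_. 0) = 0" "hardy_norm \<Phi>2 (\<lambda>_. 0) = 0"
        using hardy_norm_zero adm1 adm2 by auto
      ultimately show ?thesis
        by (intro bexI[of _ "\<lambda>_. 0"]) (auto simp: hardy_orlicz_def)
    next
      case False
      define b where "b = 2 * a"
      have b: "b > 0" using False a by (simp add: b_def)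
      have less: "hardy_norm \<Phi>3 F < ennreal b" using False a by (simp add: b_def ennreal_less_iff)
      have "\<exists>f1 f2. f1 holomorphic_on upper_half_plane \<and> f2 holomorphic_on upper_half_plane \<and>
        (\<forall>z. Im z > 0 \<longrightarrow> F z / of_real b = f1 z * f2 z) \<and>
        (\<forall>y>0. (\<integral>\<^sup>+x. ennreal (\<Phi>1 (cmod (f1 (Complex x y)) / 2)) \<partial>lborel) \<le> ennreal K) \<and>
        (\<forall>y>0. (\<integral>\<^sup>+x. ennreal (\<Phi>2 (cmod (f2 (Complex x y)) / (2 * c))) \<partial>lborel) \<le> ennreal K)"
        using hardy_norm_lessD[OF adm3 less] b
        by (intro fact holomorphic_intros Fh) (auto simp: norm_divide)
      then obtain f1 f2 where f: "f1 holomorphic_on upper_half_plane" "f2 holomorphic_on upper_half_plane"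
        and eq: "\<And>z. Im z > 0 \<Longrightarrow> F z / of_real b = f1 z * f2 z"
        and int: "\<And>y. y > 0 \<Longrightarrow> (\<integral>\<^sup>+x. ennreal (\<Phi>1 (cmod (f1 (Complex x y)) / 2)) \<partial>lborel) \<le> ennreal K"
          "\<And>y. y > 0 \<Longrightarrow> (\<integral>\<^sup>+x. ennreal (\<Phi>2 (cmod (f2 (Complex x y)) / (2 * c))) \<partial>lborel) \<le> ennreal K"
        by blast
      define F1 where "F1 z = of_real b * f1 z" for z
      define F2 where "F2 z = of_real 1 * f2 z" for z
      have n1: "hardy_norm \<Phi>1 F1 \<le> ennreal (b * (2 * k1))"
        unfolding F1_def using shrink[OF adm1 _ b k1 f(1) int(1)] by simp
      have n2: "hardy_norm \<Phi>2 F2 \<le> ennreal (1 * (2 * c * k2))"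
        unfolding F2_def using c by (intro shrink[OF adm2 _ _ k2 f(2) int(2)]) auto
      have "F1 \<in> hardy_orlicz \<Phi>1" "F2 \<in> hardy_orlicz \<Phi>2"
        unfolding hardy_orlicz_def using le_less_trans[OF n1, of \<infinity>] le_less_trans[OF n2, of \<infinity>]
        by (auto simp: F1_def[abs_def] F2_def[abs_def] intro!: holomorphic_intros f)
      moreover have "F z = F1 z * F2 z" if "z \<in> upper_half_plane" for z
        using eq[of z] that b by (simp add: F1_def F2_def upper_half_plane_def field_simps)
      moreover have "hardy_norm \<Phi>1 F1 * hardy_norm \<Phi>2 F2 \<le> ennreal C * hardy_norm \<Phi>3 F"
      proof -
        have "hardy_norm \<Phi>1 F1 * hardy_norm \<Phi>2 F2 \<le> ennreal (b * (2 * k1)) * ennreal (1 * (2 * c * k2))"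
          by (intro mult_mono n1 n2) auto
        also have "\<dots> = ennreal ((b * (2 * k1)) * (1 * (2 * c * k2)))"
          by (rule ennreal_mult'[symmetric]) (use b k1 in simp)
        also have "(b * (2 * k1)) * (1 * (2 * c * k2)) = C * a" by (simp add: b_def C_def)
        also have "ennreal (C * a) = ennreal C * hardy_norm \<Phi>3 F" using C a by (simp add: ennreal_mult')
        finally show ?thesis .
      qed
      ultimately show ?thesis by blast
    qed
  qed
  then show ?thesis using C by blast
qed

text \<open>The upper half of the equivalence gives Hoelder's inequality, valid for all pairs and
  hence for the factors found. The lower half gives the factorization with the reverse
  estimate.\<close>

theorem theorem1p1:
  fixes \<Phi>1 \<Phi>2 \<Phi>3 :: "real \<Rightarrow> real"
  assumes "\<Phi>1 \<in> class_L \<union> class_U" and "\<Phi>2 \<in> class_L \<union> class_U" and "\<Phi>3 \<in> class_L \<union> class_U"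
    and "growth_inv \<Phi>3 \<sim>\<^sub>g (\<lambda>t. growth_inv \<Phi>1 t * growth_inv \<Phi>2 t)"
  shows "(\<forall>F1 \<in> hardy_orlicz \<Phi>1. \<forall>F2 \<in> hardy_orlicz \<Phi>2. (\<lambda>z. F1 z * F2 z) \<in> hardy_orlicz \<Phi>3) \<and>
    (\<exists>C::real. C > 0 \<and>
      (\<forall>F \<in> hardy_orlicz \<Phi>3. \<exists>F1 \<in> hardy_orlicz \<Phi>1. \<exists>F2 \<in> hardy_orlicz \<Phi>2.
        (\<forall>z \<in> upper_half_plane. F z = F1 z * F2 z) \<and>
        ennreal (inverse C) * (hardy_norm \<Phi>1 F1 * hardy_norm \<Phi>2 F2) \<le> hardy_norm \<Phi>3 F \<and>
        hardy_norm \<Phi>3 F \<le> ennreal C * (hardy_norm \<Phi>1 F1 * hardy_norm \<Phi>2 F2)))"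
proof -
  note adm = class_L_U_admissible[OF assms(1)] class_L_U_admissible[OF assms(2)] class_L_U_admissible[OF assms(3)]
  obtain c where c: "c > 0"
    and lower: "\<And>t. t > 0 \<Longrightarrow> inverse c * growth_inv \<Phi>3 (inverse c * t) \<le> growth_inv \<Phi>1 t * growth_inv \<Phi>2 t"
    and upper: "\<And>t. t > 0 \<Longrightarrow> growth_inv \<Phi>1 t * growth_inv \<Phi>2 t \<le> c * growth_inv \<Phi>3 (c * t)"
    using assms(4) unfolding equiv_fun_def by blast
  \<comment> \<open>The lower half of the equivalence at \<open>t = c * \<Phi>3 u\<close>, where
    \<open>growth_inv \<Phi>3\<close> undoes \<open>\<Phi>3\<close>. It requires
    \<open>t > 0\<close>, so \<open>u = 0\<close> is checked by hand.\<close>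
  have inv: "u \<le> c * (growth_inv \<Phi>1 (c * \<Phi>3 u) * growth_inv \<Phi>2 (c * \<Phi>3 u))" if "0 \<le> u" for u
  proof (cases "u = 0")
    case True
    then show ?thesis
      using c admissible_zero[OF adm(3)] growth_inv_nonneg[OF adm(1), of 0] growth_inv_nonneg[OF adm(2), of 0]
      by simp
  next
    case False
    then have "c * \<Phi>3 u > 0" using c that admissible_pos[OF adm(3), of u] by simp
    from lower[OF this] have "inverse c * u \<le> growth_inv \<Phi>1 (c * \<Phi>3 u) * growth_inv \<Phi>2 (c * \<Phi>3 u)"
      using c that by (simp add: growth_inv_left[OF adm(3)] flip: mult.assoc)
    then show ?thesis using c by (simp add: field_simps)
  qed
  obtain C1 where C1: "C1 > 0" and hoelder: "\<And>F1 F2. F1 \<in> hardy_orlicz \<Phi>1 \<Longrightarrow> F2 \<in> hardy_orlicz \<Phi>2 \<Longrightarrow>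
      hardy_norm \<Phi>3 (\<lambda>z. F1 z * F2 z) \<le> ennreal C1 * (hardy_norm \<Phi>1 F1 * hardy_norm \<Phi>2 F2)"
    using hardy_norm_mult_le[OF adm c upper] by blast
  obtain C2 where C2: "C2 > 0" and fact: "\<And>F. F \<in> hardy_orlicz \<Phi>3 \<Longrightarrow>
      \<exists>F1 \<in> hardy_orlicz \<Phi>1. \<exists>F2 \<in> hardy_orlicz \<Phi>2. (\<forall>z \<in> upper_half_plane. F z = F1 z * F2 z) \<and>
        hardy_norm \<Phi>1 F1 * hardy_norm \<Phi>2 F2 \<le> ennreal C2 * hardy_norm \<Phi>3 F"
    using hardy_factorization[OF adm c inv] by blast
  have prod: "(\<lambda>z. F1 z * F2 z) \<in> hardy_orlicz \<Phi>3"
    if F: "F1 \<in> hardy_orlicz \<Phi>1" "F2 \<in> hardy_orlicz \<Phi>2" for F1 F2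
  proof -
    have "ennreal C1 * (hardy_norm \<Phi>1 F1 * hardy_norm \<Phi>2 F2) < \<infinity>"
      using F by (simp add: hardy_orlicz_def ennreal_mult_less_top)
    with hoelder[OF F] have "hardy_norm \<Phi>3 (\<lambda>z. F1 z * F2 z) < \<infinity>" by (rule le_less_trans)
    then show ?thesis using F by (auto simp: hardy_orlicz_def intro!: holomorphic_intros)
  qed
  define C where "C = max C1 C2"
  have C: "C > 0" "C1 \<le> C" "C2 \<le> C" using C1 by (auto simp: C_def)
  have "\<exists>F1 \<in> hardy_orlicz \<Phi>1. \<exists>F2 \<in> hardy_orlicz \<Phi>2. (\<forall>z \<in> upper_half_plane. F z = F1 z * F2 z) \<and>
        ennreal (inverse C) * (hardy_norm \<Phi>1 F1 * hardy_norm \<Phi>2 F2) \<le> hardy_norm \<Phi>3 F \<and>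
        hardy_norm \<Phi>3 F \<le> ennreal C * (hardy_norm \<Phi>1 F1 * hardy_norm \<Phi>2 F2)"
    if F: "F \<in> hardy_orlicz \<Phi>3" for F
  proof -
    obtain F1 F2 where F12: "F1 \<in> hardy_orlicz \<Phi>1" "F2 \<in> hardy_orlicz \<Phi>2"
      and eq: "\<And>z. z \<in> upper_half_plane \<Longrightarrow> F z = F1 z * F2 z"
      and le: "hardy_norm \<Phi>1 F1 * hardy_norm \<Phi>2 F2 \<le> ennreal C2 * hardy_norm \<Phi>3 F"
      using fact[OF F] by blast
    have "hardy_norm \<Phi>1 F1 * hardy_norm \<Phi>2 F2 \<le> ennreal C * hardy_norm \<Phi>3 F"
      using le by (rule order_trans) (intro mult_right_mono ennreal_leI C, simp)
    then have "ennreal (inverse C) * (hardy_norm \<Phi>1 F1 * hardy_norm \<Phi>2 F2)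
        \<le> ennreal (inverse C) * (ennreal C * hardy_norm \<Phi>3 F)" by (rule mult_left_mono) simp
    also have "\<dots> = ennreal (inverse C * C) * hardy_norm \<Phi>3 F"
      using C by (subst ennreal_mult') (auto simp: mult.assoc)
    also have "inverse C * C = 1" using C by simp
    finally have "ennreal (inverse C) * (hardy_norm \<Phi>1 F1 * hardy_norm \<Phi>2 F2) \<le> hardy_norm \<Phi>3 F" by simp
    moreover have "hardy_norm \<Phi>3 F = hardy_norm \<Phi>3 (\<lambda>z. F1 z * F2 z)" using eq by (rule hardy_norm_cong)
    then have "hardy_norm \<Phi>3 F \<le> ennreal C * (hardy_norm \<Phi>1 F1 * hardy_norm \<Phi>2 F2)"
      using order_trans[OF hoelder[OF F12] mult_right_mono[OF ennreal_leI[OF C(2)]]] by simp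
    ultimately show ?thesis using F12 eq by blast
  qed
  then show ?thesis using prod C(1) by blast
qed

end
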